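(* Let $(Y,h)$ be a compact Riemannian manifold. Then there is a formal solution $(g,f)$ on $(0,\infty)\times Y$ of the gradient expanding Ricci soliton equation $$\operatorname{Ric}_g+\operatorname{Hess}_g(f)=-\tfrac12\, g,$$ of the form $$g = dr^2 + r^2 h + h_0 + r^{-2}h_2+\cdots+r^{-2i}h_{2i}+\cdots,$$ $$f = -\tfrac14 r^2 + f_0 + r^{-2}f_2+\cdots+r^{-2i}f_{2i}+\cdots,$$ where, for each $i\ge 0$, $h_{2i}$ is a symmetric $2$-tensor field on $Y$ and $f_{2i}\in C^\infty(Y)$. The formal solution of this form is unique up to adding a constant to $f_0$.
   Context: Here $r$ is the coordinate on $(0,\infty)$, and tensor fields and functions on $Y$ are regarded as tensor fields and functions on $(0,\infty)\times Y$ by pullback. All tensor fields and functions are smooth. The series for $g$ and $f$ are formal series in powers of $r^{-1}$ (with finitely many positive powers of $r$); no convergence is required. Write $g=dr^2+H$ with $H=r^2h+h_0+r^{-2}h_2+\cdots$. Since the leading term $r^2h$ is nondegenerate, $H$ has a formal inverse $H^{-1}=r^{-2}h^{-1}+O(r^{-4})$, and so the components of $\operatorname{Ric}_g+\operatorname{Hess}_g(f)+\frac12 g$ in the decomposition $(0,\infty)\times Y$ (the $rr$ component, the mixed components $rl$, and the components $jk$ tangential to $Y$, with respect to $r$ and local coordinates $x^1,\dots,x^n$ on $Y$) are defined by the usual formulas as formal series in powers of $r^{-1}$, with coefficients that are functions, $1$-forms and symmetric $2$-tensor fields on $Y$, respectively. A "formal solution" means that all coefficients of all these formal series vanish.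
   Formalization: The manifold Y (of dimension at least 1) is not assumed connected, so "up to adding a constant to f_0" is proved as one constant on each connected component of Y; for disconnected Y a single constant would be false, and for connected Y this is the claim as stated. *)

theory Defs
  imports
    "HOL-Analysis.Analysis"
    "HOL-Computational_Algebra.Formal_Laurent_Series"
begin

section \<open>Smooth maps on open subsets of Euclidean space\<close>

definition partial_deriv ::
    "'n::finite \<Rightarrow> (real^'n \<Rightarrow> 'b::real_normed_vector) \<Rightarrow> real^'n \<Rightarrow> 'b" where
  "partial_deriv i f x = frechet_derivative f (at x) (axis i 1)"

text \<open>\<open>Ck_on k S f\<close> is the usual notion \<open>f \<in> C\<^sup>k(S)\<close> for open \<open>S\<close>; it is only used for such \<open>S\<close>.\<close>

primrec Ck_on ::
    "nat \<Rightarrow> (real^'n::finite) set \<Rightarrow> (real^'n \<Rightarrow> 'b::real_normed_vector) \<Rightarrow> bool" where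
  "Ck_on 0 S f \<longleftrightarrow> continuous_on S f"
| "Ck_on (Suc k) S f \<longleftrightarrow>
     (\<forall>x\<in>S. f differentiable (at x)) \<and> (\<forall>i. Ck_on k S (partial_deriv i f))"

definition smooth_on ::
    "(real^'n::finite) set \<Rightarrow> (real^'n \<Rightarrow> 'b::real_normed_vector) \<Rightarrow> bool" where
  "smooth_on S f \<longleftrightarrow> (\<forall>k. Ck_on k S f)"


section \<open>Smooth manifolds, functions and tensor fields\<close>

text \<open>A chart is a pair of its domain and its coordinate map. The values of the coordinate map
  outside the domain are irrelevant.\<close>

type_synonym ('a, 'n) chart = "'a set \<times> ('a \<Rightarrow> real^'n)"

definition chart_dom :: "('a, 'n::finite) chart \<Rightarrow> 'a set" where
  "chart_dom c = fst c"

definition chart_map :: "('a, 'n::finite) chart \<Rightarrow> 'a \<Rightarrow> real^'n" where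
  "chart_map c = snd c"

definition chart_image :: "('a, 'n::finite) chart \<Rightarrow> (real^'n) set" where
  "chart_image c = chart_map c ` chart_dom c"

definition chart_inv :: "('a, 'n::finite) chart \<Rightarrow> real^'n \<Rightarrow> 'a" where
  "chart_inv c = inv_into (chart_dom c) (chart_map c)"

definition transition :: "('a, 'n::finite) chart \<Rightarrow> ('a, 'n) chart \<Rightarrow> real^'n \<Rightarrow> real^'n" where
  "transition c d = chart_map c \<circ> chart_inv d"

text \<open>A smooth manifold (without boundary, not necessarily connected) of dimension \<open>CARD('n)\<close>,
  with smooth structure given by an atlas \<open>A\<close> that need not be maximal.\<close>

definition smooth_manifold :: "'a topology \<Rightarrow> ('a, 'n::finite) chart set \<Rightarrow> bool" where
  "smooth_manifold X A \<longleftrightarrow>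
     Hausdorff_space X \<and> second_countable X \<and>
     (\<Union>c\<in>A. chart_dom c) = topspace X \<and>
     (\<forall>c\<in>A. openin X (chart_dom c) \<and> open (chart_image c) \<and>
        homeomorphic_map (subtopology X (chart_dom c)) (top_of_set (chart_image c)) (chart_map c)) \<and>
     (\<forall>c\<in>A. \<forall>d\<in>A. smooth_on (chart_map d ` (chart_dom c \<inter> chart_dom d)) (transition c d))"

definition smooth_function :: "('a, 'n::finite) chart set \<Rightarrow> ('a \<Rightarrow> real) \<Rightarrow> bool" where
  "smooth_function A f \<longleftrightarrow> (\<forall>c\<in>A. smooth_on (chart_image c) (f \<circ> chart_inv c))"

text \<open>A covariant 2-tensor field is given by its component matrices in every chart of the atlas, as
  functions of the coordinates, subject to the transformation law for covariant tensors. The values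
  \<open>T c x\<close> for \<open>c \<notin> A\<close> or \<open>x \<notin> chart_image c\<close> carry no meaning.\<close>

type_synonym ('a, 'n) tensor2 = "('a, 'n) chart \<Rightarrow> real^'n \<Rightarrow> real^'n^'n"

definition sym_tensor_field :: "('a, 'n::finite) chart set \<Rightarrow> ('a, 'n) tensor2 \<Rightarrow> bool" where
  "sym_tensor_field A T \<longleftrightarrow>
     (\<forall>c\<in>A. smooth_on (chart_image c) (T c)) \<and>
     (\<forall>c\<in>A. \<forall>x\<in>chart_image c. \<forall>i j. T c x $ i $ j = T c x $ j $ i) \<and>
     (\<forall>c\<in>A. \<forall>d\<in>A. \<forall>p\<in>chart_dom c \<inter> chart_dom d. \<forall>a b.
        T d (chart_map d p) $ a $ b =
          (\<Sum>i\<in>UNIV. \<Sum>j\<in>UNIV. T c (chart_map c p) $ i $ j *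
             partial_deriv a (transition c d) (chart_map d p) $ i *
             partial_deriv b (transition c d) (chart_map d p) $ j))"

definition riemannian_metric :: "('a, 'n::finite) chart set \<Rightarrow> ('a, 'n) tensor2 \<Rightarrow> bool" where
  "riemannian_metric A h \<longleftrightarrow>
     sym_tensor_field A h \<and>
     (\<forall>c\<in>A. \<forall>x\<in>chart_image c. \<forall>v. v \<noteq> 0 \<longrightarrow> v \<bullet> (h c x *v v) > 0)"


section \<open>Formal curvature calculus on \<open>(0,\<infinity>) \<times> Y\<close> in local coordinates\<close>

text \<open>Formal series in powers of \<open>1/r\<close> with finitely many positive powers of \<open>r\<close> are formal
  Laurent series in the variable \<open>X = 1/r\<close>, so \<open>fls_nth F k\<close> is the coefficient of \<open>r\<^sup>-\<^sup>k\<close> and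
  \<open>r = fls_X_inv\<close>. A formal series whose coefficients are functions of the coordinates
  \<open>x\<^sup>1,\<dots>,x\<^sup>n\<close> is a map \<open>real^'n \<Rightarrow> real fls\<close>. The coordinates \<open>r, x\<^sup>1,\<dots>,x\<^sup>n\<close> are indexed by
  \<open>'n option\<close>, with \<open>None\<close> for \<open>r\<close> and \<open>Some i\<close> for \<open>x\<^sup>i\<close>.

  Derivatives are taken formally: those in \<open>x\<^sup>i\<close> coefficientwise, while
  \<open>d/dr = - X\<^sup>2 d/dX\<close>. In the coefficientwise case \<open>Abs_fls\<close> is applied to a sequence of the required
  kind as soon as the order of the pole of \<open>F\<close> is bounded near \<open>x\<close>; this is the case for all
  series below.\<close>

fun formal_deriv ::
    "'n::finite option \<Rightarrow> (real^'n \<Rightarrow> real fls) \<Rightarrow> real^'n \<Rightarrow> real fls" where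
  "formal_deriv None F x = - (fls_X ^ 2 * fls_deriv (F x))"
| "formal_deriv (Some i) F x = Abs_fls (\<lambda>k. partial_deriv i (\<lambda>y. fls_nth (F y) k) x)"

type_synonym 'n formal_metric = "real^'n \<Rightarrow> (real fls)^('n option)^('n option)"

text \<open>\<open>christoffel g a b c\<close> is \<open>\<Gamma>\<^sup>a\<^sub>b\<^sub>c\<close>. The matrix inverse is taken over the field of Laurent series.\<close>

definition christoffel ::
    "'n::finite formal_metric \<Rightarrow> 'n option \<Rightarrow> 'n option \<Rightarrow> 'n option \<Rightarrow> real^'n \<Rightarrow> real fls" where
  "christoffel g a b c x = fls_const (1/2) *
     (\<Sum>d\<in>UNIV. matrix_inv (g x) $ a $ d *
        (formal_deriv b (\<lambda>y. g y $ d $ c) x + formal_deriv c (\<lambda>y. g y $ d $ b) x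
         - formal_deriv d (\<lambda>y. g y $ b $ c) x))"

definition ricci ::
    "'n::finite formal_metric \<Rightarrow> 'n option \<Rightarrow> 'n option \<Rightarrow> real^'n \<Rightarrow> real fls" where
  "ricci g b c x =
     (\<Sum>a\<in>UNIV. formal_deriv a (christoffel g a b c) x - formal_deriv b (christoffel g a a c) x
        + (\<Sum>e\<in>UNIV. christoffel g a a e x * christoffel g e b c x
                     - christoffel g a b e x * christoffel g e a c x))"

definition hessian ::
    "'n::finite formal_metric \<Rightarrow> (real^'n \<Rightarrow> real fls) \<Rightarrow> 'n option \<Rightarrow> 'n option \<Rightarrow> real^'n \<Rightarrow> real fls"
  where
  "hessian g f b c x =
     formal_deriv b (formal_deriv c f) x - (\<Sum>a\<in>UNIV. christoffel g a b c x * formal_deriv a f x)"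


section \<open>Formal expanding solitons\<close>

text \<open>\<open>even_series u\<close> is \<open>u\<^sub>0 + r\<^sup>-\<^sup>2 u\<^sub>1 + r\<^sup>-\<^sup>4 u\<^sub>2 + \<cdots>\<close>.\<close>

definition even_series :: "(nat \<Rightarrow> real) \<Rightarrow> real fls" where
  "even_series u = fps_to_fls (Abs_fps (\<lambda>k. if even k then u (k div 2) else 0))"

text \<open>In the following, \<open>hs i\<close> and \<open>fs i\<close> stand for \<open>h\<^sub>2\<^sub>i\<close> and \<open>f\<^sub>2\<^sub>i\<close>. These are the expressions in
  the chart \<open>c\<close> of
  \<open>g = dr\<^sup>2 + r\<^sup>2 h + h\<^sub>0 + r\<^sup>-\<^sup>2 h\<^sub>2 + \<cdots>\<close> and \<open>f = - r\<^sup>2/4 + f\<^sub>0 + r\<^sup>-\<^sup>2 f\<^sub>2 + \<cdots>\<close>.\<close>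

definition soliton_metric ::
    "('a, 'n::finite) tensor2 \<Rightarrow> (nat \<Rightarrow> ('a, 'n) tensor2) \<Rightarrow> ('a, 'n) chart \<Rightarrow> 'n formal_metric" where
  "soliton_metric h hs c x =
     (\<chi> a b. case (a, b) of
        (None, None) \<Rightarrow> 1
      | (Some i, Some j) \<Rightarrow>
          fls_X_inv ^ 2 * fls_const (h c x $ i $ j) + even_series (\<lambda>k. hs k c x $ i $ j)
      | _ \<Rightarrow> 0)"

definition soliton_potential ::
    "(nat \<Rightarrow> 'a \<Rightarrow> real) \<Rightarrow> ('a, 'n::finite) chart \<Rightarrow> real^'n \<Rightarrow> real fls" where
  "soliton_potential fs c x =
     fls_const (- 1/4) * fls_X_inv ^ 2 + even_series (\<lambda>k. fs k (chart_inv c x))"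

definition formal_expanding_soliton ::
    "('a, 'n::finite) chart set \<Rightarrow> ('a, 'n) tensor2 \<Rightarrow>
     (nat \<Rightarrow> ('a, 'n) tensor2) \<Rightarrow> (nat \<Rightarrow> 'a \<Rightarrow> real) \<Rightarrow> bool" where
  "formal_expanding_soliton A h hs fs \<longleftrightarrow>
     (\<forall>i. sym_tensor_field A (hs i)) \<and> (\<forall>i. smooth_function A (fs i)) \<and>
     (\<forall>c\<in>A. \<forall>x\<in>chart_image c. \<forall>a b.
        ricci (soliton_metric h hs c) a b x
          + hessian (soliton_metric h hs c) (soliton_potential fs c) a b x
        = fls_const (- 1/2) * soliton_metric h hs c x $ a $ b)"

end

theory Submission
  imports Defs
begin

text \<open>Let \<open>E = Ric + Hess f + g/2\<close> and \<open>X = 1/r\<close>. If \<open>h\<^sub>2\<^sub>m\<close> and \<open>f\<^sub>2\<^sub>m\<close> are the first coefficients that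
  are not yet known, then \<open>f\<^sub>2\<^sub>m\<close> enters \<open>E\<^sub>r\<^sub>r\<close> first in the term \<open>2m(2m + 1) f\<^sub>2\<^sub>m X\<^bsup>2m+2\<^esup>\<close>, and, once \<open>f\<^sub>2\<^sub>m\<close> is fixed,
  \<open>h\<^sub>2\<^sub>m\<close> enters \<open>E\<^sub>j\<^sub>k\<close> first in the term \<open>(m + 1)/2 h\<^sub>2\<^sub>m X\<^bsup>2m\<^esup>\<close> and \<open>E\<^sub>r\<^sub>r\<close> only at order \<open>2m + 4\<close>.
  So for a given \<open>f\<^sub>0\<close> the \<open>rr\<close> and \<open>jk\<close> equations determine all coefficients recursively, and the coefficient
  of \<open>X\<close> in the \<open>rl\<close> equation is \<open>- \<partial>\<^sub>l f\<^sub>0\<close>, which forces \<open>f\<^sub>0\<close> to be locally constant.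
  Odd powers of \<open>X\<close> vanish in \<open>E\<^sub>r\<^sub>r\<close> and \<open>E\<^sub>j\<^sub>k\<close> because the ansatz is invariant under \<open>r \<mapsto> - r\<close>, and the
  coefficients obtained are tensors on \<open>Y\<close> because \<open>E\<close> is natural under changes of coordinates.

  The remaining \<open>rl\<close> equation follows from the Bianchi identity: \<open>2 div E - 2 E(\<nabla>f)\<close> is the differential of
  \<open>R + 2 \<Delta>f - |\<nabla>f|\<^sup>2 - f\<close>, hence closed. If \<open>\<omega>\<^sub>l = E\<^sub>r\<^sub>l\<close> is the only nonzero component of \<open>E\<close> and starts with
  \<open>X\<^sup>p\<close>, closedness gives \<open>(1 - p) \<omega> = 0\<close> for the leading coefficient, and \<open>p = 1\<close> is excluded by \<open>df\<^sub>0 = 0\<close>.\<close>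

text \<open>The operator E is never expanded in full. Two sets of data that agree up to some order
  are compared instead, and in the difference every product gains orders of X unless one of the
  growing quantities is involved: H of size r^2, Gamma^r_jk of size r, and f' = -r/2 + .... This is
  the origin of the constants: 2m(2m + 1) comes from the second derivative of r^(-2m), and (m + 1)/2
  = m/2 + 1/2 is the contribution of -Gamma^r_jk f' plus that of g/2. The first constant vanishes
  for m = 0, so the rr equation leaves f_0 free; the second never vanishes. The recursion can start
  because the exact cone already solves the equation to the required order: E_rr begins at X^3 and
  E_jk at X^0. It is again the growth of f' that makes E(grad f) dominate div E in the Bianchi
  identity and isolates the leading mixed coefficient. Since Y may be disconnected, the constant
  that may be added to f_0 is one constant for each connected component.\<close>

no_notation fps_nth (infixl \<open>$\<close> 75)
notation fls_nth (infixl \<open>$$\<close> 75)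

section \<open>Tensor calculus over a ring with commuting derivations\<close>

lemma matrix_diff_ldistrib: "A ** (B - C) = A ** B - A ** (C :: 'a::ring_1^'n^'m)"
  by (simp add: matrix_matrix_mult_def vec_eq_iff right_diff_distrib sum_subtractf)

lemma matrix_diff_rdistrib: "(A - B) ** C = A ** C - B ** (C :: 'a::ring_1^'n^'m)"
  by (simp add: matrix_matrix_mult_def vec_eq_iff left_diff_distrib sum_subtractf)

lemma matrix_add_rdistrib: "(A + B) ** C = A ** C + B ** (C :: 'a::ring_1^'n^'m)"
  by (simp add: matrix_matrix_mult_def vec_eq_iff distrib_right sum.distrib)

lemma matrix_minus_left: "(- A) ** C = - (A ** (C :: 'a::ring_1^'n^'m))"
  by (simp add: matrix_matrix_mult_def vec_eq_iff sum_negf)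

lemma matrix_minus_right: "A ** (- C) = - (A ** (C :: 'a::ring_1^'n^'m))"
  by (simp add: matrix_matrix_mult_def vec_eq_iff sum_negf)

lemma transpose_add: "transpose (A + B) = transpose A + transpose (B :: 'a::ring_1^'n^'m)"
  by (simp add: transpose_def vec_eq_iff)

lemma transpose_diff: "transpose (A - B) = transpose A - transpose (B :: 'a::ring_1^'n^'m)"
  by (simp add: transpose_def vec_eq_iff)

lemmas matrix_algebra = matrix_add_ldistrib matrix_add_rdistrib matrix_diff_ldistrib
  matrix_diff_rdistrib matrix_minus_left matrix_minus_right matrix_mul_assoc

lemma matrix_mult_nth: "(A ** B) $ i $ j = (\<Sum>k\<in>UNIV. A $ i $ k * B $ k $ j)"
  by (simp add: matrix_matrix_mult_def)

definition mderiv :: "('i \<Rightarrow> 'a \<Rightarrow> 'a) \<Rightarrow> 'i \<Rightarrow> 'a^'m^'k \<Rightarrow> 'a^'m^'k" where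
  "mderiv D a M = (\<chi> i j. D a (M $ i $ j))"

lemma mderiv_nth [simp]: "mderiv D a M $ i $ j = D a (M $ i $ j)"
  by (simp add: mderiv_def)

text \<open>\<open>connection hf D g P b\<close> is the matrix \<open>(\<Gamma>\<^sup>a\<^sub>b\<^sub>c)\<close> with row index \<open>a\<close> and column index \<open>c\<close>;
  here \<open>hf\<close> is one half and \<open>P\<close> is the inverse of \<open>g\<close>.\<close>

definition connection ::
    "'a \<Rightarrow> ('i::finite \<Rightarrow> 'a \<Rightarrow> 'a) \<Rightarrow> 'a::comm_ring_1^'i^'i \<Rightarrow> 'a^'i^'i \<Rightarrow> 'i \<Rightarrow> 'a^'i^'i" where
  "connection hf D g P b =
     (\<chi> a c. hf * (\<Sum>d\<in>UNIV. P $ a $ d * (D b (g $ d $ c) + D c (g $ d $ b) - D d (g $ b $ c))))"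

text \<open>The commutator of the operators \<open>D a + G a\<close> and \<open>D b + G b\<close> on
  column vectors; the entry in row k and column l is R^k_{l ab}.\<close>

definition curv :: "('i::finite \<Rightarrow> 'a \<Rightarrow> 'a) \<Rightarrow> ('i \<Rightarrow> 'a::comm_ring_1^'i^'i) \<Rightarrow> 'i \<Rightarrow> 'i \<Rightarrow> 'a^'i^'i" where
  "curv D G a b = mderiv D a (G b) - mderiv D b (G a) + G a ** G b - G b ** G a"

definition ric :: "('i::finite \<Rightarrow> 'a \<Rightarrow> 'a) \<Rightarrow> ('i \<Rightarrow> 'a::comm_ring_1^'i^'i) \<Rightarrow> 'i \<Rightarrow> 'i \<Rightarrow> 'a" where
  "ric D G b c = (\<Sum>a\<in>UNIV. curv D G a b $ a $ c)"

definition hess :: "('i::finite \<Rightarrow> 'a \<Rightarrow> 'a) \<Rightarrow> ('i \<Rightarrow> 'a::comm_ring_1^'i^'i) \<Rightarrow> 'a \<Rightarrow> 'i \<Rightarrow> 'i \<Rightarrow> 'a" where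
  "hess D G f b c = D b (D c f) - (\<Sum>a\<in>UNIV. G b $ a $ c * D a f)"

text \<open>Multiplication by \<open>g\<close> cancels \<open>P\<close> and leaves the Christoffel
  symbols of the first kind, from which metric compatibility is read off.\<close>

lemma connection_lower:
  fixes g P :: "'a::comm_ring_1^'i::finite^'i"
  assumes "g ** P = mat 1"
  shows "(g ** connection hf D g P b) $ e $ c = hf * (D b (g $ e $ c) + D c (g $ e $ b) - D e (g $ b $ c))"
proof -
  define v where "v d = D b (g $ d $ c) + D c (g $ d $ b) - D d (g $ b $ c)" for d
  have "(g ** connection hf D g P b) $ e $ c = (\<Sum>k\<in>UNIV. g $ e $ k * (hf * (\<Sum>d\<in>UNIV. P $ k $ d * v d)))"
    by (simp add: matrix_mult_nth connection_def v_def)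
  also have "\<dots> = (\<Sum>k\<in>UNIV. \<Sum>d\<in>UNIV. hf * (g $ e $ k * P $ k $ d * v d))"
    by (simp add: sum_distrib_left mult_ac)
  also have "\<dots> = (\<Sum>d\<in>UNIV. \<Sum>k\<in>UNIV. hf * (g $ e $ k * P $ k $ d * v d))"
    by (rule sum.swap)
  also have "\<dots> = (\<Sum>d\<in>UNIV. hf * ((g ** P) $ e $ d * v d))"
    by (simp add: matrix_mult_nth sum_distrib_left sum_distrib_right mult_ac)
  also have "\<dots> = hf * v e"
    using sum.delta[of UNIV e "\<lambda>d. hf * v d"] unfolding assms mat_def
    by (simp add: if_distrib if_distribR cong: if_cong)
  finally show ?thesis by (simp add: v_def)
qed

lemma connection_sym:
  assumes "\<And>i j. g $ i $ j = g $ j $ i"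
  shows "connection hf D g P b $ a $ c = connection hf D g P c $ a $ b"
  by (simp add: connection_def assms[of b c] add.commute)

lemma connection_compatible:
  fixes g P :: "'a::comm_ring_1^'i::finite^'i"
  assumes "g ** P = mat 1" and sym: "\<And>i j. g $ i $ j = g $ j $ i" and hf: "hf + hf = 1"
  shows "mderiv D b g = g ** connection hf D g P b + transpose (connection hf D g P b) ** g"
proof -
  have *: "(transpose (connection hf D g P b) ** g) $ e $ c = (g ** connection hf D g P b) $ c $ e" for e c
    by (simp add: matrix_mult_nth transpose_def sym[of c] mult.commute)
  have "hf * (x + y - z) + hf * (x + z - y) = x" for x y z :: 'a
  proof -
    have "hf * (x + y - z) + hf * (x + z - y) = (hf + hf) * x" by (simp add: algebra_simps)
    then show ?thesis by (simp add: hf)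
  qed
  then show ?thesis
    by (simp add: vec_eq_iff * connection_lower[OF assms(1)]) (metis sym)
qed

text \<open>The Koszul argument: symmetry and compatibility express the lowered symbols
  \<open>L\<close> through derivatives of \<open>g\<close>. It serves the change of frame, where the
  transformed connection is recognized by these two properties.\<close>

lemma connection_unique:
  fixes g P :: "'a::comm_ring_1^'i::finite^'i"
  assumes "P ** g = mat 1" and sym: "\<And>i j. g $ i $ j = g $ j $ i" and hf: "hf + hf = 1"
    and tf: "\<And>a b c. G b $ a $ c = G c $ a $ b"
    and compat: "\<And>b. mderiv D b g = g ** G b + transpose (G b) ** g"
  shows "G b = connection hf D g P b"
proof -
  define L where "L b = g ** G b" for b
  have tL: "(transpose (G b) ** g) $ e $ c = L b $ c $ e" for b e c
    by (simp add: L_def matrix_mult_nth transpose_def sym[of c] mult.commute)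
  have Lsym: "L b $ e $ c = L c $ e $ b" for b e c
    by (simp add: L_def matrix_mult_nth tf[of b _ c])
  have DL: "D b (g $ e $ c) = L b $ e $ c + L b $ c $ e" for b e c
    using arg_cong[OF compat[of b], of "\<lambda>M. M $ e $ c"] by (simp add: tL) (simp add: L_def)
  have "D b (g $ d $ c) + D c (g $ d $ b) - D d (g $ b $ c) = L b $ d $ c + L b $ d $ c" for b c d
    unfolding DL by (simp add: Lsym[of b c d] Lsym[of c b d] Lsym[of c d b])
  moreover have "hf * (x * (y + y)) = x * y" for x y :: 'a
  proof -
    have "hf * (x * (y + y)) = (hf + hf) * (x * y)" by (simp add: algebra_simps)
    then show ?thesis by (simp add: hf)
  qed
  ultimately have "connection hf D g P b = P ** L b" for b
    by (simp add: connection_def vec_eq_iff matrix_mult_nth sum_distrib_left)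
  also have "P ** L b = G b" for b
    by (simp add: L_def matrix_mul_assoc assms(1))
  finally show ?thesis ..
qed

text \<open>Germs do not form a field, so \<open>hf\<close> provides the one division that the
  calculus needs. It also excludes 2-torsion, on which the arguments with antisymmetric sums
  rest.\<close>

locale derivations =
  fixes D :: "'i::finite \<Rightarrow> 'a::comm_ring_1 \<Rightarrow> 'a" and hf :: 'a
  assumes D_add: "D a (x + y) = D a x + D a y"
    and D_mult: "D a (x * y) = D a x * y + x * D a y"
    and D_comm: "D a (D b x) = D b (D a x)"
    and hf: "hf + hf = 1"
begin

lemma D_0 [simp]: "D a 0 = 0"
  using D_add[of a 0 0] by simp

lemma D_1 [simp]: "D a 1 = 0"
  using D_mult[of a 1 1] by simp

lemma D_minus: "D a (- x) = - D a x"
  using D_add[of a x "- x"] by (simp add: eq_neg_iff_add_eq_0 add.commute)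

lemma D_diff: "D a (x - y) = D a x - D a y"
  using D_add[of a x "- y"] by (simp add: D_minus)

lemma D_sum: "D a (sum f S) = (\<Sum>x\<in>S. D a (f x))"
  by (induction S rule: infinite_finite_induct) (simp_all add: D_add)

lemma cancel_double: "x + x = (0::'a) \<Longrightarrow> x = 0"
proof -
  assume "x + x = 0"
  moreover have "hf * (x + x) = (hf + hf) * x" by (simp add: algebra_simps)
  ultimately show ?thesis by (simp add: hf)
qed

lemma mderiv_mult: "mderiv D a (M ** N) = mderiv D a M ** N + M ** mderiv D a N"
  by (simp add: vec_eq_iff matrix_mult_nth D_sum D_mult sum.distrib)

lemma mderiv_add: "mderiv D a (M + N) = mderiv D a M + mderiv D a N"
  by (simp add: vec_eq_iff D_add)

lemma mderiv_diff: "mderiv D a (M - N) = mderiv D a M - mderiv D a N"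
  by (simp add: vec_eq_iff D_diff)

lemma mderiv_minus: "mderiv D a (- M) = - mderiv D a M"
  by (simp add: vec_eq_iff D_minus)

lemma mderiv_transpose: "mderiv D a (transpose M) = transpose (mderiv D a M)"
  by (simp add: vec_eq_iff transpose_def)

lemma mderiv_mat [simp]: "mderiv D a (mat 1) = 0"
  by (simp add: vec_eq_iff mat_def)

lemma mderiv_comm: "mderiv D a (mderiv D b M) = mderiv D b (mderiv D a M)"
  by (simp add: vec_eq_iff D_comm[of a b])

lemma mderiv_inverse:
  assumes "P ** g = mat 1" "g ** P = mat 1"
  shows "mderiv D a P = - (P ** mderiv D a g ** P)"
proof -
  have "0 = mderiv D a (P ** g) ** P" by (simp add: assms)
  also have "\<dots> = mderiv D a P + P ** mderiv D a g ** P"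
    by (simp add: mderiv_mult matrix_add_rdistrib assms(2) flip: matrix_mul_assoc)
  finally show ?thesis by (simp add: eq_neg_iff_add_eq_0)
qed

lemma curv_antisym: "curv D G a b = - curv D G b a"
  by (simp add: curv_def)

text \<open>The Jacobi identity for the operators \<open>D a + G a\<close>, whose commutators are
  the matrices \<open>curv\<close>. Connection terms for the form indices do not appear; for
  symmetric \<open>G\<close> they would cancel in the cyclic sum.\<close>

lemma second_Bianchi:
  "(mderiv D a (curv D G b c) + G a ** curv D G b c - curv D G b c ** G a)
   + (mderiv D b (curv D G c a) + G b ** curv D G c a - curv D G c a ** G b)
   + (mderiv D c (curv D G a b) + G c ** curv D G a b - curv D G a b ** G c) = 0"
  unfolding curv_def
  by (simp add: mderiv_add mderiv_diff mderiv_mult matrix_algebra mderiv_comm[of b a]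
      mderiv_comm[of c a] mderiv_comm[of c b])

end

section \<open>Symmetries of the curvature of a metric\<close>

locale levi_civita = derivations D hf
  for D :: "'i::finite \<Rightarrow> 'a::comm_ring_1 \<Rightarrow> 'a" and hf +
  fixes g P :: "'a^'i^'i"
  assumes gP: "g ** P = mat 1" and Pg: "P ** g = mat 1" and g_sym: "g $ i $ j = g $ j $ i"
begin

abbreviation G where "G \<equiv> connection hf D g P"

lemma G_sym: "G b $ a $ c = G c $ a $ b"
  using connection_sym g_sym by metis

lemma mderiv_g: "mderiv D b g = g ** G b + transpose (G b) ** g"
  by (rule connection_compatible) (use gP g_sym hf in auto)

text \<open>The inverse metric is parallel. Every later step that raises an index under a derivative
  rests on this.\<close>

lemma mderiv_P: "mderiv D b P = - (G b ** P) - P ** transpose (G b)"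
proof -
  have "P ** mderiv D b g ** P = (P ** g) ** G b ** P + P ** transpose (G b) ** (g ** P)"
    by (simp add: mderiv_g matrix_algebra)
  then show ?thesis
    by (subst mderiv_inverse[OF Pg gP]) (simp add: gP Pg)
qed

lemma P_sym: "P $ i $ j = P $ j $ i"
proof -
  have tg: "transpose g = g" by (simp add: transpose_def vec_eq_iff g_sym)
  have "transpose P ** g = mat 1"
    by (metis gP matrix_transpose_mul tg transpose_mat)
  then have "transpose P = P"
    by (metis gP matrix_mul_assoc matrix_mul_lid matrix_mul_rid)
  then show ?thesis by (metis (no_types, lifting) transpose_def vec_lambda_beta)
qed

text \<open>Because \<open>P\<close> is parallel, the commutator of two derivatives of
  \<open>P\<close>, which is 0, equals minus the action of the curvature on
  \<open>P\<close>.\<close>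

lemma curv_P_transpose: "curv D G a b ** P + P ** transpose (curv D G a b) = 0"
proof -
  have "mderiv D a (mderiv D b P) - mderiv D b (mderiv D a P) = - (curv D G a b ** P + P ** transpose (curv D G a b))"
    unfolding curv_def
    by (simp add: mderiv_P mderiv_add mderiv_diff mderiv_minus mderiv_mult mderiv_transpose matrix_algebra
        transpose_add transpose_diff matrix_transpose_mul)
  then have "- (curv D G a b ** P + P ** transpose (curv D G a b)) = 0"
    by (simp only: mderiv_comm[of a b] diff_self)
  then show ?thesis by (simp only: neg_equal_0_iff_equal)
qed

text \<open>With its second matrix index raised the curvature is antisymmetric in both index pairs,
  and the contractions below become plain sums without the metric.\<close>

definition S where "S a b = curv D G a b ** P"

lemma S_antisym_upper: "S a b $ d $ e = - S a b $ e $ d"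
proof -
  have "transpose (S a b) = P ** transpose (curv D G a b)"
    by (simp add: S_def matrix_transpose_mul) (simp add: transpose_def P_sym)
  then have "S a b + transpose (S a b) = 0"
    using curv_P_transpose by (simp add: S_def)
  then have "S a b $ d $ e + transpose (S a b) $ d $ e = 0"
    by (metis vector_add_component zero_index)
  then show ?thesis by (simp add: transpose_def eq_neg_iff_add_eq_0)
qed

lemma S_antisym_lower: "S a b $ d $ e = - S b a $ d $ e"
  unfolding S_def by (subst curv_antisym) (simp add: matrix_minus_left)

text \<open>Antisymmetry of \<open>curv ** P\<close> makes \<open>curv\<close> conjugate to minus
  its transpose, so its trace is its own negative.\<close>

lemma curv_trace: "(\<Sum>k\<in>UNIV. curv D G a b $ k $ k) = 0"
proof -
  have "curv D G a b = curv D G a b ** P ** g"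
    by (simp add: Pg flip: matrix_mul_assoc)
  also have "\<dots> = - (P ** transpose (curv D G a b) ** g)"
    using curv_P_transpose[of a b] by (metis eq_neg_iff_add_eq_0 matrix_minus_left)
  finally have "trace (curv D G a b) = trace (- (P ** transpose (curv D G a b) ** g))" by simp
  also have "\<dots> = - trace (P ** transpose (curv D G a b) ** g)"
    by (simp add: trace_def sum_negf)
  also have "trace (P ** transpose (curv D G a b) ** g) = trace (g ** P ** transpose (curv D G a b))"
    by (metis matrix_mul_assoc trace_mul_sym)
  also have "\<dots> = trace (curv D G a b)"
    by (simp add: gP trace_def transpose_def)
  finally have "trace (curv D G a b) + trace (curv D G a b) = 0" by simp
  then have "trace (curv D G a b) = 0" by (rule cancel_double)
  then show ?thesis by (simp add: trace_def)
qed

lemma ric_expand: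
  "ric D G b c = (\<Sum>a\<in>UNIV. D a (G b $ a $ c)) - (\<Sum>a\<in>UNIV. D b (G a $ a $ c))
     + (\<Sum>a\<in>UNIV. \<Sum>e\<in>UNIV. G a $ a $ e * G b $ e $ c) - (\<Sum>a\<in>UNIV. \<Sum>e\<in>UNIV. G b $ a $ e * G a $ e $ c)"
  by (simp add: ric_def curv_def matrix_mult_nth sum.distrib sum_subtractf)

text \<open>In \<open>ric_expand\<close> only the terms D_b Gamma^a_{ac} are not symmetric by
  \<open>G_sym\<close> and a swap of summation indices. Their antisymmetric part is the trace of
  \<open>curv D G b c\<close>, since commutators of matrices have trace 0. This replaces the first
  Bianchi identity.\<close>

lemma ric_sym: "ric D G b c = ric D G c b"
proof -
  have "(\<Sum>k\<in>UNIV. (G b ** G c) $ k $ k) = (\<Sum>k\<in>UNIV. (G c ** G b) $ k $ k)"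
    using trace_mul_sym[of "G b" "G c"] by (simp add: trace_def)
  then have "(\<Sum>k\<in>UNIV. D b (G c $ k $ k)) - (\<Sum>k\<in>UNIV. D c (G b $ k $ k)) = 0"
    using curv_trace[of b c] by (simp add: curv_def sum.distrib sum_subtractf)
  moreover have "(\<Sum>a\<in>UNIV. \<Sum>e\<in>UNIV. G b $ a $ e * G a $ e $ c) = (\<Sum>a\<in>UNIV. \<Sum>e\<in>UNIV. G c $ a $ e * G a $ e $ b)"
    by (subst sum.swap) (intro sum.cong refl, metis G_sym mult.commute)
  moreover have "G a $ a $ c = G c $ a $ a" "G a $ a $ b = G b $ a $ a" "G b $ a $ c = G c $ a $ b" for a
    by (rule G_sym)+
  ultimately show ?thesis
    unfolding ric_expand by (simp add: algebra_simps)
qed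

lemma hess_sym: "hess D G f b c = hess D G f c b"
  by (simp add: hess_def D_comm[of b c] G_sym[of b _ c])

section \<open>Divergence and the contracted Bianchi identity\<close>

definition raise :: "('i \<Rightarrow> 'i \<Rightarrow> 'a) \<Rightarrow> 'i \<Rightarrow> 'i \<Rightarrow> 'a" where
  "raise T b e = (\<Sum>c\<in>UNIV. T b c * P $ c $ e)"

text \<open>The covariant divergence over the upper index \<open>e\<close> of a tensor whose first
  index \<open>b\<close> is lower.\<close>

definition dvg :: "('i \<Rightarrow> 'i \<Rightarrow> 'a) \<Rightarrow> 'i \<Rightarrow> 'a" where
  "dvg T b = (\<Sum>e\<in>UNIV. D e (T b e)) + (\<Sum>e\<in>UNIV. \<Sum>c\<in>UNIV. G e $ e $ c * T b c)
     - (\<Sum>e\<in>UNIV. \<Sum>c\<in>UNIV. G b $ c $ e * T c e)"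

lemma raise_ric: "raise (ric D G) b e = (\<Sum>a\<in>UNIV. S a b $ a $ e)"
  by (simp add: raise_def ric_def S_def matrix_mult_nth sum_distrib_right) (rule sum.swap)

definition scal where "scal = (\<Sum>b\<in>UNIV. raise (ric D G) b b)"

text \<open>Since \<open>P\<close> is parallel, raising commutes with covariant differentiation, and
  the identity for \<open>curv\<close> may be multiplied by \<open>P\<close>.\<close>

lemma second_Bianchi_S:
  "(mderiv D a (S b c) + G a ** S b c + S b c ** transpose (G a))
   + (mderiv D b (S c a) + G b ** S c a + S c a ** transpose (G b))
   + (mderiv D c (S a b) + G c ** S a b + S a b ** transpose (G c)) = 0"
proof -
  have "mderiv D a (S b c) + G a ** S b c + S b c ** transpose (G a)
     = (mderiv D a (curv D G b c) + G a ** curv D G b c - curv D G b c ** G a) ** P" for a b c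
    unfolding S_def mderiv_mult mderiv_P
    by (simp add: matrix_algebra)
  then show ?thesis
    using arg_cong[OF second_Bianchi[of a G b c], of "\<lambda>M. M ** P"]
    by (simp add: matrix_add_rdistrib)
qed

lemma sum_sym_antisym:
  assumes "\<And>i j. s i j = s j i" "\<And>i j. t i j = - t j (i::'i)"
  shows "(\<Sum>i\<in>UNIV. \<Sum>j\<in>UNIV. s i j * t i j) = (0::'a)"
proof -
  define x where "x = (\<Sum>i\<in>UNIV. \<Sum>j\<in>UNIV. s i j * t i j)"
  have "x = (\<Sum>i\<in>UNIV. \<Sum>j\<in>UNIV. s j i * t j i)" unfolding x_def by (rule sum.swap)
  also have "\<dots> = (\<Sum>i\<in>UNIV. \<Sum>j\<in>UNIV. - (s i j * t i j))"
    by (intro sum.cong refl) (metis assms mult_minus_right)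
  also have "\<dots> = - x" by (simp add: sum_negf x_def)
  finally have "x + x = 0" by (simp add: eq_neg_iff_add_eq_0)
  then show ?thesis using cancel_double x_def by blast
qed

text \<open>The matrix indices of the cyclic sum are contracted with \<open>a\<close> and
  \<open>b\<close>. Two summands then give minus the divergence and the third gives the derivative
  of \<open>scal\<close>, each up to connection terms.\<close>

lemma contracted_Bianchi: "dvg (raise (ric D G)) c + dvg (raise (ric D G)) c = D c scal"
proof -
  let ?R = "raise (ric D G)"
  define T where "T a b c = mderiv D a (S b c) + G a ** S b c + S b c ** transpose (G a)" for a b c
  have sum0: "(\<Sum>a\<in>UNIV. \<Sum>b\<in>UNIV. T a b c $ a $ b) + (\<Sum>a\<in>UNIV. \<Sum>b\<in>UNIV. T b c a $ a $ b)
      + (\<Sum>a\<in>UNIV. \<Sum>b\<in>UNIV. T c a b $ a $ b) = 0"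
  proof -
    have "T a b c $ a $ b + T b c a $ a $ b + T c a b $ a $ b = 0" for a b
      using arg_cong[OF second_Bianchi_S[of a b c], of "\<lambda>M. M $ a $ b"] by (simp add: T_def)
    then show ?thesis by (simp flip: sum.distrib)
  qed
  have R1: "(\<Sum>b\<in>UNIV. S b c $ e $ b) = - ?R c e" for c e
    unfolding raise_ric sum_negf[symmetric] by (intro sum.cong refl S_antisym_upper)
  have R2: "(\<Sum>b\<in>UNIV. S c b $ e $ b) = ?R c e" for c e
    unfolding raise_ric by (intro sum.cong refl) (metis S_antisym_upper S_antisym_lower)
  have R3: "(\<Sum>b\<in>UNIV. S c b $ b $ e) = - ?R c e" for c e
    unfolding raise_ric sum_negf[symmetric] by (intro sum.cong refl S_antisym_lower)
  have Tn: "T a b c $ d $ e = D a (S b c $ d $ e) + (\<Sum>k\<in>UNIV. G a $ d $ k * S b c $ k $ e)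
      + (\<Sum>k\<in>UNIV. S b c $ d $ k * G a $ e $ k)" for a b c d e
    by (simp add: T_def matrix_mult_nth transpose_def)
  have A: "(\<Sum>a\<in>UNIV. \<Sum>b\<in>UNIV. T a b c $ a $ b) = - (\<Sum>a\<in>UNIV. D a (?R c a)) - (\<Sum>a\<in>UNIV. \<Sum>k\<in>UNIV. G a $ a $ k * ?R c k)"
  proof -
    have 1: "(\<Sum>b\<in>UNIV. \<Sum>k\<in>UNIV. G a $ a $ k * S b c $ k $ b) = - (\<Sum>k\<in>UNIV. G a $ a $ k * ?R c k)" for a
      by (subst sum.swap) (simp add: R1 sum_negf flip: sum_distrib_left)
    have 2: "(\<Sum>a\<in>UNIV. \<Sum>b\<in>UNIV. \<Sum>k\<in>UNIV. S b c $ a $ k * G a $ b $ k) = 0"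
    proof -
      have "(\<Sum>a\<in>UNIV. \<Sum>b\<in>UNIV. \<Sum>k\<in>UNIV. S b c $ a $ k * G a $ b $ k) = (\<Sum>b\<in>UNIV. \<Sum>a\<in>UNIV. \<Sum>k\<in>UNIV. G a $ b $ k * S b c $ a $ k)"
        by (subst sum.swap) (simp add: mult.commute)
      also have "\<dots> = 0"
      proof (rule sum.neutral, rule ballI)
        fix b
        show "(\<Sum>a\<in>UNIV. \<Sum>k\<in>UNIV. G a $ b $ k * S b c $ a $ k) = 0"
          by (rule sum_sym_antisym) (rule G_sym, rule S_antisym_upper)
      qed
      finally show ?thesis .
    qed
    show ?thesis
      by (simp add: Tn sum.distrib sum_subtractf 1 2 sum_negf R1 D_minus flip: D_sum)
  qed
  have B: "(\<Sum>a\<in>UNIV. \<Sum>b\<in>UNIV. T b c a $ a $ b) = - (\<Sum>b\<in>UNIV. D b (?R c b)) - (\<Sum>b\<in>UNIV. \<Sum>k\<in>UNIV. G b $ b $ k * ?R c k)"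
  proof -
    have 1: "(\<Sum>a\<in>UNIV. \<Sum>k\<in>UNIV. S c a $ a $ k * G b $ b $ k) = - (\<Sum>k\<in>UNIV. G b $ b $ k * ?R c k)" for b
      by (subst sum.swap) (simp add: R3 sum_negf mult.commute flip: sum_distrib_left)
    have 2: "(\<Sum>b\<in>UNIV. \<Sum>a\<in>UNIV. \<Sum>k\<in>UNIV. G b $ a $ k * S c a $ k $ b) = 0"
    proof -
      have "(\<Sum>b\<in>UNIV. \<Sum>a\<in>UNIV. \<Sum>k\<in>UNIV. G b $ a $ k * S c a $ k $ b) = (\<Sum>a\<in>UNIV. \<Sum>b\<in>UNIV. \<Sum>k\<in>UNIV. G b $ a $ k * S c a $ k $ b)"
        by (rule sum.swap)
      also have "\<dots> = 0"
      proof (rule sum.neutral, rule ballI)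
        fix a
        show "(\<Sum>b\<in>UNIV. \<Sum>k\<in>UNIV. G b $ a $ k * S c a $ k $ b) = 0"
          by (rule sum_sym_antisym) (rule G_sym, rule S_antisym_upper)
      qed
      finally show ?thesis .
    qed
    show ?thesis
      by (subst sum.swap) (simp add: Tn sum.distrib sum_subtractf 1 2 sum_negf R3 D_minus flip: D_sum)
  qed
  \<comment> \<open>The connection term that occurs twice here is what \<open>A\<close> and
    \<open>B\<close> lack to be divergences, because \<open>T\<close> differentiates covariantly in
    the matrix indices only and not in the form indices.\<close>
  have C: "(\<Sum>a\<in>UNIV. \<Sum>b\<in>UNIV. T c a b $ a $ b) = D c scal + (\<Sum>a\<in>UNIV. \<Sum>k\<in>UNIV. G c $ a $ k * ?R a k)
      + (\<Sum>a\<in>UNIV. \<Sum>k\<in>UNIV. G c $ a $ k * ?R a k)"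
  proof -
    have 0: "(\<Sum>a\<in>UNIV. \<Sum>b\<in>UNIV. D c (S a b $ a $ b)) = D c scal"
      by (simp add: scal_def R2 flip: D_sum)
    have 1: "(\<Sum>b\<in>UNIV. \<Sum>k\<in>UNIV. G c $ a $ k * S a b $ k $ b) = (\<Sum>k\<in>UNIV. G c $ a $ k * ?R a k)" for a
      by (subst sum.swap) (simp add: R2 flip: sum_distrib_left)
    have 2: "(\<Sum>a\<in>UNIV. \<Sum>b\<in>UNIV. \<Sum>k\<in>UNIV. S a b $ a $ k * G c $ b $ k) = (\<Sum>b\<in>UNIV. \<Sum>k\<in>UNIV. G c $ b $ k * ?R b k)"
    proof -
      have "(\<Sum>a\<in>UNIV. \<Sum>b\<in>UNIV. \<Sum>k\<in>UNIV. S a b $ a $ k * G c $ b $ k) = (\<Sum>b\<in>UNIV. \<Sum>k\<in>UNIV. \<Sum>a\<in>UNIV. S a b $ a $ k * G c $ b $ k)"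
        by (subst sum.swap) (intro sum.cong refl sum.swap)
      also have "\<dots> = (\<Sum>b\<in>UNIV. \<Sum>k\<in>UNIV. G c $ b $ k * ?R b k)"
        by (simp only: raise_ric mult.commute sum_distrib_left)
      finally show ?thesis .
    qed
    show ?thesis
      by (simp add: Tn sum.distrib 0 1 2)
  qed
  have "(\<Sum>e\<in>UNIV. \<Sum>d\<in>UNIV. G c $ d $ e * ?R d e) = (\<Sum>a\<in>UNIV. \<Sum>k\<in>UNIV. G c $ a $ k * ?R a k)"
    by (rule sum.swap)
  then show ?thesis
    using sum0 unfolding A B C dvg_def by (simp add: algebra_simps)
qed

definition gradf where "gradf f a = (\<Sum>b\<in>UNIV. P $ a $ b * D b f)"

definition cgrad where "cgrad f b e = D b (gradf f e) + (\<Sum>c\<in>UNIV. G b $ e $ c * gradf f c)"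

text \<open>\<open>cgrad f\<close> is the covariant derivative of the gradient vector field; it is
  the raised Hessian because \<open>P\<close> is parallel.\<close>

lemma raise_hess: "raise (hess D G f) b e = cgrad f b e"
proof -
  have DP: "D b (P $ e $ c) = - (\<Sum>k\<in>UNIV. G b $ e $ k * P $ k $ c) - (\<Sum>k\<in>UNIV. P $ e $ k * G b $ c $ k)" for b e c
    using arg_cong[OF mderiv_P[of b], of "\<lambda>M. M $ e $ c"] by (simp add: matrix_mult_nth transpose_def)
  have 1: "(\<Sum>c\<in>UNIV. \<Sum>k\<in>UNIV. G b $ e $ k * P $ k $ c * D c f) = (\<Sum>c\<in>UNIV. G b $ e $ c * gradf f c)"
    by (subst sum.swap) (simp add: gradf_def sum_distrib_left mult.assoc)
  have 2: "(\<Sum>c\<in>UNIV. \<Sum>k\<in>UNIV. P $ e $ k * G b $ c $ k * D c f) = (\<Sum>k\<in>UNIV. P $ e $ k * (\<Sum>a\<in>UNIV. G b $ a $ k * D a f))"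
    by (subst sum.swap) (simp add: sum_distrib_left mult.assoc)
  have "D b (gradf f e) = - (\<Sum>c\<in>UNIV. G b $ e $ c * gradf f c) - (\<Sum>k\<in>UNIV. P $ e $ k * (\<Sum>a\<in>UNIV. G b $ a $ k * D a f))
      + (\<Sum>c\<in>UNIV. P $ e $ c * D b (D c f))"
    unfolding 1[symmetric] 2[symmetric]
    by (simp add: gradf_def D_sum D_mult DP sum.distrib sum_subtractf left_diff_distrib sum_distrib_right sum_negf)
  then show ?thesis
    by (simp add: raise_def cgrad_def hess_def P_sym[of _ e] right_diff_distrib left_diff_distrib sum_subtractf mult.commute)
qed

definition lap where "lap f = (\<Sum>e\<in>UNIV. cgrad f e e)"

text \<open>Commuting two covariant derivatives of the gradient costs one curvature term
  (\<open>ricci_id\<close>). Contracting the upper index with the direction of differentiation gives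
  this form of Bochner's formula.\<close>

lemma dvg_cgrad: "dvg (cgrad f) b = D b (lap f) + (\<Sum>c\<in>UNIV. ric D G b c * gradf f c)"
proof -
  let ?F = "gradf f"
  have ricci_id: "D e (cgrad f b k) + (\<Sum>c\<in>UNIV. G e $ k $ c * cgrad f b c) - D b (cgrad f e k) - (\<Sum>c\<in>UNIV. G b $ k $ c * cgrad f e c)
     = (\<Sum>c\<in>UNIV. curv D G e b $ k $ c * ?F c)" for e b k
  proof -
    have 1: "(\<Sum>c\<in>UNIV. \<Sum>d\<in>UNIV. G e $ k $ c * (G b $ c $ d * ?F d)) = (\<Sum>c\<in>UNIV. (G e ** G b) $ k $ c * ?F c)" for e b
      by (subst sum.swap) (simp add: matrix_mult_nth sum_distrib_right mult.assoc)
    show ?thesis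
      by (simp add: cgrad_def D_add D_sum D_mult curv_def D_comm[of b e] distrib_left distrib_right sum.distrib
          left_diff_distrib sum_subtractf sum_distrib_left 1)
  qed
  have "(\<Sum>e\<in>UNIV. D e (cgrad f b e)) + (\<Sum>e\<in>UNIV. \<Sum>c\<in>UNIV. G e $ e $ c * cgrad f b c) - (\<Sum>e\<in>UNIV. D b (cgrad f e e))
     - (\<Sum>e\<in>UNIV. \<Sum>c\<in>UNIV. G b $ e $ c * cgrad f e c) = (\<Sum>e\<in>UNIV. \<Sum>c\<in>UNIV. curv D G e b $ e $ c * ?F c)"
    using ricci_id by (simp flip: sum.distrib sum_subtractf)
  also have "\<dots> = (\<Sum>c\<in>UNIV. ric D G b c * ?F c)"
    by (subst sum.swap) (simp add: ric_def sum_distrib_right)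
  finally have *: "(\<Sum>e\<in>UNIV. D e (cgrad f b e)) + (\<Sum>e\<in>UNIV. \<Sum>c\<in>UNIV. G e $ e $ c * cgrad f b c) - D b (lap f)
     - (\<Sum>e\<in>UNIV. \<Sum>c\<in>UNIV. G b $ e $ c * cgrad f e c) = (\<Sum>c\<in>UNIV. ric D G b c * ?F c)"
    by (simp add: lap_def D_sum)
  have "(\<Sum>e\<in>UNIV. \<Sum>c\<in>UNIV. G b $ e $ c * cgrad f e c) = (\<Sum>e\<in>UNIV. \<Sum>c\<in>UNIV. G b $ c $ e * cgrad f c e)"
    by (rule sum.swap)
  with * show ?thesis unfolding dvg_def by (simp add: algebra_simps)
qed

definition normgrad where "normgrad f = (\<Sum>a\<in>UNIV. D a f * gradf f a)"

text \<open>The connection terms in the derivative of the gradient cancel those hidden in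
  \<open>hess\<close>, again by compatibility with the metric.\<close>

lemma D_normgrad: "D b (normgrad f) = (\<Sum>c\<in>UNIV. hess D G f b c * gradf f c) + (\<Sum>c\<in>UNIV. hess D G f b c * gradf f c)"
proof -
  have DF: "D b (gradf f a) = raise (hess D G f) b a - (\<Sum>c\<in>UNIV. G b $ a $ c * gradf f c)" for a
    by (simp add: raise_hess cgrad_def)
  have 1: "(\<Sum>a\<in>UNIV. D a f * raise (hess D G f) b a) = (\<Sum>c\<in>UNIV. hess D G f b c * gradf f c)"
    unfolding raise_def gradf_def sum_distrib_left
    by (subst sum.swap) (simp add: mult_ac)
  have 2: "(\<Sum>a\<in>UNIV. D b (D a f) * gradf f a) = (\<Sum>c\<in>UNIV. hess D G f b c * gradf f c) + (\<Sum>a\<in>UNIV. D a f * (\<Sum>c\<in>UNIV. G b $ a $ c * gradf f c))"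
  proof -
    have "(\<Sum>a\<in>UNIV. D a f * (\<Sum>c\<in>UNIV. G b $ a $ c * gradf f c)) = (\<Sum>c\<in>UNIV. (\<Sum>a\<in>UNIV. G b $ a $ c * D a f) * gradf f c)"
      unfolding sum_distrib_left sum_distrib_right by (subst sum.swap) (simp add: mult_ac)
    then show ?thesis by (simp add: hess_def left_diff_distrib sum_subtractf)
  qed
  show ?thesis
    unfolding normgrad_def by (simp add: D_sum D_mult DF sum.distrib right_diff_distrib sum_subtractf 1 2)
qed

text \<open>Subtracting E(grad f) removes the terms Ric(grad f) that \<open>dvg_cgrad\<close>
  produces. What remains is exact by the contracted Bianchi identity and
  \<open>D_normgrad\<close>.\<close>

lemma soliton_Bianchi:
  fixes f :: 'a
  defines "E \<equiv> \<lambda>b c. ric D G b c + hess D G f b c + hf * g $ b $ c"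
  shows "(dvg (raise E) b + dvg (raise E) b) - (\<Sum>c\<in>UNIV. E b c * gradf f c) - (\<Sum>c\<in>UNIV. E b c * gradf f c)
     = D b (scal + lap f + lap f - normgrad f - f)"
proof -
  let ?d = "\<lambda>b e. if b = e then hf else 0 :: 'a"
  have gP': "(\<Sum>c\<in>UNIV. g $ b $ c * P $ c $ e) = (if b = e then 1 else 0)" for b e
    using arg_cong[OF gP, of "\<lambda>M. M $ b $ e"] by (simp add: matrix_mult_nth mat_def)
  have rE: "raise E = (\<lambda>b e. raise (ric D G) b e + cgrad f b e + ?d b e)"
  proof (intro ext)
    fix b e
    have "(\<Sum>c\<in>UNIV. hf * g $ b $ c * P $ c $ e) = ?d b e"
      using gP'[of b e] by (simp add: mult.assoc flip: sum_distrib_left)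
    then show "raise E b e = raise (ric D G) b e + cgrad f b e + ?d b e"
      by (simp add: raise_def E_def distrib_right sum.distrib flip: raise_hess)
  qed
  have Dhf: "D a hf = 0" for a
  proof -
    have "D a hf + D a hf = 0" using D_add[of a hf hf] by (simp add: hf)
    then show ?thesis by (rule cancel_double)
  qed
  \<comment> \<open>\<open>?d\<close> is the raised form of \<open>hf * g\<close>, half of the
    identity tensor, and that tensor is parallel.\<close>
  have "dvg ?d b = 0"
  proof -
    have "(\<Sum>e\<in>UNIV. D e (?d b e)) = 0" by (rule sum.neutral) (simp add: Dhf)
    moreover have "(\<Sum>e\<in>UNIV. \<Sum>c\<in>UNIV. G e $ e $ c * ?d b c) = (\<Sum>e\<in>UNIV. G e $ e $ b * hf)"
      by (simp add: if_distrib cong: if_cong)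
    moreover have "(\<Sum>e\<in>UNIV. \<Sum>c\<in>UNIV. G b $ c $ e * ?d c e) = (\<Sum>e\<in>UNIV. G b $ e $ e * hf)"
      by (simp add: if_distrib cong: if_cong)
    moreover have "G b $ e $ e = G e $ e $ b" for e by (rule G_sym)
    ultimately show ?thesis by (simp add: dvg_def)
  qed
  moreover have "dvg (\<lambda>b e. raise (ric D G) b e + cgrad f b e + ?d b e) b = dvg (raise (ric D G)) b + dvg (cgrad f) b + dvg ?d b"
    unfolding dvg_def by (simp add: D_add sum.distrib distrib_left)
  ultimately have 1: "dvg (raise E) b = dvg (raise (ric D G)) b + dvg (cgrad f) b" by (simp add: rE)
  have 2: "(\<Sum>c\<in>UNIV. hf * g $ b $ c * gradf f c) = hf * D b f"
  proof -
    have "(\<Sum>c\<in>UNIV. g $ b $ c * gradf f c) = (\<Sum>e\<in>UNIV. (\<Sum>c\<in>UNIV. g $ b $ c * P $ c $ e) * D e f)"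
      unfolding gradf_def sum_distrib_left sum_distrib_right by (subst sum.swap) (simp add: mult.assoc)
    also have "\<dots> = D b f" by (simp add: gP' if_distribR if_distrib cong: if_cong)
    finally show ?thesis by (simp add: mult.assoc flip: sum_distrib_left)
  qed
  have 3: "hf * D b f + hf * D b f = D b f" by (simp only: hf mult_1 flip: distrib_right)
  have 4: "(\<Sum>c\<in>UNIV. E b c * gradf f c) = (\<Sum>c\<in>UNIV. ric D G b c * gradf f c) + (\<Sum>c\<in>UNIV. hess D G f b c * gradf f c) + hf * D b f"
    by (simp add: E_def distrib_right sum.distrib 2)
  have cB: "dvg (raise (ric D G)) b + dvg (raise (ric D G)) b = D b scal" by (rule contracted_Bianchi)
  have "(a + (l + r) + (a + (l + r))) - (r + t + h) - (r + t + h) = (a + a) + l + l - (t + t) - (h + h)"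
    for a l r t h :: 'a
    by (simp add: algebra_simps)
  then show ?thesis
    unfolding 1 4 dvg_cgrad D_add D_diff D_normgrad
    by (simp only: 3 cB)
qed

end

section \<open>Change of frame\<close>

lemma matrix_mult_eq_mat_nth:
  fixes J K :: "'a::comm_ring_1^'i::finite^'i"
  assumes "J ** K = mat 1"
  shows "(\<Sum>a\<in>UNIV. J $ i $ a * K $ a $ k) = (if i = k then 1 else 0)"
  using arg_cong[OF assms, of "\<lambda>M. M $ i $ k"] by (simp add: matrix_mult_nth mat_def)

text \<open>Both coordinate systems live in one ring: \<open>D\<close> are the new and \<open>E\<close> the old coordinate derivations,
  and \<open>J\<close> is the Jacobian of the old coordinates with respect to the new ones. The operators \<open>E\<close> are only
  used through \<open>D_E\<close>; that they commute is not required.\<close>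

locale frame_change = derivations D hf
  for D :: "'i::finite \<Rightarrow> 'a::comm_ring_1 \<Rightarrow> 'a" and hf +
  fixes E :: "'i \<Rightarrow> 'a \<Rightarrow> 'a" and J K g P :: "'a^'i^'i"
  assumes JK: "J ** K = mat 1" and KJ: "K ** J = mat 1"
    and J_closed: "D a (J $ i $ b) = D b (J $ i $ a)"
    and D_E: "D a x = (\<Sum>i\<in>UNIV. J $ i $ a * E i x)"
    and gP: "g ** P = mat 1" and Pg: "P ** g = mat 1" and g_sym: "g $ i $ j = g $ j $ i"
begin

definition g' where "g' = transpose J ** g ** J"
definition P' where "P' = K ** P ** transpose K"

abbreviation G where "G \<equiv> connection hf E g P"

text \<open>The old connection in the new direction \<open>a\<close>, with matrix indices still in
  the old frame; \<open>G'\<close> is its gauge transform by \<open>J\<close>.\<close>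

definition A where "A a = (\<chi> k l. \<Sum>i\<in>UNIV. J $ i $ a * G i $ k $ l)"
definition G' where "G' b = K ** (A b ** J + mderiv D b J)"

lemma tJK: "transpose J ** transpose K = mat 1" "transpose K ** transpose J = mat 1"
  by (metis KJ matrix_transpose_mul transpose_mat) (metis JK matrix_transpose_mul transpose_mat)

lemma g'P': "g' ** P' = mat 1"
proof -
  have "g' ** P' = transpose J ** (g ** ((J ** K) ** (P ** transpose K)))"
    by (simp add: g'_def P'_def matrix_mul_assoc)
  also have "\<dots> = mat 1" by (simp add: JK) (simp add: gP tJK matrix_mul_assoc)
  finally show ?thesis .
qed

lemma P'g': "P' ** g' = mat 1"
proof -
  have "P' ** g' = K ** (P ** ((transpose K ** transpose J) ** (g ** J)))"
    by (simp add: g'_def P'_def matrix_mul_assoc)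
  also have "\<dots> = mat 1" by (simp add: tJK) (simp add: Pg KJ matrix_mul_assoc)
  finally show ?thesis .
qed

lemma transpose_g: "transpose g = g"
  by (simp add: transpose_def vec_eq_iff g_sym)

lemma g'_sym: "g' $ i $ j = g' $ j $ i"
proof -
  have "transpose g' = g'"
    by (simp add: g'_def matrix_transpose_mul transpose_g matrix_mul_assoc)
  then show ?thesis by (metis (no_types, lifting) transpose_def vec_lambda_beta)
qed

lemma JG': "J ** G' b = A b ** J + mderiv D b J"
  by (simp add: G'_def matrix_mul_assoc JK)

lemma mderiv_D: "mderiv D b M = (\<chi> k l. \<Sum>i\<in>UNIV. J $ i $ b * mderiv E i M $ k $ l)"
  by (simp add: vec_eq_iff D_E)

lemma mderiv_g: "mderiv D b g = g ** A b + transpose (A b) ** g"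
proof -
  have 1: "mderiv E i g = g ** G i + transpose (G i) ** g" for i
    by (rule connection_compatible) (use gP g_sym hf in auto)
  have 2: "(\<Sum>i\<in>UNIV. \<Sum>m\<in>UNIV. J $ i $ b * (g $ k $ m * G i $ m $ l)) = (g ** A b) $ k $ l" for k l
    by (subst sum.swap) (simp add: matrix_mult_nth A_def sum_distrib_left mult_ac)
  have 3: "(\<Sum>i\<in>UNIV. \<Sum>m\<in>UNIV. J $ i $ b * (G i $ m $ k * g $ m $ l)) = (transpose (A b) ** g) $ k $ l" for k l
    by (subst sum.swap) (simp add: matrix_mult_nth A_def sum_distrib_left transpose_def mult_ac)
  show ?thesis
    unfolding mderiv_D 1
    by (simp add: vec_eq_iff 2[symmetric] 3[symmetric])
       (simp add: matrix_mult_nth transpose_def distrib_left sum_distrib_left sum.distrib)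
qed

lemma AJ_sym: "(A b ** J) $ k $ c = (A c ** J) $ k $ b"
proof -
  have *: "(A b ** J) $ k $ c = (\<Sum>l\<in>UNIV. \<Sum>i\<in>UNIV. J $ i $ b * G i $ k $ l * J $ l $ c)" for b c
    by (simp add: matrix_mult_nth A_def sum_distrib_right)
  have "G i $ k $ l = G l $ k $ i" for i k l using connection_sym g_sym by metis
  then show ?thesis
    unfolding * by (subst sum.swap) (intro sum.cong refl, simp add: mult_ac)
qed

text \<open>By \<open>connection_unique\<close>: closedness of \<open>J\<close> makes
  \<open>G'\<close> symmetric, and the gauge transformation preserves compatibility. The explicit
  formula for the symbols is never transformed.\<close>

lemma G'_connection: "G' b = connection hf D g' P' b"
proof (rule connection_unique[OF P'g' g'_sym hf])
  show "G' b $ a $ c = G' c $ a $ b" for a b c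
    by (simp add: G'_def matrix_mult_nth[of K] AJ_sym[of b _ c] J_closed[of b _ c])
  show "mderiv D b g' = g' ** G' b + transpose (G' b) ** g'" for b
  proof -
    have 1: "g' ** G' b = transpose J ** g ** (A b ** J + mderiv D b J)"
      by (simp add: g'_def JG' flip: matrix_mul_assoc)
    have "transpose (G' b) ** g' = transpose (g' ** G' b)"
      using g'_sym by (simp add: matrix_transpose_mul) (simp add: transpose_def vec_eq_iff)
    also have "\<dots> = transpose (A b ** J + mderiv D b J) ** g ** J"
      unfolding 1 by (simp add: matrix_transpose_mul transpose_g matrix_mul_assoc)
    finally show ?thesis
      unfolding 1 by (simp add: g'_def mderiv_mult mderiv_transpose mderiv_g matrix_algebra transpose_add matrix_transpose_mul)
  qed
qed

definition R where "R a b = mderiv D a (A b) - mderiv D b (A a) + A a ** A b - A b ** A a"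

text \<open>The terms with derivatives of \<open>J\<close>, namely
  \<open>A b ** mderiv D a J\<close>, \<open>A a ** mderiv D b J\<close> and the second derivative
  of \<open>J\<close>, are together symmetric in \<open>a\<close> and \<open>b\<close> and drop
  out.\<close>

lemma J_curv: "J ** curv D G' a b = R a b ** J"
proof -
  have 1: "J ** (mderiv D a (G' b) + G' a ** G' b) = mderiv D a (A b) ** J + A b ** mderiv D a J + mderiv D a (mderiv D b J)
        + A a ** (A b ** J) + A a ** mderiv D b J" for a b
  proof -
    have "mderiv D a J ** G' b + J ** mderiv D a (G' b) = mderiv D a (A b) ** J + A b ** mderiv D a J + mderiv D a (mderiv D b J)"
      using arg_cong[OF JG'[of b], of "mderiv D a"] by (simp add: mderiv_mult mderiv_add)
    moreover have "J ** (G' a ** G' b) = A a ** (A b ** J) + A a ** mderiv D b J + mderiv D a J ** G' b"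
    proof -
      have "J ** (G' a ** G' b) = A a ** (J ** G' b) + mderiv D a J ** G' b"
        by (simp add: matrix_mul_assoc JG') (simp add: matrix_add_rdistrib JG' flip: matrix_mul_assoc)
      then show ?thesis by (simp add: JG' matrix_add_ldistrib)
    qed
    ultimately show ?thesis by (simp add: matrix_add_ldistrib algebra_simps)
  qed
  have "J ** curv D G' a b = J ** (mderiv D a (G' b) + G' a ** G' b) - J ** (mderiv D b (G' a) + G' b ** G' a)"
    by (simp add: curv_def matrix_algebra)
  then show ?thesis
    unfolding 1 by (simp add: R_def matrix_algebra mderiv_comm[of b a])
qed

text \<open>The derivatives of \<open>J\<close> inside \<open>D a (A b)\<close> cancel under
  antisymmetrization because \<open>J\<close> is closed, so the curvature is pulled back as a
  two-form with values in matrices.\<close>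

lemma R_nth: "R a b $ k $ l = (\<Sum>i\<in>UNIV. \<Sum>j\<in>UNIV. J $ i $ a * J $ j $ b * curv E G i j $ k $ l)"
proof -
  have 1: "D a (A b $ k $ l) = (\<Sum>j\<in>UNIV. D a (J $ j $ b) * G j $ k $ l) + (\<Sum>i\<in>UNIV. \<Sum>j\<in>UNIV. J $ i $ a * J $ j $ b * E i (G j $ k $ l))" for a b
    by (subst sum.swap) (simp add: A_def D_sum D_mult sum.distrib D_E[of a "G _ $ _ $ _"] sum_distrib_left mult_ac)
  have 2: "(A a ** A b) $ k $ l = (\<Sum>i\<in>UNIV. \<Sum>j\<in>UNIV. J $ i $ a * J $ j $ b * (G i ** G j) $ k $ l)" for a b
  proof -
    have "(A a ** A b) $ k $ l = (\<Sum>m\<in>UNIV. \<Sum>i\<in>UNIV. \<Sum>j\<in>UNIV. J $ i $ a * J $ j $ b * (G i $ k $ m * G j $ m $ l))"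
      by (simp add: matrix_mult_nth A_def sum_product mult_ac)
    also have "\<dots> = (\<Sum>i\<in>UNIV. \<Sum>j\<in>UNIV. \<Sum>m\<in>UNIV. J $ i $ a * J $ j $ b * (G i $ k $ m * G j $ m $ l))"
      by (subst sum.swap) (intro sum.cong refl sum.swap)
    finally show ?thesis by (simp add: matrix_mult_nth sum_distrib_left)
  qed
  have 3: "(\<Sum>i\<in>UNIV. \<Sum>j\<in>UNIV. J $ i $ b * J $ j $ a * E i (G j $ k $ l)) = (\<Sum>i\<in>UNIV. \<Sum>j\<in>UNIV. J $ i $ a * J $ j $ b * E j (G i $ k $ l))"
    by (subst sum.swap) (simp add: mult_ac)
  have 4: "(\<Sum>i\<in>UNIV. \<Sum>j\<in>UNIV. J $ i $ b * J $ j $ a * (G i ** G j) $ k $ l) = (\<Sum>i\<in>UNIV. \<Sum>j\<in>UNIV. J $ i $ a * J $ j $ b * (G j ** G i) $ k $ l)"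
    by (subst sum.swap) (simp add: mult_ac)
  show ?thesis
    by (simp add: R_def 1 2 3 4 J_closed[of b _ a] curv_def distrib_left right_diff_distrib sum.distrib sum_subtractf)
qed

text \<open>Among the Jacobian factors the pair \<open>J\<close>, \<open>K\<close> attached to the
  contracted index multiplies to the identity; the interchanges of sums bring that index
  innermost.\<close>

lemma ric_frame_change:
  "ric D (connection hf D g' P') b c = (\<Sum>j\<in>UNIV. \<Sum>l\<in>UNIV. J $ j $ b * J $ l $ c * ric E G j l)"
proof -
  have cc: "connection hf D g' P' = G'" using G'_connection by auto
  have "curv D G' a b = K ** R a b ** J" for a
  proof -
    have "K ** (J ** curv D G' a b) = K ** (R a b ** J)" by (simp add: J_curv)
    then show ?thesis by (simp add: matrix_mul_assoc KJ)
  qed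
  then have "ric D G' b c = (\<Sum>a\<in>UNIV. \<Sum>l\<in>UNIV. \<Sum>k\<in>UNIV. \<Sum>i\<in>UNIV. \<Sum>j\<in>UNIV. (J $ i $ a * K $ a $ k) * (J $ j $ b * J $ l $ c * curv E G i j $ k $ l))"
    by (simp add: ric_def matrix_mult_nth R_nth sum_distrib_left sum_distrib_right mult_ac)
  also have "\<dots> = (\<Sum>l\<in>UNIV. \<Sum>k\<in>UNIV. \<Sum>i\<in>UNIV. \<Sum>j\<in>UNIV. \<Sum>a\<in>UNIV. (J $ i $ a * K $ a $ k) * (J $ j $ b * J $ l $ c * curv E G i j $ k $ l))"
    by (subst sum.swap, rule sum.cong[OF refl], subst sum.swap, rule sum.cong[OF refl], subst sum.swap, rule sum.cong[OF refl], rule sum.swap)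
  also have "\<dots> = (\<Sum>l\<in>UNIV. \<Sum>k\<in>UNIV. \<Sum>i\<in>UNIV. \<Sum>j\<in>UNIV. (if i = k then 1 else 0) * (J $ j $ b * J $ l $ c * curv E G i j $ k $ l))"
    by (simp only: matrix_mult_eq_mat_nth[OF JK] flip: sum_distrib_right)
  also have "\<dots> = (\<Sum>l\<in>UNIV. \<Sum>k\<in>UNIV. \<Sum>j\<in>UNIV. \<Sum>i\<in>UNIV. (if i = k then J $ j $ b * J $ l $ c * curv E G i j $ k $ l else 0))"
    by (rule sum.cong[OF refl], rule sum.cong[OF refl], subst sum.swap, intro sum.cong refl) simp
  also have "\<dots> = (\<Sum>l\<in>UNIV. \<Sum>k\<in>UNIV. \<Sum>j\<in>UNIV. J $ j $ b * J $ l $ c * curv E G k j $ k $ l)"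
    by simp
  also have "\<dots> = (\<Sum>l\<in>UNIV. \<Sum>j\<in>UNIV. \<Sum>k\<in>UNIV. J $ j $ b * J $ l $ c * curv E G k j $ k $ l)"
    by (intro sum.cong refl sum.swap)
  also have "\<dots> = (\<Sum>j\<in>UNIV. \<Sum>l\<in>UNIV. J $ j $ b * J $ l $ c * ric E G j l)"
    by (subst sum.swap) (simp add: ric_def sum_distrib_left)
  finally show ?thesis unfolding cc .
qed

text \<open>The non-tensorial terms \<open>D b (J $ i $ c)\<close> occur in the second derivative
  and in the transformed connection, and cancel.\<close>

lemma hess_frame_change:
  "hess D (connection hf D g' P') f b c = (\<Sum>j\<in>UNIV. \<Sum>l\<in>UNIV. J $ j $ b * J $ l $ c * hess E G f j l)"
proof -
  have cc: "connection hf D g' P' = G'" using G'_connection by auto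
  have 1: "D b (D c f) = (\<Sum>i\<in>UNIV. D b (J $ i $ c) * E i f) + (\<Sum>j\<in>UNIV. \<Sum>l\<in>UNIV. J $ j $ b * J $ l $ c * E j (E l f))"
    by (subst sum.swap) (simp add: D_E[of c f] D_sum D_mult sum.distrib D_E[of b "E _ f"] sum_distrib_left mult_ac)
  have "(\<Sum>a\<in>UNIV. G' b $ a $ c * D a f) = (\<Sum>i\<in>UNIV. (J ** G' b) $ i $ c * E i f)"
    by (simp add: D_E[of _ f] matrix_mult_nth sum_distrib_left sum_distrib_right) (subst sum.swap, simp add: mult_ac)
  also have "\<dots> = (\<Sum>i\<in>UNIV. D b (J $ i $ c) * E i f) + (\<Sum>i\<in>UNIV. (A b ** J) $ i $ c * E i f)"
    by (simp add: JG' distrib_right sum.distrib)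
  also have "(\<Sum>i\<in>UNIV. (A b ** J) $ i $ c * E i f) = (\<Sum>i\<in>UNIV. \<Sum>l\<in>UNIV. \<Sum>j\<in>UNIV. J $ j $ b * J $ l $ c * (G j $ i $ l * E i f))"
    by (simp add: matrix_mult_nth A_def sum_distrib_left sum_distrib_right mult_ac)
  also have "\<dots> = (\<Sum>l\<in>UNIV. \<Sum>j\<in>UNIV. \<Sum>i\<in>UNIV. J $ j $ b * J $ l $ c * (G j $ i $ l * E i f))"
    by (subst sum.swap, rule sum.cong[OF refl], rule sum.swap)
  also have "\<dots> = (\<Sum>j\<in>UNIV. \<Sum>l\<in>UNIV. \<Sum>i\<in>UNIV. J $ j $ b * J $ l $ c * (G j $ i $ l * E i f))"
    by (rule sum.swap)
  finally show ?thesis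
    unfolding cc by (simp add: hess_def 1 right_diff_distrib sum_subtractf sum_distrib_left)
qed

end

section \<open>Smooth functions on open sets\<close>

lemma has_derivative_frechet:
  "f differentiable (at x) \<Longrightarrow> (f has_derivative frechet_derivative f (at x)) (at x)"
  by (simp add: frechet_derivative_works)

lemma partial_deriv_eqI:
  "(f has_derivative f') (at x) \<Longrightarrow> partial_deriv i f x = f' (axis i 1)"
  unfolding partial_deriv_def by (metis frechet_derivative_at)

lemma partial_deriv_cong:
  assumes "open S" "x \<in> S" "\<And>y. y \<in> S \<Longrightarrow> f y = g y"
  shows "partial_deriv i f x = partial_deriv i g x"
proof -
  have "(f has_derivative F) (at x) \<longleftrightarrow> (g has_derivative F) (at x)" for F
    using assms has_derivative_transform_within_open[of f F x UNIV S g]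
      has_derivative_transform_within_open[of g F x UNIV S f] by auto
  then show ?thesis by (simp add: partial_deriv_def frechet_derivative_def)
qed

lemma differentiable_cong_open:
  assumes "open S" "x \<in> S" "\<And>y. y \<in> S \<Longrightarrow> f y = g y" "f differentiable (at x)"
  shows "g differentiable (at x)"
  using assms has_derivative_transform_within_open[of f _ x UNIV S g]
  unfolding differentiable_def by blast

lemma Ck_on_cong:
  assumes "open S" "\<And>y. y \<in> S \<Longrightarrow> f y = g y" "Ck_on k S f"
  shows "Ck_on k S g"
  using assms(2,3)
proof (induction k arbitrary: f g)
  case 0
  then show ?case by (simp cong: continuous_on_cong)
next
  case (Suc k)
  have "g differentiable (at x)" if "x \<in> S" for x
    using differentiable_cong_open[OF assms(1) that, of f g] Suc.prems that by auto
  moreover have "Ck_on k S (partial_deriv i g)" for i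
    by (rule Suc.IH[of "partial_deriv i f"])
      (use Suc.prems partial_deriv_cong[OF assms(1), of _ f g] in auto)
  ultimately show ?case by simp
qed

lemma Ck_on_SucD: "Ck_on (Suc k) S f \<Longrightarrow> Ck_on k S f"
proof (induction k arbitrary: f)
  case 0
  then show ?case
    using continuous_at_imp_continuous_on differentiable_imp_continuous_within by (simp) blast
next
  case (Suc k)
  then show ?case by (metis Ck_on.simps(2))
qed

lemma Ck_on_subset: "Ck_on k S f \<Longrightarrow> T \<subseteq> S \<Longrightarrow> Ck_on k T f"
proof (induction k arbitrary: f)
  case 0
  then show ?case using continuous_on_subset by auto
next
  case (Suc k)
  then show ?case by auto
qed

lemma Ck_on_const: "Ck_on k S (\<lambda>x::real^'n::finite. c)"
proof (induction k arbitrary: c)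
  case (Suc k)
  have "partial_deriv i (\<lambda>x::real^'n. c) = (\<lambda>x. 0)" for i
    by (rule ext) (rule partial_deriv_eqI[of _ "\<lambda>_. 0", simplified], simp)
  then have "Ck_on k S (partial_deriv i (\<lambda>x::real^'n. c))" for i
    using Suc.IH[of 0] by (simp only:)
  then show ?case by simp
qed simp

lemma partial_deriv_const: "partial_deriv i (\<lambda>x. c) x = 0"
  by (rule partial_deriv_eqI[of _ "\<lambda>_. 0", simplified], simp)

lemma partial_deriv_add:
  assumes "f differentiable (at x)" "g differentiable (at x)"
  shows "partial_deriv i (\<lambda>x. f x + g x) x = partial_deriv i f x + partial_deriv i g x"
  unfolding partial_deriv_def
  by (subst frechet_derivative_at[symmetric, OF has_derivative_add[OF assms[THEN has_derivative_frechet]]]) simp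

lemma partial_deriv_linear:
  assumes "bounded_linear L" "f differentiable (at x)"
  shows "partial_deriv i (\<lambda>x. L (f x)) x = L (partial_deriv i f x)"
  using partial_deriv_eqI[OF bounded_linear.has_derivative[OF assms(1) has_derivative_frechet[OF assms(2)]]]
  by (simp add: partial_deriv_def)

lemma partial_deriv_mult:
  fixes f g :: "real^'n::finite \<Rightarrow> real"
  assumes "f differentiable (at x)" "g differentiable (at x)"
  shows "partial_deriv i (\<lambda>x. f x * g x) x = partial_deriv i f x * g x + f x * partial_deriv i g x"
  using partial_deriv_eqI[OF has_derivative_mult[OF assms[THEN has_derivative_frechet]]]
  by (simp add: partial_deriv_def algebra_simps)

lemma partial_deriv_inverse:
  fixes f :: "real^'n::finite \<Rightarrow> real"
  assumes "f differentiable (at x)" "f x \<noteq> 0"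
  shows "partial_deriv i (\<lambda>x. inverse (f x)) x = - (inverse (f x) * partial_deriv i f x * inverse (f x))"
  using partial_deriv_eqI[OF Deriv.has_derivative_inverse[OF assms(2) has_derivative_frechet[OF assms(1)]]]
  by (simp add: partial_deriv_def)

lemma frechet_derivative_expand:
  assumes "f differentiable (at x)"
  shows "frechet_derivative f (at x) v = (\<Sum>i\<in>UNIV. (v $ i) *\<^sub>R partial_deriv i f x)"
proof -
  have lin: "linear (frechet_derivative f (at x))" using assms by (rule linear_frechet_derivative)
  have "v = (\<Sum>i\<in>UNIV. (v $ i) *\<^sub>R axis i 1)"
    using basis_expansion[of v] by (simp add: scalar_mult_eq_scaleR)
  then have "frechet_derivative f (at x) v = frechet_derivative f (at x) (\<Sum>i\<in>UNIV. (v $ i) *\<^sub>R axis i 1)"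
    by simp
  then show ?thesis
    by (simp add: linear_sum[OF lin] linear_scale[OF lin] partial_deriv_def)
qed

lemma partial_deriv_compose:
  fixes f :: "real^'m::finite \<Rightarrow> 'b::real_normed_vector" and t :: "real^'n::finite \<Rightarrow> real^'m"
  assumes "f differentiable (at (t x))" "t differentiable (at x)"
  shows "partial_deriv a (\<lambda>x. f (t x)) x = (\<Sum>i\<in>UNIV. (partial_deriv a t x $ i) *\<^sub>R partial_deriv i f (t x))"
proof -
  have "((\<lambda>x. f (t x)) has_derivative (\<lambda>v. frechet_derivative f (at (t x)) (frechet_derivative t (at x) v))) (at x)"
    using diff_chain_at[OF has_derivative_frechet[OF assms(2)] has_derivative_frechet[OF assms(1)]]
    by (simp add: o_def)
  from partial_deriv_eqI[OF this] show ?thesis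
    unfolding frechet_derivative_expand[OF assms(1)] by (simp add: partial_deriv_def)
qed

section \<open>Closure properties of the differentiability classes\<close>

lemma Ck_on_add:
  assumes "open S" "Ck_on k S f" "Ck_on k S g"
  shows "Ck_on k S (\<lambda>x. f x + g x)"
  using assms(2,3)
proof (induction k arbitrary: f g)
  case 0
  then show ?case by (simp add: continuous_on_add)
next
  case (Suc k)
  have "Ck_on k S (partial_deriv i (\<lambda>x. f x + g x))" for i
    by (rule Ck_on_cong[OF assms(1) _ Suc.IH[of "partial_deriv i f" "partial_deriv i g"]])
      (use Suc.prems partial_deriv_add in \<open>auto simp: partial_deriv_add\<close>)
  then show ?case using Suc.prems by simp
qed

lemma Ck_on_linear:
  assumes "open S" "bounded_linear L" "Ck_on k S f"
  shows "Ck_on k S (\<lambda>x. L (f x))"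
  using assms(3)
proof (induction k arbitrary: f)
  case 0
  then show ?case using bounded_linear.continuous_on[OF assms(2)] by simp
next
  case (Suc k)
  have "Ck_on k S (partial_deriv i (\<lambda>x. L (f x)))" for i
    by (rule Ck_on_cong[OF assms(1) _ Suc.IH[of "partial_deriv i f"]])
      (use Suc.prems in \<open>auto simp: partial_deriv_linear[OF assms(2)]\<close>)
  moreover have "(\<lambda>x. L (f x)) differentiable (at x)" if "x \<in> S" for x
    using bounded_linear.has_derivative[OF assms(2) has_derivative_frechet[of f x]] Suc.prems that
    by (auto intro: differentiableI)
  ultimately show ?case by simp
qed

lemma Ck_on_mult:
  fixes f g :: "real^'n::finite \<Rightarrow> real"
  assumes "open S" "Ck_on k S f" "Ck_on k S g"
  shows "Ck_on k S (\<lambda>x. f x * g x)"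
  using assms(2,3)
proof (induction k arbitrary: f g)
  case 0
  then show ?case by (simp add: continuous_on_mult)
next
  case (Suc k)
  have "Ck_on k S (\<lambda>x. partial_deriv i f x * g x + f x * partial_deriv i g x)" for i
    by (intro Ck_on_add assms Suc.IH) (use Suc.prems Ck_on_SucD in auto)
  then have "Ck_on k S (partial_deriv i (\<lambda>x. f x * g x))" for i
    by (rule Ck_on_cong[OF assms(1), rotated]) (use Suc.prems in \<open>auto simp: partial_deriv_mult\<close>)
  then show ?case using Suc.prems by simp
qed

lemma Ck_on_inverse:
  fixes f :: "real^'n::finite \<Rightarrow> real"
  assumes "open S" "Ck_on k S f" and nz: "\<And>x. x \<in> S \<Longrightarrow> f x \<noteq> 0"
  shows "Ck_on k S (\<lambda>x. inverse (f x))"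
  using assms(2)
proof (induction k)
  case 0
  then show ?case using nz by (simp add: continuous_on_inverse)
next
  case (Suc k)
  have I: "Ck_on k S (\<lambda>x. inverse (f x))" using Suc Ck_on_SucD by blast
  have "Ck_on k S (\<lambda>x. (- 1) * (inverse (f x) * partial_deriv i f x * inverse (f x)))" for i
    by (intro Ck_on_mult assms I Ck_on_const) (use Suc.prems in auto)
  then have "Ck_on k S (partial_deriv i (\<lambda>x. inverse (f x)))" for i
    by (rule Ck_on_cong[OF assms(1), rotated]) (use Suc.prems nz in \<open>auto simp: partial_deriv_inverse\<close>)
  then show ?case using Suc.prems nz by simp
qed

lemma Ck_on_sum:
  assumes "open S" "\<And>i. i \<in> I \<Longrightarrow> Ck_on k S (f i)"
  shows "Ck_on k S (\<lambda>x. \<Sum>i\<in>I. f i x)"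
  using assms(2)
proof (induction I rule: infinite_finite_induct)
  case (insert i I)
  then show ?case using Ck_on_add[OF assms(1), of k "f i" "\<lambda>x. \<Sum>i\<in>I. f i x"] by simp
qed (simp_all add: Ck_on_const)

text \<open>The induction is over all \<open>f\<close>, since the chain rule replaces
  \<open>f\<close> by its partial derivatives composed with \<open>t\<close>.\<close>

lemma Ck_on_compose:
  fixes f :: "real^'m::finite \<Rightarrow> real" and t :: "real^'n::finite \<Rightarrow> real^'m"
  assumes "open S" "Ck_on k T f" "Ck_on k S t" "t ` S \<subseteq> T"
  shows "Ck_on k S (\<lambda>x. f (t x))"
  using assms(2,3)
proof (induction k arbitrary: f)
  case 0
  then show ?case using continuous_on_compose2[of T f S t] assms(4) by simp
next
  case (Suc k)
  have tk: "Ck_on k S t" using Suc.prems Ck_on_SucD by blast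
  have "Ck_on k S (\<lambda>x. \<Sum>i\<in>UNIV. (partial_deriv a t x $ i) * partial_deriv i f (t x))" for a
    by (intro Ck_on_sum Ck_on_mult assms Suc.IH tk Ck_on_linear[OF _ bounded_linear_vec_nth])
       (use Suc.prems in auto)
  then have "Ck_on k S (partial_deriv a (\<lambda>x. f (t x)))" for a
    by (rule Ck_on_cong[OF assms(1), rotated]) (use Suc.prems assms(4) in \<open>auto simp: partial_deriv_compose image_subset_iff\<close>)
  moreover have "(\<lambda>x. f (t x)) differentiable (at x)" if "x \<in> S" for x
    using differentiable_chain_at[of t x f] Suc.prems that assms(4) by (auto simp: o_def image_subset_iff)
  ultimately show ?case by simp
qed

lemma Ck_on_local:
  assumes "open S" "\<And>x. x \<in> S \<Longrightarrow> \<exists>T. open T \<and> x \<in> T \<and> Ck_on k T f"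
  shows "Ck_on k S f"
  using assms(2)
proof (induction k arbitrary: f)
  case 0
  then show ?case
    using assms(1) by (auto simp: continuous_on_eq_continuous_at) (metis continuous_on_eq_continuous_at)
next
  case (Suc k)
  have "Ck_on k S (partial_deriv i f)" for i
    by (rule Suc.IH) (use Suc.prems in fastforce)
  then show ?case using Suc.prems by fastforce
qed

lemma smooth_on_cong: "open S \<Longrightarrow> (\<And>y. y \<in> S \<Longrightarrow> f y = g y) \<Longrightarrow> smooth_on S f \<Longrightarrow> smooth_on S g"
  unfolding smooth_on_def using Ck_on_cong[of S f g] by simp

lemma smooth_on_subset: "smooth_on S f \<Longrightarrow> T \<subseteq> S \<Longrightarrow> smooth_on T f"
  unfolding smooth_on_def using Ck_on_subset[of _ S f T] by simp

lemma smooth_on_const [simp, intro]: "smooth_on S (\<lambda>x. c)"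
  by (simp add: smooth_on_def Ck_on_const)

lemma smooth_on_add: "open S \<Longrightarrow> smooth_on S f \<Longrightarrow> smooth_on S g \<Longrightarrow> smooth_on S (\<lambda>x. f x + g x)"
  unfolding smooth_on_def using Ck_on_add[of S _ f g] by simp

lemma smooth_on_mult:
  fixes f g :: "real^'n::finite \<Rightarrow> real"
  shows "open S \<Longrightarrow> smooth_on S f \<Longrightarrow> smooth_on S g \<Longrightarrow> smooth_on S (\<lambda>x. f x * g x)"
  unfolding smooth_on_def using Ck_on_mult[of S _ f g] by simp

lemma smooth_on_inverse:
  fixes f :: "real^'n::finite \<Rightarrow> real"
  shows "open S \<Longrightarrow> smooth_on S f \<Longrightarrow> (\<And>x. x \<in> S \<Longrightarrow> f x \<noteq> 0) \<Longrightarrow> smooth_on S (\<lambda>x. inverse (f x))"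
  unfolding smooth_on_def using Ck_on_inverse[of S _ f] by simp

lemma smooth_on_sum: "open S \<Longrightarrow> (\<And>i. i \<in> I \<Longrightarrow> smooth_on S (f i)) \<Longrightarrow> smooth_on S (\<lambda>x. \<Sum>i\<in>I. f i x)"
  unfolding smooth_on_def using Ck_on_sum[of S I _ f] by simp

lemma smooth_on_linear: "open S \<Longrightarrow> bounded_linear L \<Longrightarrow> smooth_on S f \<Longrightarrow> smooth_on S (\<lambda>x. L (f x))"
  unfolding smooth_on_def using Ck_on_linear[of S L _ f] by simp

lemma smooth_on_compose:
  fixes f :: "real^'m::finite \<Rightarrow> real" and t :: "real^'n::finite \<Rightarrow> real^'m"
  shows "open S \<Longrightarrow> smooth_on T f \<Longrightarrow> smooth_on S t \<Longrightarrow> t ` S \<subseteq> T \<Longrightarrow> smooth_on S (\<lambda>x. f (t x))"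
  unfolding smooth_on_def using Ck_on_compose[of S _ T f t] by simp

lemma smooth_on_partial_deriv: "smooth_on S f \<Longrightarrow> smooth_on S (partial_deriv i f)"
  unfolding smooth_on_def
proof
  fix k assume "\<forall>k. Ck_on k S f"
  then have "Ck_on (Suc k) S f" by blast
  then show "Ck_on k S (partial_deriv i f)" by simp
qed

lemma smooth_on_differentiable: "smooth_on S f \<Longrightarrow> x \<in> S \<Longrightarrow> f differentiable (at x)"
  unfolding smooth_on_def by (drule spec[of _ "Suc 0"]) simp

lemma smooth_on_continuous: "smooth_on S f \<Longrightarrow> continuous_on S f"
  unfolding smooth_on_def by (drule spec[of _ 0]) simp

lemma smooth_on_local:
  "open S \<Longrightarrow> (\<And>x. x \<in> S \<Longrightarrow> \<exists>T. open T \<and> x \<in> T \<and> smooth_on T f) \<Longrightarrow> smooth_on S f"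
  unfolding smooth_on_def by (intro allI Ck_on_local) blast+

lemma bounded_linear_axis: "bounded_linear (axis i :: 'b::real_normed_vector \<Rightarrow> 'b^'m::finite)"
proof (rule bounded_linear_intro[where K=1])
  show "norm (axis i x :: 'b^'m) \<le> norm x * 1" for x
  proof -
    have "(\<Sum>k\<in>UNIV. (norm (axis i x $ k))\<^sup>2) = (\<Sum>k\<in>UNIV. if k = i then (norm x)\<^sup>2 else 0)"
      by (rule sum.cong) (auto simp: axis_def)
    then show ?thesis by (simp add: norm_vec_def L2_set_def)
  qed
qed (auto simp: axis_def vec_eq_iff)

lemma smooth_on_vec_iff:
  fixes f :: "real^'n::finite \<Rightarrow> 'b::real_normed_vector^'m::finite"
  assumes "open S"
  shows "smooth_on S f \<longleftrightarrow> (\<forall>i. smooth_on S (\<lambda>x. f x $ i))"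
proof
  assume "smooth_on S f"
  then show "\<forall>i. smooth_on S (\<lambda>x. f x $ i)"
    using smooth_on_linear[OF assms bounded_linear_vec_nth] by blast
next
  assume *: "\<forall>i. smooth_on S (\<lambda>x. f x $ i)"
  have "f = (\<lambda>x. \<Sum>i\<in>UNIV. axis i (f x $ i))"
    by (auto simp: vec_eq_iff axis_def fun_eq_iff)
  moreover have "smooth_on S (\<lambda>x. \<Sum>i\<in>UNIV. axis i (f x $ i))"
    by (intro smooth_on_sum assms smooth_on_linear[OF _ bounded_linear_axis]) (use * in auto)
  ultimately show "smooth_on S f" by simp
qed

section \<open>Symmetry of second partial derivatives\<close>

lemma DERIV_along_axis:
  fixes f :: "real^'n::finite \<Rightarrow> real"
  assumes "f differentiable (at (y + s *\<^sub>R axis i 1))"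
  shows "DERIV (\<lambda>s. f (y + s *\<^sub>R axis i 1)) s :> partial_deriv i f (y + s *\<^sub>R axis i 1)"
proof -
  have 1: "((\<lambda>s. y + s *\<^sub>R axis i 1) has_derivative (\<lambda>h. h *\<^sub>R axis i 1)) (at s)"
    by (auto intro!: derivative_eq_intros)
  have lin: "linear (frechet_derivative f (at (y + s *\<^sub>R axis i 1)))"
    using assms by (rule linear_frechet_derivative)
  show ?thesis
    using diff_chain_at[OF 1 has_derivative_frechet[OF assms]]
    by (simp add: has_field_derivative_def o_def linear_scale[OF lin] partial_deriv_def mult_commute_abs)
qed

text \<open>The mean value theorem is applied in direction \<open>i\<close> to the difference in
  direction \<open>j\<close>, and then in direction \<open>j\<close> to
  \<open>partial_deriv i f\<close>.\<close>

lemma second_difference: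
  fixes f :: "real^'n::finite \<Rightarrow> real" and i j :: 'n and x :: "real^'n"
  defines "p \<equiv> \<lambda>s t. x + s *\<^sub>R axis i 1 + t *\<^sub>R axis j 1"
  assumes S: "\<And>s t. 0 \<le> s \<Longrightarrow> s \<le> h \<Longrightarrow> 0 \<le> t \<Longrightarrow> t \<le> h \<Longrightarrow> p s t \<in> S"
    and sm: "smooth_on S f" and "0 < h"
  shows "\<exists>s t. 0 < s \<and> s < h \<and> 0 < t \<and> t < h \<and>
    f (p h h) - f (p h 0) - f (p 0 h) + f (p 0 0) = h * h * partial_deriv j (partial_deriv i f) (p s t)"
proof -
  have p1: "p s t = (x + t *\<^sub>R axis j 1) + s *\<^sub>R axis i 1" for s t by (simp add: p_def)
  have d1: "DERIV (\<lambda>s. f (p s t)) s :> partial_deriv i f (p s t)" if "0 \<le> s" "s \<le> h" "0 \<le> t" "t \<le> h" for s t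
    using DERIV_along_axis[of f "x + t *\<^sub>R axis j 1" s i] smooth_on_differentiable[OF sm S[OF that]]
    unfolding p1 by blast
  have d2: "DERIV (\<lambda>t. partial_deriv i f (p s t)) t :> partial_deriv j (partial_deriv i f) (p s t)"
    if "0 \<le> s" "s \<le> h" "0 \<le> t" "t \<le> h" for s t
    using DERIV_along_axis[of "partial_deriv i f" "x + s *\<^sub>R axis i 1" t j]
      smooth_on_differentiable[OF smooth_on_partial_deriv[OF sm] S[OF that]]
    unfolding p_def by blast
  have "\<exists>s>0. s < h \<and> (f (p h h) - f (p h 0)) - (f (p 0 h) - f (p 0 0)) = (h - 0) * (partial_deriv i f (p s h) - partial_deriv i f (p s 0))"
    by (rule MVT2[OF \<open>0 < h\<close>, of "\<lambda>s. f (p s h) - f (p s 0)"]) (intro DERIV_diff d1, use \<open>0 < h\<close> in auto)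
  then obtain s where s: "0 < s" "s < h"
    and e1: "(f (p h h) - f (p h 0)) - (f (p 0 h) - f (p 0 0)) = h * (partial_deriv i f (p s h) - partial_deriv i f (p s 0))"
    by auto
  have "\<exists>t>0. t < h \<and> partial_deriv i f (p s h) - partial_deriv i f (p s 0) = (h - 0) * partial_deriv j (partial_deriv i f) (p s t)"
    by (rule MVT2[OF \<open>0 < h\<close>, of "\<lambda>t. partial_deriv i f (p s t)"]) (intro d2, use s in auto)
  then obtain t where t: "0 < t" "t < h"
    and e2: "partial_deriv i f (p s h) - partial_deriv i f (p s 0) = h * partial_deriv j (partial_deriv i f) (p s t)"
    by auto
  have "f (p h h) - f (p h 0) - f (p 0 h) + f (p 0 0) = h * h * partial_deriv j (partial_deriv i f) (p s t)"
    using e1 unfolding e2 by (simp add: mult.assoc)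
  then show ?thesis using s t by blast
qed

text \<open>The second difference is symmetric in the two directions, so the two mixed derivatives
  take a common value at points arbitrarily close to \<open>x\<close>; continuity does the
  rest.\<close>

lemma partial_deriv_commute:
  fixes f :: "real^'n::finite \<Rightarrow> real"
  assumes "open S" "smooth_on S f" "x \<in> S"
  shows "partial_deriv i (partial_deriv j f) x = partial_deriv j (partial_deriv i f) x"
proof (rule ccontr)
  let ?a = "partial_deriv i (partial_deriv j f)" and ?b = "partial_deriv j (partial_deriv i f)"
  assume "?a x \<noteq> ?b x"
  define e where "e = \<bar>?a x - ?b x\<bar> / 2"
  have "e > 0" using \<open>?a x \<noteq> ?b x\<close> by (simp add: e_def)
  have "continuous (at x) ?a" "continuous (at x) ?b"
    using assms smooth_on_continuous[OF smooth_on_partial_deriv[OF smooth_on_partial_deriv[OF assms(2)]]]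
    by (auto simp: continuous_on_eq_continuous_at)
  then obtain d1 d2 where d: "d1 > 0" "d2 > 0" "\<And>y. dist y x < d1 \<Longrightarrow> dist (?a y) (?a x) < e"
      "\<And>y. dist y x < d2 \<Longrightarrow> dist (?b y) (?b x) < e"
    using \<open>e > 0\<close> unfolding continuous_at_eps_delta by metis
  obtain d3 where d3: "d3 > 0" "ball x d3 \<subseteq> S" using assms by (meson openE)
  \<comment> \<open>The points that occur lie within distance 2h of \<open>x\<close>, hence strictly
    inside all three balls.\<close>
  define h where "h = min d1 (min d2 d3) / 3"
  have h: "h > 0" "3 * h \<le> d1" "3 * h \<le> d2" "3 * h \<le> d3" using d(1,2) d3(1) by (auto simp: h_def)
  have near: "dist (x + s *\<^sub>R axis k 1 + t *\<^sub>R axis l 1) x < 3 * h" if "0 \<le> s" "s \<le> h" "0 \<le> t" "t \<le> h" for s t and k l :: 'n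
  proof -
    have "norm (s *\<^sub>R axis k 1 + t *\<^sub>R axis l 1 :: real^'n) \<le> s + t"
      using norm_triangle_ineq[of "s *\<^sub>R axis k 1" "t *\<^sub>R axis l 1 :: real^'n"] that by (simp add: norm_axis_1)
    then show ?thesis using that h(1) by (simp add: dist_norm add.assoc)
  qed
  then have inS: "x + s *\<^sub>R axis k 1 + t *\<^sub>R axis l 1 \<in> S" if "0 \<le> s" "s \<le> h" "0 \<le> t" "t \<le> h" for s t and k l :: 'n
  proof -
    have "x + s *\<^sub>R axis k 1 + t *\<^sub>R axis l 1 \<in> ball x d3"
      using near[OF that, of k l] h(4) by (simp only: mem_ball dist_commute[of x])
    then show ?thesis using d3(2) by blast
  qed
  obtain s t where st: "0 < s" "s < h" "0 < t" "t < h"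
    and e1: "f (x + h *\<^sub>R axis i 1 + h *\<^sub>R axis j 1) - f (x + h *\<^sub>R axis i 1 + 0 *\<^sub>R axis j 1) - f (x + 0 *\<^sub>R axis i 1 + h *\<^sub>R axis j 1) + f (x + 0 *\<^sub>R axis i 1 + 0 *\<^sub>R axis j 1)
      = h * h * ?b (x + s *\<^sub>R axis i 1 + t *\<^sub>R axis j 1)"
    using second_difference[OF inS assms(2) h(1), of i j] by blast
  obtain s' t' where st': "0 < s'" "s' < h" "0 < t'" "t' < h"
    and e2: "f (x + h *\<^sub>R axis j 1 + h *\<^sub>R axis i 1) - f (x + h *\<^sub>R axis j 1 + 0 *\<^sub>R axis i 1) - f (x + 0 *\<^sub>R axis j 1 + h *\<^sub>R axis i 1) + f (x + 0 *\<^sub>R axis j 1 + 0 *\<^sub>R axis i 1)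
      = h * h * ?a (x + s' *\<^sub>R axis j 1 + t' *\<^sub>R axis i 1)"
    using second_difference[OF inS assms(2) h(1), of j i] by blast
  have "h * h * ?b (x + s *\<^sub>R axis i 1 + t *\<^sub>R axis j 1) = h * h * ?a (x + s' *\<^sub>R axis j 1 + t' *\<^sub>R axis i 1)"
    unfolding e1[symmetric] e2[symmetric] by (simp add: ac_simps)
  then have eq: "?b (x + s *\<^sub>R axis i 1 + t *\<^sub>R axis j 1) = ?a (x + s' *\<^sub>R axis j 1 + t' *\<^sub>R axis i 1)"
    using h(1) by simp
  have "dist (?b (x + s *\<^sub>R axis i 1 + t *\<^sub>R axis j 1)) (?b x) < e"
    by (rule d(4)) (use near[of s t i j] st h in linarith)
  moreover have "dist (?a (x + s' *\<^sub>R axis j 1 + t' *\<^sub>R axis i 1)) (?a x) < e"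
    by (rule d(3)) (use near[of s' t' j i] st' h in linarith)
  ultimately have "dist (?a x) (?b x) < e + e"
    unfolding eq by (meson add_strict_mono dist_triangle3 le_less_trans)
  then show False by (simp add: e_def dist_real_def)
qed

section \<open>Smooth families of Laurent series\<close>

text \<open>Unlike a condition on \<open>fls_subdegree\<close>, which is 0 for the zero series, this
  bound is inherited by sums even when they cancel.\<close>

definition fls_ge :: "int \<Rightarrow> 'a::zero fls \<Rightarrow> bool" where
  "fls_ge p F \<longleftrightarrow> (\<forall>k<p. F $$ k = 0)"

lemma fls_geD: "fls_ge p F \<Longrightarrow> k < p \<Longrightarrow> F $$ k = 0"
  by (simp add: fls_ge_def)

lemma fls_ge_mono: "fls_ge p F \<Longrightarrow> q \<le> p \<Longrightarrow> fls_ge q F"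
  by (simp add: fls_ge_def)

lemma fls_ge_0 [simp]: "fls_ge p 0"
  by (simp add: fls_ge_def)

lemma fls_ge_subdegree: "fls_ge (fls_subdegree F) F"
  by (simp add: fls_ge_def)

lemma fls_ge_imp_subdegree: "fls_ge p F \<Longrightarrow> F \<noteq> 0 \<Longrightarrow> p \<le> fls_subdegree F"
  by (metis fls_geD nth_fls_subdegree_nonzero not_le)

lemma fls_ge_add: "fls_ge p F \<Longrightarrow> fls_ge p G \<Longrightarrow> fls_ge p (F + (G :: 'a::monoid_add fls))"
  by (simp add: fls_ge_def)

lemma fls_ge_minus: "fls_ge p F \<Longrightarrow> fls_ge p (- (F :: 'a::group_add fls))"
  by (simp add: fls_ge_def)

lemma fls_ge_diff: "fls_ge p F \<Longrightarrow> fls_ge p G \<Longrightarrow> fls_ge p (F - (G :: 'a::group_add fls))"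
  by (simp add: fls_ge_def)

lemma fls_sum_nth: "(sum F I :: 'a::comm_monoid_add fls) $$ k = (\<Sum>i\<in>I. F i $$ k)"
  by (induction I rule: infinite_finite_induct) simp_all

lemma fls_ge_sum: "(\<And>i. i \<in> I \<Longrightarrow> fls_ge p (F i)) \<Longrightarrow> fls_ge p (sum F I :: 'a::comm_monoid_add fls)"
  by (simp add: fls_ge_def fls_sum_nth)

text \<open>If \<open>p\<close> and \<open>q\<close> bound the orders of whole families, a
  coefficient of the product is a sum over a fixed finite range and can be differentiated
  termwise.\<close>

lemma fls_times_nth_ge:
  fixes F G :: "'a::comm_ring_1 fls"
  assumes "fls_ge p F" "fls_ge q G"
  shows "(F * G) $$ n = (\<Sum>i=p..n-q. F $$ i * G $$ (n - i))"
proof (cases "F = 0 \<or> G = 0")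
  case False
  define f g where "f = fls_subdegree F" and "g = fls_subdegree G"
  have fg: "p \<le> f" "q \<le> g"
    using False assms fls_ge_imp_subdegree by (auto simp: f_def g_def)
  have "(F * G) $$ n = (\<Sum>i=f..n-g. F $$ i * G $$ (n - i))"
    unfolding f_def g_def by (rule fls_times_nth(2))
  also have "\<dots> = (\<Sum>i=p..n-q. F $$ i * G $$ (n - i))"
  proof (rule sum.mono_neutral_left)
    show "\<forall>i\<in>{p..n - q} - {f..n - g}. F $$ i * G $$ (n - i) = 0"
    proof
      fix i assume i: "i \<in> {p..n - q} - {f..n - g}"
      then have "i < f \<or> n - i < g" by auto
      then show "F $$ i * G $$ (n - i) = 0" unfolding f_def g_def by auto
    qed
  qed (use fg in auto)
  finally show ?thesis .
qed auto

lemma fls_ge_mult: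
  fixes F G :: "'a::comm_ring_1 fls"
  assumes "fls_ge p F" "fls_ge q G"
  shows "fls_ge (p + q) (F * G)"
  by (simp add: fls_ge_def fls_times_nth_ge[OF assms])

lemma fls_ge_mult':
  fixes F G :: "'a::comm_ring_1 fls"
  assumes "fls_ge p F" "fls_ge q G" "r \<le> p + q"
  shows "fls_ge r (F * G)"
  using fls_ge_mono[OF fls_ge_mult[OF assms(1,2)] assms(3)] .

lemma fls_mult_lead:
  fixes F G :: "'a::comm_ring_1 fls"
  assumes "fls_ge p F" "fls_ge q G" "n = p + q"
  shows "(F * G) $$ n = F $$ p * G $$ q"
  by (simp add: fls_times_nth_ge[OF assms(1,2)] assms(3))

lemma fls_ge_const [simp]: "p \<le> 0 \<Longrightarrow> fls_ge p (fls_const c)"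
  by (simp add: fls_ge_def)

lemma fls_ge_1 [simp]: "p \<le> 0 \<Longrightarrow> fls_ge p 1"
  by (simp add: fls_ge_def)

lemma fls_X_inv_power_nth: "(fls_X_inv ^ n * F) $$ k = F $$ (k + int n)" for F :: "'a::comm_ring_1 fls"
  by (simp add: fls_X_inv_power_times_conv_shift)

lemma fls_X_power_nth: "(fls_X ^ n * F) $$ k = F $$ (k - int n)" for F :: "'a::comm_ring_1 fls"
  by (simp add: fls_X_power_times_conv_shift)

text \<open>The bound on the pole is uniform on \<open>U\<close>: this makes \<open>Abs_fls\<close>
  in \<open>formal_deriv\<close> meaningful and the ranges of summation in products independent of
  the point.\<close>

definition fls_smooth_on :: "(real^'n::finite) set \<Rightarrow> (real^'n \<Rightarrow> real fls) \<Rightarrow> bool" where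
  "fls_smooth_on U F \<longleftrightarrow> (\<exists>N. \<forall>x\<in>U. fls_ge N (F x)) \<and> (\<forall>k. smooth_on U (\<lambda>x. F x $$ k))"

lemma fls_smooth_onI:
  "(\<And>x. x \<in> U \<Longrightarrow> fls_ge N (F x)) \<Longrightarrow> (\<And>k. smooth_on U (\<lambda>x. F x $$ k)) \<Longrightarrow> fls_smooth_on U F"
  by (auto simp: fls_smooth_on_def)

lemma fls_smooth_onE:
  assumes "fls_smooth_on U F"
  obtains N where "\<And>x. x \<in> U \<Longrightarrow> fls_ge N (F x)"
  using assms by (auto simp: fls_smooth_on_def)

lemma fls_smooth_on_nth: "fls_smooth_on U F \<Longrightarrow> smooth_on U (\<lambda>x. F x $$ k)"
  by (simp add: fls_smooth_on_def)

lemma fls_smooth_on_subset: "fls_smooth_on U F \<Longrightarrow> V \<subseteq> U \<Longrightarrow> fls_smooth_on V F"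
  unfolding fls_smooth_on_def using smooth_on_subset by (metis subsetD)

lemma fls_smooth_on_cong:
  assumes "open U" "\<And>x. x \<in> U \<Longrightarrow> F x = G x" "fls_smooth_on U F"
  shows "fls_smooth_on U G"
proof -
  obtain N where N: "\<And>x. x \<in> U \<Longrightarrow> fls_ge N (F x)" using assms(3) by (auto simp: fls_smooth_on_def)
  show ?thesis
  proof (rule fls_smooth_onI[of _ N])
    show "smooth_on U (\<lambda>x. G x $$ k)" for k
      by (rule smooth_on_cong[OF assms(1) _ fls_smooth_on_nth[OF assms(3), of k]]) (simp add: assms(2))
  qed (use N assms(2) in force)
qed

lemma fls_smooth_on_fls_const: "smooth_on U u \<Longrightarrow> fls_smooth_on U (\<lambda>x. fls_const (u x))"
proof (rule fls_smooth_onI[of _ 0])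
  assume "smooth_on U u"
  then show "smooth_on U (\<lambda>x. fls_const (u x) $$ k)" for k by (cases "k = 0") simp_all
qed simp

lemma fls_smooth_on_const [simp]: "fls_smooth_on U (\<lambda>x. F)"
  by (rule fls_smooth_onI[of _ "fls_subdegree F"]) (auto intro: fls_ge_subdegree)

lemma fls_smooth_on_add:
  assumes "open U" "fls_smooth_on U F" "fls_smooth_on U G"
  shows "fls_smooth_on U (\<lambda>x. F x + G x)"
proof -
  obtain N M where N: "\<And>x. x \<in> U \<Longrightarrow> fls_ge N (F x)" "\<And>x. x \<in> U \<Longrightarrow> fls_ge M (G x)"
    using assms fls_smooth_onE by metis
  show ?thesis
  proof (rule fls_smooth_onI[of _ "min N M"])
    show "fls_ge (min N M) (F x + G x)" if "x \<in> U" for x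
      by (intro fls_ge_add fls_ge_mono[OF N(1)] fls_ge_mono[OF N(2)] that) auto
  qed (use assms in \<open>auto intro!: smooth_on_add fls_smooth_on_nth\<close>)
qed

lemma fls_smooth_on_mult:
  assumes "open U" "fls_smooth_on U F" "fls_smooth_on U G"
  shows "fls_smooth_on U (\<lambda>x. F x * G x)"
proof -
  obtain N M where N: "\<And>x. x \<in> U \<Longrightarrow> fls_ge N (F x)" "\<And>x. x \<in> U \<Longrightarrow> fls_ge M (G x)"
    using assms fls_smooth_onE by metis
  show ?thesis
  proof (rule fls_smooth_onI[of _ "N + M"])
    show "fls_ge (N + M) (F x * G x)" if "x \<in> U" for x
      by (intro fls_ge_mult N that)
    show "smooth_on U (\<lambda>x. (F x * G x) $$ k)" for k
    proof (rule smooth_on_cong[OF assms(1)])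
      show "(\<Sum>i=N..k-M. F x $$ i * G x $$ (k - i)) = (F x * G x) $$ k" if "x \<in> U" for x
        using fls_times_nth_ge[OF N(1) N(2)] that by simp
      show "smooth_on U (\<lambda>x. \<Sum>i=N..k-M. F x $$ i * G x $$ (k - i))"
        by (intro smooth_on_sum smooth_on_mult fls_smooth_on_nth assms)
    qed
  qed
qed

lemma fls_smooth_on_minus:
  assumes "open U" "fls_smooth_on U F"
  shows "fls_smooth_on U (\<lambda>x. - F x)"
  using fls_smooth_on_mult[OF assms(1) fls_smooth_on_const[of U "-1"] assms(2)] by simp

lemma fls_smooth_on_diff:
  assumes "open U" "fls_smooth_on U F" "fls_smooth_on U G"
  shows "fls_smooth_on U (\<lambda>x. F x - G x)"
  using fls_smooth_on_add[OF assms(1,2) fls_smooth_on_minus[OF assms(1,3)]] by simp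

lemma fls_smooth_on_sum:
  assumes "open U" "\<And>i. i \<in> I \<Longrightarrow> fls_smooth_on U (F i)"
  shows "fls_smooth_on U (\<lambda>x. \<Sum>i\<in>I. F i x)"
  using assms(2) by (induction I rule: infinite_finite_induct) (auto intro: fls_smooth_on_add assms(1))

lemma fls_smooth_on_prod:
  assumes "open U" "\<And>i. i \<in> I \<Longrightarrow> fls_smooth_on U (F i)"
  shows "fls_smooth_on U (\<lambda>x. \<Prod>i\<in>I. F i x)"
  using assms(2) by (induction I rule: infinite_finite_induct) (auto intro: fls_smooth_on_mult assms(1))

lemma fls_ge_0_conv_fps:
  assumes "fls_ge 0 (F :: 'a::comm_ring_1 fls)"
  shows "F = fps_to_fls (Abs_fps (\<lambda>n. F $$ int n))"
  by (rule fls_eqI) (use assms in \<open>auto simp: fls_ge_def\<close>)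

text \<open>The third claim is a recursion for the coefficients of the inverse, through which their
  smoothness follows by induction.\<close>

lemma fls_inverse_ge_0:
  fixes F :: "real fls"
  assumes "fls_ge 0 F" "F $$ 0 \<noteq> 0"
  shows "fls_ge 0 (inverse F)" "inverse F $$ 0 = inverse (F $$ 0)" 
    "0 < n \<Longrightarrow> inverse F $$ int n = - inverse (F $$ 0) * (\<Sum>i=1..n. F $$ int i * inverse F $$ int (n - i))"
proof -
  define f where "f = Abs_fps (\<lambda>n. F $$ int n)"
  have F: "F = fps_to_fls f" unfolding f_def by (rule fls_ge_0_conv_fps[OF assms(1)])
  have f0: "fps_nth f 0 \<noteq> 0" using assms(2) by (simp add: f_def)
  then have iF: "inverse F = fps_to_fls (inverse f)"
    unfolding F by (intro fls_inverse_fps_to_fls) simp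
  show "fls_ge 0 (inverse F)" by (simp add: iF fls_ge_def)
  show "inverse F $$ 0 = inverse (F $$ 0)" by (simp add: iF) (simp add: F)
  assume "0 < n"
  have "fps_nth (f * inverse f) n = 0" using f0 \<open>0 < n\<close> by (simp add: inverse_mult_eq_1')
  then have "fps_nth f 0 * fps_nth (inverse f) n + (\<Sum>i=1..n. fps_nth f i * fps_nth (inverse f) (n - i)) = 0"
    by (simp add: fps_mult_nth sum.atLeast_Suc_atMost)
  then have "fps_nth (inverse f) n = - inverse (fps_nth f 0) * (\<Sum>i=1..n. fps_nth f i * fps_nth (inverse f) (n - i))"
    using f0 by (simp add: field_simps)
  moreover have "fps_to_fls u $$ int k = fps_nth u k" for u :: "real fps" and k by simp
  moreover have "F $$ int i = fps_nth f i" "F $$ 0 = fps_nth f 0" for i by (simp_all add: f_def)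
  ultimately show "inverse F $$ int n = - inverse (F $$ 0) * (\<Sum>i=1..n. F $$ int i * inverse F $$ int (n - i))"
    by (simp only: iF)
qed

lemma fls_smooth_on_inverse:
  assumes "open U" "fls_smooth_on U F" "\<And>x. x \<in> U \<Longrightarrow> fls_ge 0 (F x)" "\<And>x. x \<in> U \<Longrightarrow> F x $$ 0 \<noteq> 0"
  shows "fls_smooth_on U (\<lambda>x. inverse (F x))"
proof (rule fls_smooth_onI[of _ 0])
  show ge: "fls_ge 0 (inverse (F x))" if "x \<in> U" for x
    using fls_inverse_ge_0(1) assms that by blast
  have nat: "smooth_on U (\<lambda>x. inverse (F x) $$ int n)" for n
  proof (induction n rule: less_induct)
    case (less n)
    show ?case
    proof (cases "n = 0")
      case True
      have "smooth_on U (\<lambda>x. inverse (F x $$ 0))"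
        by (intro smooth_on_inverse assms fls_smooth_on_nth)
      then show ?thesis
        by (rule smooth_on_cong[OF assms(1), rotated]) (simp add: True fls_inverse_ge_0(2) assms)
    next
      case False
      have "smooth_on U (\<lambda>x. (- 1) * inverse (F x $$ 0) * (\<Sum>i=1..n. F x $$ int i * inverse (F x) $$ int (n - i)))"
        by (intro smooth_on_mult smooth_on_sum smooth_on_const smooth_on_inverse assms fls_smooth_on_nth less.IH)
           (use False in auto)
      then show ?thesis
        by (rule smooth_on_cong[OF assms(1), rotated]) (use False in \<open>simp add: fls_inverse_ge_0(3) assms\<close>)
    qed
  qed
  show "smooth_on U (\<lambda>x. inverse (F x) $$ k)" for k
  proof (cases "k < 0")
    case True
    show ?thesis by (rule smooth_on_cong[OF assms(1) _ smooth_on_const[of _ 0]]) (use ge fls_geD True in force)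
  next
    case False
    then show ?thesis using nat[of "nat k"] by simp
  qed
qed

section \<open>Formal derivatives\<close>

lemma formal_deriv_None_nth: "formal_deriv None F x $$ k = - (of_int (k - 1) * F x $$ (k - 1))"
  by (simp add: fls_X_power_times_conv_shift)

lemma formal_deriv_Some_nth:
  assumes "open U" "x \<in> U" "fls_smooth_on U F"
  shows "formal_deriv (Some i) F x $$ k = partial_deriv i (\<lambda>y. F y $$ k) x"
proof -
  obtain N where N: "\<And>x. x \<in> U \<Longrightarrow> fls_ge N (F x)" using assms(3) by (auto simp: fls_smooth_on_def)
  have "partial_deriv i (\<lambda>y. F y $$ k) x = 0" if "k < N" for k
  proof -
    have "partial_deriv i (\<lambda>y. F y $$ k) x = partial_deriv i (\<lambda>y. 0) x"
      by (rule partial_deriv_cong[OF assms(1,2)]) (use N that fls_geD in blast)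
    then show ?thesis by (simp add: partial_deriv_const)
  qed
  then show ?thesis by (simp add: nth_Abs_fls_lower_bound[of N])
qed

lemma formal_deriv_cong:
  assumes "open U" "x \<in> U" "\<And>y. y \<in> U \<Longrightarrow> F y = G y"
  shows "formal_deriv a F x = formal_deriv a G x"
proof (cases a)
  case None
  then show ?thesis using assms by simp
next
  case (Some i)
  have "partial_deriv i (\<lambda>y. F y $$ k) x = partial_deriv i (\<lambda>y. G y $$ k) x" for k
    by (rule partial_deriv_cong[OF assms(1,2)]) (simp add: assms(3))
  then show ?thesis using Some by simp
qed

declare formal_deriv.simps [simp del]

lemma fls_ge_formal_deriv_None: "fls_ge p (F x) \<Longrightarrow> fls_ge (p + 1) (formal_deriv None F x)"
  unfolding fls_ge_def formal_deriv_None_nth by simp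

lemma fls_ge_formal_deriv_Some:
  assumes "open U" "x \<in> U" "\<And>y. y \<in> U \<Longrightarrow> fls_ge p (F y)" "fls_smooth_on U F"
  shows "fls_ge p (formal_deriv (Some i) F x)"
  unfolding fls_ge_def formal_deriv_Some_nth[OF assms(1,2,4)]
proof (intro allI impI)
  fix k assume "k < p"
  have "partial_deriv i (\<lambda>y. F y $$ k) x = partial_deriv i (\<lambda>y. 0) x"
    by (rule partial_deriv_cong[OF assms(1,2)]) (use assms(3) \<open>k < p\<close> fls_geD in blast)
  then show "partial_deriv i (\<lambda>y. F y $$ k) x = 0" by (simp add: partial_deriv_const)
qed

lemma fls_smooth_on_formal_deriv:
  assumes "open U" "fls_smooth_on U F"
  shows "fls_smooth_on U (formal_deriv a F)"
proof -
  obtain N where N: "\<And>x. x \<in> U \<Longrightarrow> fls_ge N (F x)" using assms(2) by (auto simp: fls_smooth_on_def)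
  show ?thesis
  proof (cases a)
    case None
    show ?thesis unfolding None
    proof (rule fls_smooth_onI)
      have "smooth_on U (\<lambda>x. - of_int (k - 1) * F x $$ (k - 1))" for k
        by (intro smooth_on_mult smooth_on_const fls_smooth_on_nth assms)
      then show "smooth_on U (\<lambda>x. formal_deriv None F x $$ k)" for k
        unfolding formal_deriv_None_nth by (simp only: mult_minus_left)
    qed (rule fls_ge_formal_deriv_None[OF N])
  next
    case (Some i)
    show ?thesis unfolding Some
    proof (rule fls_smooth_onI)
      show "smooth_on U (\<lambda>x. formal_deriv (Some i) F x $$ k)" for k
        by (rule smooth_on_cong[OF assms(1) _ smooth_on_partial_deriv[OF fls_smooth_on_nth[OF assms(2), of k], of i]])
           (simp only: formal_deriv_Some_nth[OF assms(1) _ assms(2)])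
    qed (rule fls_ge_formal_deriv_Some[OF assms(1) _ N assms(2)])
  qed
qed

lemma formal_deriv_add:
  assumes "open U" "x \<in> U" "fls_smooth_on U F" "fls_smooth_on U G"
  shows "formal_deriv a (\<lambda>y. F y + G y) x = formal_deriv a F x + formal_deriv a G x"
proof (cases a)
  case None
  then show ?thesis by (simp add: formal_deriv.simps algebra_simps)
next
  case (Some i)
  have "formal_deriv (Some i) (\<lambda>y. F y + G y) x $$ k = (formal_deriv (Some i) F x + formal_deriv (Some i) G x) $$ k" for k
    unfolding fls_plus_nth formal_deriv_Some_nth[OF assms(1,2) fls_smooth_on_add[OF assms(1,3,4)]]
      formal_deriv_Some_nth[OF assms(1,2,3)] formal_deriv_Some_nth[OF assms(1,2,4)]
    by (rule partial_deriv_add) (use assms smooth_on_differentiable fls_smooth_on_nth in blast)+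
  then show ?thesis unfolding Some by (rule fls_eqI)
qed

lemma partial_deriv_sum:
  fixes f :: "'i \<Rightarrow> real^'n::finite \<Rightarrow> 'b::real_normed_vector"
  assumes "\<And>i. i \<in> I \<Longrightarrow> f i differentiable (at x)"
  shows "partial_deriv a (\<lambda>x. \<Sum>i\<in>I. f i x) x = (\<Sum>i\<in>I. partial_deriv a (f i) x)"
  using partial_deriv_eqI[OF has_derivative_sum[of I f "\<lambda>i. frechet_derivative (f i) (at x)" "at x"]]
    assms by (simp add: has_derivative_frechet partial_deriv_def)

text \<open>For tangential derivatives the ordinary Leibniz rule is applied to the finite sum giving
  each coefficient. The derivatives satisfy the same order bounds as the factors, so the two
  resulting sums are again coefficients of products.\<close>

lemma formal_deriv_mult:
  assumes "open U" "x \<in> U" "fls_smooth_on U F" "fls_smooth_on U G"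
  shows "formal_deriv a (\<lambda>y. F y * G y) x = formal_deriv a F x * G x + F x * formal_deriv a G x"
proof (cases a)
  case None
  then show ?thesis by (simp add: formal_deriv.simps algebra_simps)
next
  case (Some i)
  obtain N M where N: "\<And>x. x \<in> U \<Longrightarrow> fls_ge N (F x)" "\<And>x. x \<in> U \<Longrightarrow> fls_ge M (G x)"
    using assms fls_smooth_onE by metis
  have dF: "(\<lambda>x. F x $$ k) differentiable (at x)" and dG: "(\<lambda>x. G x $$ k) differentiable (at x)" for k
    using assms smooth_on_differentiable fls_smooth_on_nth by blast+
  have "formal_deriv (Some i) (\<lambda>y. F y * G y) x $$ k = (formal_deriv (Some i) F x * G x + F x * formal_deriv (Some i) G x) $$ k" for k
  proof -
    have "formal_deriv (Some i) (\<lambda>y. F y * G y) x $$ k = partial_deriv i (\<lambda>y. (F y * G y) $$ k) x"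
      by (rule formal_deriv_Some_nth[OF assms(1,2) fls_smooth_on_mult[OF assms(1,3,4)]])
    also have "\<dots> = partial_deriv i (\<lambda>y. \<Sum>j=N..k-M. F y $$ j * G y $$ (k - j)) x"
      by (rule partial_deriv_cong[OF assms(1,2)]) (rule fls_times_nth_ge[OF N])
    also have "\<dots> = (\<Sum>j=N..k-M. partial_deriv i (\<lambda>y. F y $$ j * G y $$ (k - j)) x)"
      by (rule partial_deriv_sum) (intro differentiable_mult dF dG)
    also have "\<dots> = (\<Sum>j=N..k-M. formal_deriv (Some i) F x $$ j * G x $$ (k - j)) + (\<Sum>j=N..k-M. F x $$ j * formal_deriv (Some i) G x $$ (k - j))"
      unfolding formal_deriv_Some_nth[OF assms(1,2,3)] formal_deriv_Some_nth[OF assms(1,2,4)]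
      by (simp add: partial_deriv_mult dF dG sum.distrib)
    finally show ?thesis
      using fls_times_nth_ge[OF fls_ge_formal_deriv_Some[OF assms(1,2) N(1) assms(3), of i] N(2)[OF assms(2)], of k]
        fls_times_nth_ge[OF N(1)[OF assms(2)] fls_ge_formal_deriv_Some[OF assms(1,2) N(2) assms(4), of i], of k]
      by simp
  qed
  then show ?thesis unfolding Some by (rule fls_eqI)
qed

lemma formal_deriv_const: "formal_deriv (Some i) (\<lambda>y. F) x = 0"
proof (rule fls_eqI)
  fix k
  show "formal_deriv (Some i) (\<lambda>y. F) x $$ k = 0 $$ k"
    using formal_deriv_Some_nth[of UNIV x "\<lambda>y. F" i k] by (simp add: partial_deriv_const)
qed

lemma formal_deriv_fls_const: "formal_deriv a (\<lambda>y. fls_const c) x = 0"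
  by (cases a) (simp add: formal_deriv.simps, simp only: formal_deriv_const)

lemma formal_deriv_commute:
  assumes "open U" "x \<in> U" "fls_smooth_on U F"
  shows "formal_deriv a (formal_deriv b F) x = formal_deriv b (formal_deriv a F) x"
proof -
  have NS: "formal_deriv None (formal_deriv (Some i) F) x = formal_deriv (Some i) (formal_deriv None F) x" for i
  proof (rule fls_eqI)
    fix k
    have "formal_deriv (Some i) (formal_deriv None F) x $$ k = partial_deriv i (\<lambda>y. (- of_int (k - 1)) * F y $$ (k - 1)) x"
      unfolding formal_deriv_Some_nth[OF assms(1,2) fls_smooth_on_formal_deriv[OF assms(1,3)]] formal_deriv_None_nth by (simp only: mult_minus_left)
    also have "\<dots> = (- of_int (k - 1)) * partial_deriv i (\<lambda>y. F y $$ (k - 1)) x"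
      by (rule partial_deriv_linear[OF bounded_linear_mult_right])
         (use assms smooth_on_differentiable fls_smooth_on_nth in blast)
    finally show "formal_deriv None (formal_deriv (Some i) F) x $$ k = formal_deriv (Some i) (formal_deriv None F) x $$ k"
      unfolding formal_deriv_None_nth formal_deriv_Some_nth[OF assms] by (simp only: mult_minus_left)
  qed
  have SS: "formal_deriv (Some i) (formal_deriv (Some j) F) x = formal_deriv (Some j) (formal_deriv (Some i) F) x" for i j
  proof (rule fls_eqI)
    fix k
    have *: "formal_deriv (Some i) (formal_deriv (Some j) F) x $$ k = partial_deriv i (partial_deriv j (\<lambda>y. F y $$ k)) x" for i j
      unfolding formal_deriv_Some_nth[OF assms(1,2) fls_smooth_on_formal_deriv[OF assms(1,3)]]
      by (rule partial_deriv_cong[OF assms(1,2)]) (rule formal_deriv_Some_nth[OF assms(1) _ assms(3)])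
    show "formal_deriv (Some i) (formal_deriv (Some j) F) x $$ k = formal_deriv (Some j) (formal_deriv (Some i) F) x $$ k"
      unfolding * by (rule partial_deriv_commute[OF assms(1) fls_smooth_on_nth[OF assms(3)] assms(2)])
  qed
  show ?thesis
    by (cases a; cases b) (simp_all only: NS SS)
qed

text \<open>This is the substitution \<open>r \<mapsto> - r\<close>, whence the sign in its commutation rule with \<open>d/dr\<close>.\<close>

definition fls_reflect :: "real fls \<Rightarrow> real fls" where
  "fls_reflect F = Abs_fls (\<lambda>k. if even k then F $$ k else - (F $$ k))"

lemma fls_reflect_nth: "fls_reflect F $$ k = (if even k then F $$ k else - (F $$ k))"
  unfolding fls_reflect_def by (rule nth_Abs_fls_lower_bound[of "fls_subdegree F"]) simp

lemma fls_ge_reflect: "fls_ge p (fls_reflect F) \<longleftrightarrow> fls_ge p F"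
  by (auto simp: fls_ge_def fls_reflect_nth)

lemma fls_reflect_add: "fls_reflect (F + G) = fls_reflect F + fls_reflect G"
  by (rule fls_eqI) (simp add: fls_reflect_nth)

lemma fls_reflect_mult: "fls_reflect (F * G) = fls_reflect F * fls_reflect G"
proof (rule fls_eqI)
  fix n
  have g: "fls_ge (fls_subdegree F) (fls_reflect F)" "fls_ge (fls_subdegree G) (fls_reflect G)"
    by (simp_all add: fls_ge_reflect fls_ge_subdegree)
  show "fls_reflect (F * G) $$ n = (fls_reflect F * fls_reflect G) $$ n"
    using fls_times_nth_ge[OF g, of n] fls_times_nth_ge[OF fls_ge_subdegree[of F] fls_ge_subdegree[of G], of n]
    by (simp only: fls_reflect_nth[of "F * G"]) (auto simp: fls_reflect_nth sum_negf[symmetric] intro!: sum.cong)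
qed

lemma fls_reflect_const [simp]: "fls_reflect (fls_const c) = fls_const c"
  by (rule fls_eqI) (simp add: fls_reflect_nth)

lemma fls_reflect_formal_deriv_None: "formal_deriv None (\<lambda>y. fls_reflect (F y)) x = - fls_reflect (formal_deriv None F x)"
  by (rule fls_eqI) (simp add: formal_deriv_None_nth fls_reflect_nth)

lemma fls_smooth_on_reflect:
  assumes "open U" "fls_smooth_on U F"
  shows "fls_smooth_on U (\<lambda>x. fls_reflect (F x))"
proof -
  obtain N where N: "\<And>x. x \<in> U \<Longrightarrow> fls_ge N (F x)" using assms(2) by (auto simp: fls_smooth_on_def)
  have c: "smooth_on U (\<lambda>x. (if even k then 1 else - 1) * F x $$ k)" for k
    by (intro smooth_on_mult smooth_on_const fls_smooth_on_nth assms)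
  have "smooth_on U (\<lambda>x. fls_reflect (F x) $$ k)" for k
    by (rule smooth_on_cong[OF assms(1) _ c[of k]]) (simp add: fls_reflect_nth)
  then show ?thesis by (intro fls_smooth_onI[of _ N]) (simp_all add: fls_ge_reflect N)
qed

lemma fls_reflect_formal_deriv_Some:
  assumes "open U" "x \<in> U" "fls_smooth_on U F"
  shows "formal_deriv (Some i) (\<lambda>y. fls_reflect (F y)) x = fls_reflect (formal_deriv (Some i) F x)"
proof (rule fls_eqI)
  fix k
  have "partial_deriv i (\<lambda>y. fls_reflect (F y) $$ k) x = partial_deriv i (\<lambda>y. (if even k then 1 else - 1) * F y $$ k) x"
    by (rule partial_deriv_cong[OF assms(1,2)]) (simp add: fls_reflect_nth)
  also have "\<dots> = (if even k then 1 else - 1) * partial_deriv i (\<lambda>y. F y $$ k) x"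
    by (rule partial_deriv_linear[OF bounded_linear_mult_right])
       (use assms smooth_on_differentiable fls_smooth_on_nth in blast)
  finally show "formal_deriv (Some i) (\<lambda>y. fls_reflect (F y)) x $$ k = fls_reflect (formal_deriv (Some i) F x) $$ k"
    unfolding formal_deriv_Some_nth[OF assms(1,2) fls_smooth_on_reflect[OF assms(1,3)]]
      fls_reflect_nth by (simp add: formal_deriv_Some_nth[OF assms])
qed

lemma christoffel_smooth:
  assumes "open U" "\<And>i j. fls_smooth_on U (\<lambda>x. g x $ i $ j)" "\<And>i j. fls_smooth_on U (\<lambda>x. matrix_inv (g x) $ i $ j)"
  shows "fls_smooth_on U (christoffel g a b c)"
  unfolding christoffel_def[abs_def] by (intro fls_smooth_on_mult fls_smooth_on_const fls_smooth_on_sum fls_smooth_on_add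
        fls_smooth_on_diff fls_smooth_on_formal_deriv assms)

lemma ricci_smooth:
  assumes "open U" "\<And>i j. fls_smooth_on U (\<lambda>x. g x $ i $ j)" "\<And>i j. fls_smooth_on U (\<lambda>x. matrix_inv (g x) $ i $ j)"
  shows "fls_smooth_on U (ricci g b c)"
  unfolding ricci_def[abs_def] by (intro fls_smooth_on_mult fls_smooth_on_sum fls_smooth_on_add
        fls_smooth_on_diff fls_smooth_on_formal_deriv christoffel_smooth assms)

lemma hessian_smooth:
  assumes "open U" "\<And>i j. fls_smooth_on U (\<lambda>x. g x $ i $ j)" "\<And>i j. fls_smooth_on U (\<lambda>x. matrix_inv (g x) $ i $ j)"
    "fls_smooth_on U f"
  shows "fls_smooth_on U (hessian g f b c)"
  unfolding hessian_def[abs_def] by (intro fls_smooth_on_mult fls_smooth_on_sum fls_smooth_on_add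
        fls_smooth_on_diff fls_smooth_on_formal_deriv christoffel_smooth assms)

text \<open>Below \<open>\<psi>\<close> is the germ at a point, possibly taken after a change of coordinates or after \<open>r \<mapsto> - r\<close>.
  Identities of the abstract tensor calculus thereby become identities between the formal components.\<close>

locale realization =
  fixes U :: "(real^'n::finite) set" and \<psi> :: "(real^'n \<Rightarrow> real fls) \<Rightarrow> 'a::comm_ring_1"
    and E :: "'n option \<Rightarrow> 'a \<Rightarrow> 'a" and hf :: 'a
  assumes open_U: "open U"
    and \<psi>_cong: "fls_smooth_on U F \<Longrightarrow> (\<And>x. x \<in> U \<Longrightarrow> F x = G x) \<Longrightarrow> \<psi> F = \<psi> G"
    and \<psi>_add: "fls_smooth_on U F \<Longrightarrow> fls_smooth_on U G \<Longrightarrow> \<psi> (\<lambda>x. F x + G x) = \<psi> F + \<psi> G"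
    and \<psi>_mult: "fls_smooth_on U F \<Longrightarrow> fls_smooth_on U G \<Longrightarrow> \<psi> (\<lambda>x. F x * G x) = \<psi> F * \<psi> G"
    and \<psi>_half: "\<psi> (\<lambda>x. fls_const (1/2)) = hf"
    and \<psi>_1: "\<psi> (\<lambda>x. 1) = 1"
    and \<psi>_deriv: "fls_smooth_on U F \<Longrightarrow> \<psi> (formal_deriv a F) = E a (\<psi> F)"
begin

lemma \<psi>_0: "\<psi> (\<lambda>x. 0) = 0"
  using \<psi>_add[of "\<lambda>x. 0" "\<lambda>x. 0"] by simp

lemma \<psi>_minus:
  assumes "fls_smooth_on U F"
  shows "\<psi> (\<lambda>x. - F x) = - \<psi> F"
  using \<psi>_add[OF assms fls_smooth_on_minus[OF open_U assms]]
  by (simp add: \<psi>_0 eq_neg_iff_add_eq_0 add.commute)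

lemma \<psi>_diff: "fls_smooth_on U F \<Longrightarrow> fls_smooth_on U G \<Longrightarrow> \<psi> (\<lambda>x. F x - G x) = \<psi> F - \<psi> G"
  using \<psi>_add[of F "\<lambda>x. - G x"] fls_smooth_on_minus[OF open_U, of G] by (simp add: \<psi>_minus)

lemma \<psi>_sum: "(\<And>i. i \<in> I \<Longrightarrow> fls_smooth_on U (F i)) \<Longrightarrow> \<psi> (\<lambda>x. \<Sum>i\<in>I. F i x) = (\<Sum>i\<in>I. \<psi> (F i))"
proof (induction I rule: infinite_finite_induct)
  case (insert i I)
  then show ?case
    using \<psi>_add[of "F i" "\<lambda>x. \<Sum>i\<in>I. F i x"] fls_smooth_on_sum[OF open_U, of I F] by simp
qed (simp_all add: \<psi>_0)

definition \<psi>m where "\<psi>m g = (\<chi> i j. \<psi> (\<lambda>x. g x $ i $ j))"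

lemma \<psi>m_nth: "\<psi>m g $ i $ j = \<psi> (\<lambda>x. g x $ i $ j)"
  by (simp add: \<psi>m_def)

lemma \<psi>m_inverse:
  assumes "\<And>i j. fls_smooth_on U (\<lambda>x. g x $ i $ j)" "\<And>i j. fls_smooth_on U (\<lambda>x. h x $ i $ j)"
    and "\<And>x. x \<in> U \<Longrightarrow> g x ** h x = mat 1"
  shows "\<psi>m g ** \<psi>m h = mat 1"
proof -
  have "(\<psi>m g ** \<psi>m h) $ i $ j = mat 1 $ i $ j" for i j
  proof -
    have "(\<psi>m g ** \<psi>m h) $ i $ j = \<psi> (\<lambda>x. \<Sum>k\<in>UNIV. g x $ i $ k * h x $ k $ j)"
      by (simp add: matrix_mult_nth \<psi>m_nth \<psi>_sum \<psi>_mult assms(1,2) fls_smooth_on_mult open_U)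
    also have "\<dots> = \<psi> (\<lambda>x. mat 1 $ i $ j)"
    proof (rule \<psi>_cong)
      show "fls_smooth_on U (\<lambda>x. \<Sum>k\<in>UNIV. g x $ i $ k * h x $ k $ j)"
        by (intro fls_smooth_on_sum fls_smooth_on_mult assms open_U)
      show "(\<Sum>k\<in>UNIV. g x $ i $ k * h x $ k $ j) = mat 1 $ i $ j" if "x \<in> U" for x
        using assms(3)[OF that] matrix_mult_nth[of "g x" "h x" i j] by simp
    qed
    also have "\<dots> = mat 1 $ i $ j" by (simp add: mat_def \<psi>_0 \<psi>_1)
    finally show ?thesis .
  qed
  then show ?thesis by (simp add: vec_eq_iff)
qed

context
  fixes g :: "'n formal_metric"
  assumes g: "\<And>i j. fls_smooth_on U (\<lambda>x. g x $ i $ j)"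
    and gi: "\<And>i j. fls_smooth_on U (\<lambda>x. matrix_inv (g x) $ i $ j)"
begin

abbreviation "Gam \<equiv> connection hf E (\<psi>m g) (\<psi>m (\<lambda>x. matrix_inv (g x)))"

lemma \<psi>_christoffel: "\<psi> (christoffel g a b c) = Gam b $ a $ c"
  unfolding christoffel_def[abs_def]
  by (simp add: \<psi>_mult \<psi>_sum \<psi>_diff \<psi>_add \<psi>_half \<psi>_deriv g gi connection_def \<psi>m_nth
      fls_smooth_on_mult fls_smooth_on_sum fls_smooth_on_add fls_smooth_on_diff fls_smooth_on_formal_deriv open_U
      del: sum_divide_distrib)

lemmas sm = fls_smooth_on_mult fls_smooth_on_sum fls_smooth_on_add fls_smooth_on_diff fls_smooth_on_formal_deriv
  open_U christoffel_smooth[OF open_U g gi]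

lemma \<psi>_ricci: "\<psi> (ricci g b c) = ric E Gam b c"
  unfolding ricci_def[abs_def]
  by (simp add: \<psi>_mult \<psi>_sum \<psi>_diff \<psi>_add \<psi>_deriv \<psi>_christoffel sm ric_def curv_def matrix_mult_nth sum_subtractf)
     (simp add: sum.distrib sum_subtractf algebra_simps)

lemma \<psi>_hessian:
  assumes "fls_smooth_on U f"
  shows "\<psi> (hessian g f b c) = hess E Gam (\<psi> f) b c"
  unfolding hessian_def[abs_def]
  by (simp add: \<psi>_mult \<psi>_sum \<psi>_diff \<psi>_deriv \<psi>_christoffel sm assms hess_def)

end

end

section \<open>Germs\<close>

text \<open>Germs form a commutative ring on which the derivations are total, so that the tensor calculus needs no
  smoothness side conditions.\<close>

definition germ_rel :: "(real^'n::finite \<Rightarrow> real fls) \<Rightarrow> (real^'n \<Rightarrow> real fls) \<Rightarrow> bool" where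
  "germ_rel F G \<longleftrightarrow> (\<exists>U. open U \<and> 0 \<in> U \<and> fls_smooth_on U F \<and> fls_smooth_on U G \<and> (\<forall>x\<in>U. F x = G x))"

lemma germ_relI:
  "open U \<Longrightarrow> 0 \<in> U \<Longrightarrow> fls_smooth_on U F \<Longrightarrow> (\<And>x. x \<in> U \<Longrightarrow> F x = G x) \<Longrightarrow> germ_rel F G"
  unfolding germ_rel_def using fls_smooth_on_cong[of U F G] by blast

lemma germ_rel_trans:
  assumes "germ_rel F G" "germ_rel G H"
  shows "germ_rel F H"
proof -
  obtain U V where "open U" "0 \<in> U" "fls_smooth_on U F" "\<forall>x\<in>U. F x = G x"
    "open V" "0 \<in> V" "\<forall>x\<in>V. G x = H x"
    using assms unfolding germ_rel_def by blast
  then show ?thesis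
    by (intro germ_relI[of "U \<inter> V"]) (auto intro: fls_smooth_on_subset)
qed

\<comment> \<open>The quotient is partial because only functions that are smooth near 0 represent
  germs. The base point is always 0; \<open>germ_at\<close> moves other points there by a
  translation, so one type serves all points.\<close>
quotient_type 'n germ = "real^('n::finite) \<Rightarrow> real fls" / partial: germ_rel
proof (rule part_equivpI)
  show "\<exists>x. germ_rel x x"
    by (rule exI[of _ "\<lambda>_. 0"]) (rule germ_relI[of UNIV], auto)
  show "symp germ_rel"
    by (rule sympI) (auto simp: germ_rel_def)
  show "transp germ_rel"
    by (rule transpI) (rule germ_rel_trans)
qed

lemma germ_rel_binary:
  assumes "germ_rel F F'" "germ_rel G G'"
  obtains U where "open U" "0 \<in> U" "fls_smooth_on U F" "fls_smooth_on U G" "\<And>x. x \<in> U \<Longrightarrow> F x = F' x"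
    "\<And>x. x \<in> U \<Longrightarrow> G x = G' x"
proof -
  obtain U V where "open U" "0 \<in> U" "fls_smooth_on U F" "\<forall>x\<in>U. F x = F' x"
    "open V" "0 \<in> V" "fls_smooth_on V G" "\<forall>x\<in>V. G x = G' x"
    using assms unfolding germ_rel_def by blast
  then show ?thesis
    by (intro that[of "U \<inter> V"]) (auto intro: fls_smooth_on_subset)
qed

lemma germ_rel_add:
  assumes "germ_rel F F'" "germ_rel G G'"
  shows "germ_rel (\<lambda>x. F x + G x) (\<lambda>x. F' x + G' x)"
proof -
  obtain U where "open U" "0 \<in> U" "fls_smooth_on U F" "fls_smooth_on U G" "\<And>x. x \<in> U \<Longrightarrow> F x = F' x"
    "\<And>x. x \<in> U \<Longrightarrow> G x = G' x"
    using germ_rel_binary[OF assms] by blast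
  then show ?thesis
    by (intro germ_relI[of U]) (auto intro: fls_smooth_on_add)
qed

lemma germ_rel_diff:
  assumes "germ_rel F F'" "germ_rel G G'"
  shows "germ_rel (\<lambda>x. F x - G x) (\<lambda>x. F' x - G' x)"
proof -
  obtain U where "open U" "0 \<in> U" "fls_smooth_on U F" "fls_smooth_on U G" "\<And>x. x \<in> U \<Longrightarrow> F x = F' x"
    "\<And>x. x \<in> U \<Longrightarrow> G x = G' x"
    using germ_rel_binary[OF assms] by blast
  then show ?thesis
    by (intro germ_relI[of U]) (auto intro: fls_smooth_on_diff)
qed

lemma germ_rel_mult:
  assumes "germ_rel F F'" "germ_rel G G'"
  shows "germ_rel (\<lambda>x. F x * G x) (\<lambda>x. F' x * G' x)"
proof -
  obtain U where "open U" "0 \<in> U" "fls_smooth_on U F" "fls_smooth_on U G" "\<And>x. x \<in> U \<Longrightarrow> F x = F' x"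
    "\<And>x. x \<in> U \<Longrightarrow> G x = G' x"
    using germ_rel_binary[OF assms] by blast
  then show ?thesis
    by (intro germ_relI[of U]) (auto intro: fls_smooth_on_mult)
qed

lemma germ_rel_const: "germ_rel (\<lambda>x. c) (\<lambda>x. c)"
  by (rule germ_relI[of UNIV]) auto

lemma germ_rel_minus: "germ_rel F F' \<Longrightarrow> germ_rel (\<lambda>x. - F x) (\<lambda>x. - F' x)"
  using germ_rel_diff[OF germ_rel_const[of 0]] by simp

lemma germ_rel_eq: "germ_rel F F \<Longrightarrow> (\<And>x. F x = G x) \<Longrightarrow> germ_rel F G"
  by (metis ext)

lemma germ_rel_formal_deriv:
  assumes "germ_rel F G"
  shows "germ_rel (formal_deriv a F) (formal_deriv a G)"
proof -
  obtain U where U: "open U" "0 \<in> U" "fls_smooth_on U F" "\<And>x. x \<in> U \<Longrightarrow> F x = G x"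
    using assms unfolding germ_rel_def by blast
  show ?thesis
    by (rule germ_relI[OF U(1,2)]) (auto intro!: fls_smooth_on_formal_deriv formal_deriv_cong[OF U(1)] U)
qed

instantiation germ :: (finite) comm_ring_1
begin

lift_definition zero_germ :: "'a germ" is "\<lambda>_. 0" by (rule germ_rel_const)
lift_definition one_germ :: "'a germ" is "\<lambda>_. 1" by (rule germ_rel_const)
lift_definition plus_germ :: "'a germ \<Rightarrow> 'a germ \<Rightarrow> 'a germ" is "\<lambda>F G x. F x + G x" by (rule germ_rel_add)
lift_definition minus_germ :: "'a germ \<Rightarrow> 'a germ \<Rightarrow> 'a germ" is "\<lambda>F G x. F x - G x" by (rule germ_rel_diff)
lift_definition times_germ :: "'a germ \<Rightarrow> 'a germ \<Rightarrow> 'a germ" is "\<lambda>F G x. F x * G x" by (rule germ_rel_mult)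
lift_definition uminus_germ :: "'a germ \<Rightarrow> 'a germ" is "\<lambda>F x. - F x" by (rule germ_rel_minus)

instance
proof
  fix a b c :: "'a germ"
  note I = germ_rel_add germ_rel_diff germ_rel_mult germ_rel_minus germ_rel_const
  show "a + b + c = a + (b + c)"
    by transfer (rule germ_rel_eq, intro I, auto simp: algebra_simps)
  show "a + b = b + a"
    by transfer (rule germ_rel_eq, intro I, auto simp: algebra_simps)
  show "0 + a = a"
    by transfer (rule germ_rel_eq, intro I, auto simp: algebra_simps)
  show "- a + a = 0"
    by transfer (rule germ_rel_eq, intro I, auto simp: algebra_simps)
  show "a - b = a + - b"
    by transfer (rule germ_rel_eq, intro I, auto simp: algebra_simps)
  show "a * b * c = a * (b * c)"
    by transfer (rule germ_rel_eq, intro I, auto simp: algebra_simps)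
  show "a * b = b * a"
    by transfer (rule germ_rel_eq, intro I, auto simp: algebra_simps)
  show "1 * a = a"
    by transfer (rule germ_rel_eq, intro I, auto simp: algebra_simps)
  show "(a + b) * c = a * c + b * c"
    by transfer (rule germ_rel_eq, intro I, auto simp: algebra_simps)
  show "(0::'a germ) \<noteq> 1"
    by transfer (auto simp: germ_rel_def)
qed

end

lift_definition germ_deriv :: "'n::finite option \<Rightarrow> 'n germ \<Rightarrow> 'n germ" is formal_deriv
  by (rule germ_rel_formal_deriv)

lift_definition germ_half :: "'n::finite germ" is "\<lambda>_. fls_const (1/2)"
  by (rule germ_rel_const)

interpretation germ: derivations germ_deriv "germ_half :: 'n::finite germ"
proof
  fix a b and x y :: "'n germ"
  show "germ_deriv a (x + y) = germ_deriv a x + germ_deriv a y"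
  proof transfer
    fix a and F G :: "real^'n \<Rightarrow> real fls"
    assume "germ_rel F F" "germ_rel G G"
    then obtain U where U: "open U" "0 \<in> U" "fls_smooth_on U F" "fls_smooth_on U G"
      by (rule germ_rel_binary)
    show "germ_rel (formal_deriv a (\<lambda>x. F x + G x)) (\<lambda>x. formal_deriv a F x + formal_deriv a G x)"
      by (rule germ_relI[OF U(1,2)])
         (auto intro!: fls_smooth_on_formal_deriv fls_smooth_on_add formal_deriv_add[OF U(1)] U)
  qed
  show "germ_deriv a (x * y) = germ_deriv a x * y + x * germ_deriv a y"
  proof transfer
    fix a and F G :: "real^'n \<Rightarrow> real fls"
    assume "germ_rel F F" "germ_rel G G"
    then obtain U where U: "open U" "0 \<in> U" "fls_smooth_on U F" "fls_smooth_on U G"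
      by (rule germ_rel_binary)
    show "germ_rel (formal_deriv a (\<lambda>x. F x * G x)) (\<lambda>x. formal_deriv a F x * G x + F x * formal_deriv a G x)"
      by (rule germ_relI[OF U(1,2)])
         (auto intro!: fls_smooth_on_formal_deriv fls_smooth_on_mult formal_deriv_mult[OF U(1)] U)
  qed
  show "germ_deriv a (germ_deriv b x) = germ_deriv b (germ_deriv a x)"
  proof transfer
    fix a b and F :: "real^'n \<Rightarrow> real fls"
    assume "germ_rel F F"
    then obtain U where U: "open U" "0 \<in> U" "fls_smooth_on U F" unfolding germ_rel_def by blast
    show "germ_rel (formal_deriv a (formal_deriv b F)) (formal_deriv b (formal_deriv a F))"
      by (rule germ_relI[OF U(1,2)])
         (auto intro!: fls_smooth_on_formal_deriv formal_deriv_commute[OF U(1)] U)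
  qed
  show "germ_half + germ_half = (1 :: 'n germ)"
    by transfer (rule germ_rel_eq, intro germ_rel_add germ_rel_const, simp add: fls_plus_const)
qed

section \<open>Composition with smooth maps and germs at a point\<close>

lemma fls_smooth_on_compose:
  assumes "open V" "fls_smooth_on U F" "smooth_on V t" "t ` V \<subseteq> U"
  shows "fls_smooth_on V (\<lambda>y. F (t y))"
proof -
  obtain N where "\<And>x. x \<in> U \<Longrightarrow> fls_ge N (F x)" using assms(2) fls_smooth_onE by metis
  moreover have "smooth_on V (\<lambda>y. F (t y) $$ k)" for k
    by (rule smooth_on_compose[OF assms(1) fls_smooth_on_nth[OF assms(2)] assms(3,4)])
  ultimately show ?thesis using assms(4) by (intro fls_smooth_onI) blast+
qed

lemma formal_deriv_compose_None: "formal_deriv None (\<lambda>y. F (t y)) y = formal_deriv None F (t y)"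
  by (simp add: formal_deriv.simps)

lemma formal_deriv_compose_Some:
  assumes "open V" "open U" "fls_smooth_on U F" "smooth_on V t" "t ` V \<subseteq> U" "y \<in> V"
  shows "formal_deriv (Some a) (\<lambda>y. F (t y)) y =
    (\<Sum>i\<in>UNIV. fls_const (partial_deriv a t y $ i) * formal_deriv (Some i) F (t y))"
proof (rule fls_eqI)
  fix k
  have tU: "t y \<in> U" using assms by auto
  have "formal_deriv (Some a) (\<lambda>y. F (t y)) y $$ k = partial_deriv a (\<lambda>y. F (t y) $$ k) y"
    by (rule formal_deriv_Some_nth[OF assms(1,6) fls_smooth_on_compose[OF assms(1,3,4,5)]])
  also have "\<dots> = (\<Sum>i\<in>UNIV. (partial_deriv a t y $ i) *\<^sub>R partial_deriv i (\<lambda>x. F x $$ k) (t y))"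
    by (rule partial_deriv_compose[of "\<lambda>x. F x $$ k"])
       (use smooth_on_differentiable[OF fls_smooth_on_nth[OF assms(3)] tU] smooth_on_differentiable[OF assms(4,6)] in auto)
  finally show "formal_deriv (Some a) (\<lambda>y. F (t y)) y $$ k = (\<Sum>i\<in>UNIV. fls_const (partial_deriv a t y $ i) * formal_deriv (Some i) F (t y)) $$ k"
    by (simp add: fls_sum_nth formal_deriv_Some_nth[OF assms(2) tU assms(3)])
qed

lemma smooth_on_translation: "smooth_on S (\<lambda>y. x0 + y)"
proof -
  have "Ck_on k S (\<lambda>y. x0 + y)" for k
  proof (cases k)
    case (Suc m)
    have "partial_deriv i (\<lambda>y. x0 + y) = (\<lambda>y. axis i 1)" for i
      by (rule ext) (rule partial_deriv_eqI[of _ "\<lambda>v. v", simplified], auto intro!: derivative_eq_intros)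
    then show ?thesis using Suc by (simp add: Ck_on_const)
  qed (simp add: continuous_on_add)
  then show ?thesis by (simp add: smooth_on_def)
qed

lemma partial_deriv_translation: "partial_deriv i (\<lambda>y. x0 + y) x = axis i 1"
  by (rule partial_deriv_eqI[of _ "\<lambda>v. v", simplified]) (auto intro!: derivative_eq_intros)

definition germ_at :: "real^'n::finite \<Rightarrow> (real^'n \<Rightarrow> real fls) \<Rightarrow> 'n germ" where
  "germ_at x0 F = abs_germ (\<lambda>y. F (x0 + y))"

context
  fixes U :: "(real^'n::finite) set" and x0 :: "real^'n"
  assumes U: "open U" "x0 \<in> U"
begin

definition "U0 = (\<lambda>x. x - x0) ` U"

lemma U0: "open U0" "0 \<in> U0" "(\<lambda>y. x0 + y) ` U0 = U"
proof -
  show "open U0" unfolding U0_def using open_translation_subtract[OF U(1)] by simp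
  show "0 \<in> U0" unfolding U0_def using U(2) by force
  show "(\<lambda>y. x0 + y) ` U0 = U" unfolding U0_def by (auto simp: image_iff)
qed

lemma translate_smooth: "fls_smooth_on U F \<Longrightarrow> fls_smooth_on U0 (\<lambda>y. F (x0 + y))"
  by (rule fls_smooth_on_compose[OF U0(1) _ smooth_on_translation]) (auto simp: U0)

lemma translate_rel: "fls_smooth_on U F \<Longrightarrow> germ_rel (\<lambda>y. F (x0 + y)) (\<lambda>y. F (x0 + y))"
  by (rule germ_relI[OF U0(1,2) translate_smooth]) auto

text \<open>The way back from identities between germs to identities between series at the base
  point.\<close>

lemma germ_at_eqD:
  assumes "fls_smooth_on U F" "fls_smooth_on U G" "germ_at x0 F = germ_at x0 G"
  shows "F x0 = G x0"
proof -
  have "germ_rel (\<lambda>y. F (x0 + y)) (\<lambda>y. G (x0 + y))"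
    using Quotient3_rel[OF Quotient3_germ, of "\<lambda>y. F (x0 + y)" "\<lambda>y. G (x0 + y)"]
      translate_rel[OF assms(1)] translate_rel[OF assms(2)] assms(3) unfolding germ_at_def by blast
  then have "F (x0 + 0) = G (x0 + 0)" unfolding germ_rel_def by blast
  then show ?thesis by simp
qed

lemma germ_realization: "realization U (germ_at x0) germ_deriv germ_half"
proof
  fix F G a assume F: "fls_smooth_on U F"
  have rel: "abs_germ (\<lambda>y. F (x0 + y)) = abs_germ G" if "germ_rel (\<lambda>y. F (x0 + y)) G" for F G
    by (rule Quotient3_rel_abs[OF Quotient3_germ, OF that])
  show "germ_at x0 F = germ_at x0 G" if "\<And>x. x \<in> U \<Longrightarrow> F x = G x"
    unfolding germ_at_def
    by (rule rel) (rule germ_relI[OF U0(1,2) translate_smooth[OF F]], use that U0(3) in auto)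
  show "germ_at x0 (formal_deriv a F) = germ_deriv a (germ_at x0 F)"
  proof -
    have "germ_deriv a (germ_at x0 F) = abs_germ (formal_deriv a (\<lambda>y. F (x0 + y)))"
      unfolding germ_at_def by (rule germ_deriv.abs_eq) (simp add: translate_rel[OF F] eq_onp_def)
    moreover have "germ_at x0 (formal_deriv a F) = abs_germ (formal_deriv a (\<lambda>y. F (x0 + y)))"
      unfolding germ_at_def
    proof (rule rel, rule germ_relI[OF U0(1,2) translate_smooth])
      show "fls_smooth_on U (formal_deriv a F)" by (rule fls_smooth_on_formal_deriv[OF U(1) F])
      fix y assume y: "y \<in> U0"
      show "formal_deriv a F (x0 + y) = formal_deriv a (\<lambda>y. F (x0 + y)) y"
      proof (cases a)
        case (Some i)
        have "formal_deriv (Some i) (\<lambda>y. F (x0 + y)) y = (\<Sum>j\<in>UNIV. fls_const (axis i 1 $ j) * formal_deriv (Some j) F (x0 + y))"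
          using formal_deriv_compose_Some[OF U0(1) U(1) F smooth_on_translation _ y, of x0 i] U0(3)
          by (simp add: partial_deriv_translation)
        also have "\<dots> = (\<Sum>j\<in>UNIV. if j = i then formal_deriv (Some j) F (x0 + y) else 0)"
          by (rule sum.cong) (auto simp: axis_def)
        finally show ?thesis using Some by simp
      qed (simp add: formal_deriv.simps)
    qed
    ultimately show ?thesis by simp
  qed
next
  fix F G assume F: "fls_smooth_on U F" and G: "fls_smooth_on U G"
  show "germ_at x0 (\<lambda>x. F x + G x) = germ_at x0 F + germ_at x0 G"
    unfolding germ_at_def by (subst plus_germ.abs_eq) (simp_all add: translate_rel F G eq_onp_def)
  show "germ_at x0 (\<lambda>x. F x * G x) = germ_at x0 F * germ_at x0 G"
    unfolding germ_at_def by (subst times_germ.abs_eq) (simp_all add: translate_rel F G eq_onp_def)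
next
  show "germ_at x0 (\<lambda>x. fls_const (1/2)) = germ_half"
    by (simp add: germ_at_def germ_half_def)
  show "germ_at x0 (\<lambda>x. 1) = 1"
    by (simp add: germ_at_def one_germ_def)
qed (rule U)

end

section \<open>The Bianchi identity for formal metrics\<close>

locale smooth_formal_metric =
  fixes U :: "(real^'n::finite) set" and g :: "'n formal_metric"
  assumes openU: "open U"
    and g_smooth: "fls_smooth_on U (\<lambda>x. g x $ i $ j)"
    and gi_smooth: "fls_smooth_on U (\<lambda>x. matrix_inv (g x) $ i $ j)"
    and g_symm: "x \<in> U \<Longrightarrow> g x $ i $ j = g x $ j $ i"
    and g_gi: "x \<in> U \<Longrightarrow> g x ** matrix_inv (g x) = mat 1"
    and gi_g: "x \<in> U \<Longrightarrow> matrix_inv (g x) ** g x = mat 1"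
begin

lemma christoffel_sm: "fls_smooth_on U (christoffel g a b c)"
  by (rule christoffel_smooth[OF openU g_smooth gi_smooth])

lemma ricci_sm: "fls_smooth_on U (ricci g b c)"
  by (rule ricci_smooth[OF openU g_smooth gi_smooth])

lemma hessian_sm: "fls_smooth_on U f \<Longrightarrow> fls_smooth_on U (hessian g f b c)"
  by (rule hessian_smooth[OF openU g_smooth gi_smooth])

lemma levi_civita_realization:
  assumes "realization U \<psi> D hf" "derivations D hf"
  shows "levi_civita D hf (realization.\<psi>m \<psi> g) (realization.\<psi>m \<psi> (\<lambda>x. matrix_inv (g x)))"
proof -
  interpret realization U \<psi> D hf by fact
  interpret derivations D hf by fact
  show ?thesis
  proof
    show "\<psi>m g ** \<psi>m (\<lambda>x. matrix_inv (g x)) = mat 1"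
      by (rule \<psi>m_inverse[OF g_smooth gi_smooth g_gi])
    show "\<psi>m (\<lambda>x. matrix_inv (g x)) ** \<psi>m g = mat 1"
      by (rule \<psi>m_inverse[OF gi_smooth g_smooth gi_g])
    show "\<psi>m g $ i $ j = \<psi>m g $ j $ i" for i j
      unfolding \<psi>m_nth by (rule \<psi>_cong[OF g_smooth g_symm])
  qed
qed

text \<open>The counterparts for series of \<open>dvg\<close>, \<open>raise\<close> and
  \<open>gradf\<close>; here \<open>christoffel g a b c\<close> stands for
  \<open>G b $ a $ c\<close>.\<close>

definition fdiv :: "('n option \<Rightarrow> 'n option \<Rightarrow> real^'n \<Rightarrow> real fls) \<Rightarrow> 'n option \<Rightarrow> real^'n \<Rightarrow> real fls" where
  "fdiv T b x = (\<Sum>e\<in>UNIV. formal_deriv e (T b e) x)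
     + (\<Sum>e\<in>UNIV. \<Sum>c\<in>UNIV. christoffel g e e c x * T b c x)
     - (\<Sum>e\<in>UNIV. \<Sum>c\<in>UNIV. christoffel g c b e x * T c e x)"

definition fraise :: "('n option \<Rightarrow> 'n option \<Rightarrow> real^'n \<Rightarrow> real fls) \<Rightarrow> 'n option \<Rightarrow> 'n option \<Rightarrow> real^'n \<Rightarrow> real fls" where
  "fraise T b e x = (\<Sum>c\<in>UNIV. T b c x * matrix_inv (g x) $ c $ e)"

definition fgrad :: "(real^'n \<Rightarrow> real fls) \<Rightarrow> 'n option \<Rightarrow> real^'n \<Rightarrow> real fls" where
  "fgrad f c x = (\<Sum>b\<in>UNIV. matrix_inv (g x) $ c $ b * formal_deriv b f x)"

text \<open>\<open>bianchi f\<close> is the one-form \<open>2 div E - 2 E(\<nabla>f)\<close> for \<open>E = soliton_op f\<close>.\<close>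

definition soliton_op :: "(real^'n \<Rightarrow> real fls) \<Rightarrow> 'n option \<Rightarrow> 'n option \<Rightarrow> real^'n \<Rightarrow> real fls" where
  "soliton_op f b c x = ricci g b c x + hessian g f b c x + fls_const (1/2) * g x $ b $ c"

definition bianchi :: "(real^'n \<Rightarrow> real fls) \<Rightarrow> 'n option \<Rightarrow> real^'n \<Rightarrow> real fls" where
  "bianchi f b x = (fdiv (fraise (soliton_op f)) b x + fdiv (fraise (soliton_op f)) b x)
     - (\<Sum>c\<in>UNIV. soliton_op f b c x * fgrad f c x) - (\<Sum>c\<in>UNIV. soliton_op f b c x * fgrad f c x)"

lemma soliton_op_smooth:
  assumes "fls_smooth_on U f"
  shows "fls_smooth_on U (soliton_op f b c)"
  unfolding soliton_op_def[abs_def] by (intro fls_smooth_on_add fls_smooth_on_mult fls_smooth_on_const ricci_sm hessian_sm g_smooth assms openU)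

lemma fraise_smooth:
  assumes "\<And>b c. fls_smooth_on U (T b c)"
  shows "fls_smooth_on U (fraise T b e)"
  unfolding fraise_def[abs_def] by (intro fls_smooth_on_sum fls_smooth_on_mult gi_smooth assms openU)

lemma fgrad_smooth:
  assumes "fls_smooth_on U f"
  shows "fls_smooth_on U (fgrad f c)"
  unfolding fgrad_def[abs_def] by (intro fls_smooth_on_sum fls_smooth_on_mult gi_smooth fls_smooth_on_formal_deriv assms openU)

lemma fdiv_smooth:
  assumes "\<And>b c. fls_smooth_on U (T b c)"
  shows "fls_smooth_on U (fdiv T b)"
  unfolding fdiv_def[abs_def] by (intro fls_smooth_on_sum fls_smooth_on_add fls_smooth_on_diff fls_smooth_on_mult
        christoffel_sm fls_smooth_on_formal_deriv assms openU)

lemma bianchi_smooth: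
  assumes "fls_smooth_on U f"
  shows "fls_smooth_on U (bianchi f b)"
  unfolding bianchi_def[abs_def] by (intro fls_smooth_on_sum fls_smooth_on_add fls_smooth_on_diff fls_smooth_on_mult
        fdiv_smooth fraise_smooth soliton_op_smooth fgrad_smooth assms openU)

lemma germ_facts:
  assumes "x0 \<in> U"
  shows "realization U (germ_at x0) germ_deriv germ_half"
    "levi_civita germ_deriv germ_half (realization.\<psi>m (germ_at x0) g) (realization.\<psi>m (germ_at x0) (\<lambda>x. matrix_inv (g x)))"
proof -
  show "realization U (germ_at x0) germ_deriv germ_half" by (rule germ_realization[OF openU assms])
  then show "levi_civita germ_deriv germ_half (realization.\<psi>m (germ_at x0) g) (realization.\<psi>m (germ_at x0) (\<lambda>x. matrix_inv (g x)))"
    by (rule levi_civita_realization) (rule germ.derivations_axioms)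
qed

lemma ricci_symm:
  assumes "x0 \<in> U"
  shows "ricci g b c x0 = ricci g c b x0"
proof -
  interpret realization U "germ_at x0" germ_deriv germ_half by (rule germ_facts[OF assms])
  interpret lc: levi_civita germ_deriv germ_half "\<psi>m g" "\<psi>m (\<lambda>x. matrix_inv (g x))" by (rule germ_facts[OF assms])
  show ?thesis
    by (rule germ_at_eqD[OF openU assms ricci_sm ricci_sm])
       (simp only: \<psi>_ricci[OF g_smooth gi_smooth] lc.ric_sym[of b c])
qed

lemma hessian_symm:
  assumes "x0 \<in> U" "fls_smooth_on U f"
  shows "hessian g f b c x0 = hessian g f c b x0"
proof -
  interpret realization U "germ_at x0" germ_deriv germ_half by (rule germ_facts[OF assms(1)])
  interpret lc: levi_civita germ_deriv germ_half "\<psi>m g" "\<psi>m (\<lambda>x. matrix_inv (g x))" by (rule germ_facts[OF assms(1)])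
  show ?thesis
    by (rule germ_at_eqD[OF openU assms(1) hessian_sm hessian_sm])
       (simp_all only: \<psi>_hessian[OF g_smooth gi_smooth assms(2)] lc.hess_sym[of _ b c] assms(2))
qed

lemma soliton_op_symm:
  assumes "x \<in> U" "fls_smooth_on U f"
  shows "soliton_op f b c x = soliton_op f c b x"
  unfolding soliton_op_def
  by (simp only: ricci_symm[OF assms(1), of b c] hessian_symm[OF assms, of b c] g_symm[OF assms(1), of b c])

text \<open>By \<open>soliton_Bianchi\<close> the germ of \<open>bianchi f\<close> is exact. Its
  potential \<open>Q\<close> lives only in the ring of germs; closedness does not mention
  \<open>Q\<close> and can be carried back to series.\<close>

lemma bianchi_closed:
  assumes "x0 \<in> U" and f: "fls_smooth_on U f"
  shows "formal_deriv a (bianchi f b) x0 = formal_deriv b (bianchi f a) x0"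
proof -
  interpret realization U "germ_at x0" germ_deriv germ_half by (rule germ_facts[OF assms(1)])
  interpret lc: levi_civita germ_deriv germ_half "\<psi>m g" "\<psi>m (\<lambda>x. matrix_inv (g x))" by (rule germ_facts[OF assms(1)])
  let ?\<psi> = "germ_at x0"
  have sm_op: "fls_smooth_on U (soliton_op f b c)" for b c by (rule soliton_op_smooth[OF f])
  have op: "?\<psi> (soliton_op f b c) = ric germ_deriv lc.G b c + hess germ_deriv lc.G (?\<psi> f) b c + germ_half * \<psi>m g $ b $ c" for b c
    unfolding soliton_op_def[abs_def]
    by (simp add: \<psi>_add \<psi>_mult \<psi>_half ricci_sm hessian_sm f g_smooth fls_smooth_on_add fls_smooth_on_mult openU
        \<psi>_ricci[OF g_smooth gi_smooth] \<psi>_hessian[OF g_smooth gi_smooth f] \<psi>m_nth)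
  have raise: "?\<psi> (fraise T b e) = lc.raise (\<lambda>b c. ?\<psi> (T b c)) b e" if "\<And>b c. fls_smooth_on U (T b c)" for T b e
    unfolding fraise_def[abs_def]
    by (simp add: \<psi>_sum \<psi>_mult that gi_smooth fls_smooth_on_mult openU lc.raise_def \<psi>m_nth)
  have dvg: "?\<psi> (fdiv T b) = lc.dvg (\<lambda>b c. ?\<psi> (T b c)) b" if T: "\<And>b c. fls_smooth_on U (T b c)" for T b
    unfolding fdiv_def[abs_def]
    by (simp add: \<psi>_sum \<psi>_mult \<psi>_add \<psi>_diff \<psi>_deriv T christoffel_sm fls_smooth_on_mult fls_smooth_on_sum
        fls_smooth_on_add fls_smooth_on_formal_deriv openU lc.dvg_def \<psi>_christoffel[OF g_smooth gi_smooth])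
  have grad: "?\<psi> (fgrad f c) = lc.gradf (?\<psi> f) c" for c
    unfolding fgrad_def[abs_def]
    by (simp add: \<psi>_sum \<psi>_mult f gi_smooth fls_smooth_on_mult fls_smooth_on_formal_deriv openU lc.gradf_def \<psi>m_nth \<psi>_deriv)
  have two: "?\<psi> (\<lambda>x. 2) = 2"
    using \<psi>_add[of "\<lambda>x. 1" "\<lambda>x. 1"] \<psi>_1 by simp
  have "\<exists>Q. \<forall>b. ?\<psi> (bianchi f b) = germ_deriv b Q"
  proof (rule exI, rule allI)
    fix b
    have "?\<psi> (bianchi f b) = ?\<psi> (\<lambda>x. (fdiv (fraise (soliton_op f)) b x + fdiv (fraise (soliton_op f)) b x)
     - (\<Sum>c\<in>UNIV. soliton_op f b c x * fgrad f c x) - (\<Sum>c\<in>UNIV. soliton_op f b c x * fgrad f c x))"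
      by (rule arg_cong[of _ _ ?\<psi>], rule ext) (rule bianchi_def)
    also have "\<dots> = (lc.dvg (lc.raise (\<lambda>b c. ?\<psi> (soliton_op f b c))) b + lc.dvg (lc.raise (\<lambda>b c. ?\<psi> (soliton_op f b c))) b)
       - (\<Sum>c\<in>UNIV. ?\<psi> (soliton_op f b c) * lc.gradf (?\<psi> f) c) - (\<Sum>c\<in>UNIV. ?\<psi> (soliton_op f b c) * lc.gradf (?\<psi> f) c)"
      by (simp add: \<psi>_sum \<psi>_mult \<psi>_add \<psi>_diff fdiv_smooth fraise_smooth sm_op fgrad_smooth f fls_smooth_on_mult fls_smooth_on_sum
          fls_smooth_on_add fls_smooth_on_diff openU dvg raise grad two)
    also have "\<dots> = germ_deriv b (lc.scal + lc.lap (?\<psi> f) + lc.lap (?\<psi> f) - lc.normgrad (?\<psi> f) - ?\<psi> f)"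
      unfolding op by (rule lc.soliton_Bianchi)
    finally show "?\<psi> (bianchi f b) = germ_deriv b (lc.scal + lc.lap (?\<psi> f) + lc.lap (?\<psi> f) - lc.normgrad (?\<psi> f) - ?\<psi> f)" .
  qed
  then obtain Q where Q: "\<And>b. ?\<psi> (bianchi f b) = germ_deriv b Q" by blast
  show ?thesis
    by (rule germ_at_eqD[OF openU assms(1)])
       (simp_all only: \<psi>_deriv[OF bianchi_smooth[OF f]] Q germ.D_comm[of a b] fls_smooth_on_formal_deriv[OF openU bianchi_smooth[OF f]])
qed

end

text \<open>Both metrics are mapped into one ring: \<open>\<psi>1\<close> takes the new data and
  \<open>\<psi>2\<close> the old data after substitution. Changes of coordinates and the reflection
  of r are the two instances.\<close>

lemma realization_frame_change:
  fixes g g' :: "'n::finite formal_metric" and J K :: "'a::comm_ring_1^'n option^'n option"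
  assumes "smooth_formal_metric U g" "smooth_formal_metric V g'"
    and r2: "realization U \<psi>2 E hf" and r1: "realization V \<psi>1 D hf" and "derivations D hf"
    and JK: "J ** K = mat 1" "K ** J = mat 1"
    and "\<And>a b i. D a (J $ i $ b) = D b (J $ i $ a)"
    and "\<And>a x. D a x = (\<Sum>i\<in>UNIV. J $ i $ a * E i x)"
    and gJ: "\<And>i j. \<psi>1 (\<lambda>x. g' x $ i $ j) = (transpose J ** realization.\<psi>m \<psi>2 g ** J) $ i $ j"
    and f: "fls_smooth_on V f'" "fls_smooth_on U f" "\<psi>1 f' = \<psi>2 f"
  shows "\<psi>1 (ricci g' b c) = (\<Sum>j\<in>UNIV. \<Sum>l\<in>UNIV. J $ j $ b * J $ l $ c * \<psi>2 (ricci g j l))"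
    and "\<psi>1 (hessian g' f' b c) = (\<Sum>j\<in>UNIV. \<Sum>l\<in>UNIV. J $ j $ b * J $ l $ c * \<psi>2 (hessian g f j l))"
proof -
  interpret g: smooth_formal_metric U g by fact
  interpret g': smooth_formal_metric V g' by fact
  interpret r1: realization V \<psi>1 D hf by fact
  interpret r2: realization U \<psi>2 E hf by fact
  interpret D: derivations D hf by fact
  let ?gi = "\<lambda>x. matrix_inv (g x)" and ?gi' = "\<lambda>x. matrix_inv (g' x)"
  interpret fc: frame_change D hf E J K "r2.\<psi>m g" "r2.\<psi>m ?gi"
  proof
    show "r2.\<psi>m g ** r2.\<psi>m ?gi = mat 1"
      by (rule r2.\<psi>m_inverse[OF g.g_smooth g.gi_smooth g.g_gi])
    show "r2.\<psi>m ?gi ** r2.\<psi>m g = mat 1"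
      by (rule r2.\<psi>m_inverse[OF g.gi_smooth g.g_smooth g.gi_g])
    show "r2.\<psi>m g $ i $ j = r2.\<psi>m g $ j $ i" for i j
      unfolding r2.\<psi>m_nth by (rule r2.\<psi>_cong[OF g.g_smooth g.g_symm])
  qed fact+
  have g': "r1.\<psi>m g' = fc.g'"
    by (simp add: vec_eq_iff r1.\<psi>m_nth gJ fc.g'_def)
  have inv: "r1.\<psi>m ?gi' ** fc.g' = mat 1"
    unfolding g'[symmetric] by (rule r1.\<psi>m_inverse[OF g'.gi_smooth g'.g_smooth g'.gi_g])
  \<comment> \<open>The inverse of the new metric is identified by uniqueness of inverses.\<close>
  have "r1.\<psi>m ?gi' = r1.\<psi>m ?gi' ** (fc.g' ** fc.P')" by (simp only: fc.g'P' matrix_mul_rid)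
  also have "\<dots> = fc.P'" by (simp only: matrix_mul_assoc inv matrix_mul_lid)
  finally have P': "r1.\<psi>m ?gi' = fc.P'" .
  show "\<psi>1 (ricci g' b c) = (\<Sum>j\<in>UNIV. \<Sum>l\<in>UNIV. J $ j $ b * J $ l $ c * \<psi>2 (ricci g j l))"
    unfolding r1.\<psi>_ricci[OF g'.g_smooth g'.gi_smooth] r2.\<psi>_ricci[OF g.g_smooth g.gi_smooth] g' P'
    by (rule fc.ric_frame_change)
  show "\<psi>1 (hessian g' f' b c) = (\<Sum>j\<in>UNIV. \<Sum>l\<in>UNIV. J $ j $ b * J $ l $ c * \<psi>2 (hessian g f j l))"
    unfolding r1.\<psi>_hessian[OF g'.g_smooth g'.gi_smooth f(1)] r2.\<psi>_hessian[OF g.g_smooth g.gi_smooth f(2)] g' P' f(3)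
    by (rule fc.hess_frame_change)
qed

section \<open>Invariance under coordinate changes and reflection\<close>

text \<open>Block matrices for the splitting into r and Y. The metrics, their inverses and the
  Jacobians of coordinate changes on Y all have vanishing mixed blocks.\<close>

definition option_block :: "'a \<Rightarrow> 'a^'n^'n \<Rightarrow> 'a::zero^('n::finite option)^('n option)" where
  "option_block c M = (\<chi> a b. case (a, b) of (None, None) \<Rightarrow> c | (Some i, Some j) \<Rightarrow> M $ i $ j | _ \<Rightarrow> 0)"

lemma option_block_nth [simp]:
  "option_block c M $ None $ None = c" "option_block c M $ None $ Some j = 0"
  "option_block c M $ Some i $ None = 0" "option_block c M $ Some i $ Some j = M $ i $ j"
  by (simp_all add: option_block_def)

lemma sum_option: "(\<Sum>a\<in>UNIV. f a) = f None + (\<Sum>i\<in>(UNIV :: 'n::finite set). f (Some i))"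
  by (simp add: UNIV_option_conv sum.reindex)

lemma option_block_mult: "option_block c M ** option_block d N = option_block (c * d) (M ** (N :: 'a::comm_ring_1^'n^'n))"
  unfolding vec_eq_iff matrix_mult_nth sum_option
  by (simp add: split_option_all matrix_mult_nth)

lemma option_block_mat: "option_block 1 (mat 1) = (mat 1 :: 'a::comm_ring_1^('n::finite option)^('n option))"
  unfolding vec_eq_iff by (simp add: split_option_all mat_def)

text \<open>The Jacobian of the map (r, y) \<mapsto> (r, t y).\<close>

definition jac :: "(real^'n::finite \<Rightarrow> real^'n) \<Rightarrow> real^'n \<Rightarrow> real fls^('n option)^('n option)" where
  "jac t y = option_block 1 (\<chi> i a. fls_const (partial_deriv a t y $ i))"

lemma fls_const_sum: "fls_const (sum f I) = (\<Sum>i\<in>I. fls_const (f i))"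
  by (induction I rule: infinite_finite_induct) (simp_all add: fls_plus_const[symmetric])

lemma fls_const_matrix_mult:
  "(\<chi> i j. fls_const (A $ i $ j)) ** (\<chi> i j. fls_const (B $ i $ j)) = (\<chi> i j. fls_const ((A ** B) $ i $ j))" for A B :: "real^'n^'n"
  by (simp add: vec_eq_iff matrix_mult_nth fls_const_sum)

text \<open>The old data enter through the germs of \<open>F (t y)\<close>. A smooth inverse
  \<open>K\<close> of the Jacobian makes it invertible over the ring of germs.\<close>

lemma ricci_coordinate_change:
  fixes t :: "real^'n::finite \<Rightarrow> real^'n"
  assumes "smooth_formal_metric U g" "smooth_formal_metric V g'"
    and t: "smooth_on V t" "t ` V \<subseteq> U"
    and K: "\<And>a i. smooth_on V (\<lambda>y. K y $ a $ i)" "\<And>y. y \<in> V \<Longrightarrow> (\<chi> i a. partial_deriv a t y $ i) ** K y = mat 1"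
    and g': "\<And>y. y \<in> V \<Longrightarrow> g' y = transpose (jac t y) ** g (t y) ** jac t y"
    and f: "fls_smooth_on V f'" "fls_smooth_on U f" "\<And>y. y \<in> V \<Longrightarrow> f' y = f (t y)"
    and y: "y \<in> V"
  shows "ricci g' b c y = (\<Sum>j\<in>UNIV. \<Sum>l\<in>UNIV. jac t y $ j $ b * jac t y $ l $ c * ricci g j l (t y))"
    and "hessian g' f' b c y = (\<Sum>j\<in>UNIV. \<Sum>l\<in>UNIV. jac t y $ j $ b * jac t y $ l $ c * hessian g f j l (t y))"
proof -
  interpret g: smooth_formal_metric U g by fact
  interpret g': smooth_formal_metric V g' by fact
  let ?\<psi> = "germ_at y"
  interpret r1: realization V ?\<psi> germ_deriv germ_half by (rule germ_realization[OF g'.openU y])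
  define Ko where "Ko y = option_block 1 (\<chi> i a. fls_const (K y $ i $ a))" for y
  have comp: "fls_smooth_on V (\<lambda>y. F (t y))" if "fls_smooth_on U F" for F
    by (rule fls_smooth_on_compose[OF g'.openU that t])
  have dt: "t differentiable (at z)" if "z \<in> V" for z by (rule smooth_on_differentiable[OF t(1) that])
  have pd: "smooth_on V (\<lambda>y. partial_deriv a t y $ i)" for a i
    by (rule smooth_on_linear[OF g'.openU bounded_linear_vec_nth smooth_on_partial_deriv[OF t(1)]])
  have jac_sm: "fls_smooth_on V (\<lambda>y. jac t y $ i $ a)" for i a
    by (cases i; cases a) (simp_all add: jac_def fls_smooth_on_fls_const pd)
  have Ko_sm: "fls_smooth_on V (\<lambda>y. Ko y $ i $ a)" for i a
    by (cases i; cases a) (simp_all add: Ko_def fls_smooth_on_fls_const K)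
  have JK: "jac t z ** Ko z = mat 1" if "z \<in> V" for z
  proof -
    have "(\<chi> i a. fls_const (partial_deriv a t z $ i)) ** (\<chi> i a. fls_const (K z $ i $ a))
      = (\<chi> i j. fls_const (((\<chi> i a. partial_deriv a t z $ i) ** K z) $ i $ j))"
      using fls_const_matrix_mult[of "\<chi> i a. partial_deriv a t z $ i" "K z"] by simp
    also have "\<dots> = mat 1" unfolding K(2)[OF that] by (simp add: vec_eq_iff mat_def)
    finally show ?thesis by (simp add: jac_def Ko_def option_block_mult option_block_mat)
  qed
  have KJ: "Ko z ** jac t z = mat 1" if "z \<in> V" for z
    using JK[OF that] matrix_left_right_inverse by blast
  define J where "J = r1.\<psi>m (jac t)"
  define Kg where "Kg = r1.\<psi>m Ko"
  have JKg: "J ** Kg = mat 1" "Kg ** J = mat 1"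
    unfolding J_def Kg_def by (rule r1.\<psi>m_inverse[OF jac_sm Ko_sm JK], assumption)
      (rule r1.\<psi>m_inverse[OF Ko_sm jac_sm KJ], assumption)
  \<comment> \<open>Obtained by solving the chain rule for the old derivations; \<open>r2\<close>
    confirms that on pulled-back series it acts as the old coordinate derivative.\<close>
  define E where "E i x = (\<Sum>a\<in>UNIV. Kg $ a $ i * germ_deriv a x)" for i x
  have DE: "germ_deriv a x = (\<Sum>i\<in>UNIV. J $ i $ a * E i x)" for a x
  proof -
    have "(\<Sum>i\<in>UNIV. J $ i $ a * E i x) = (\<Sum>b\<in>UNIV. (\<Sum>i\<in>UNIV. Kg $ b $ i * J $ i $ a) * germ_deriv b x)"
      unfolding E_def sum_distrib_left sum_distrib_right by (subst sum.swap) (simp add: mult_ac)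
    also have "\<dots> = (\<Sum>b\<in>UNIV. if b = a then germ_deriv b x else 0)"
      unfolding matrix_mult_eq_mat_nth[OF JKg(2)] by (rule sum.cong) auto
    finally show ?thesis by simp
  qed
  have ED: "E i x = (\<Sum>a\<in>UNIV. Kg $ a $ i * germ_deriv a x)" for i x by (rule E_def)
  have J_closed: "germ_deriv a (J $ i $ b) = germ_deriv b (J $ i $ a)" for a b i
  proof -
    have dJ: "germ_deriv a (J $ i $ b) = ?\<psi> (formal_deriv a (\<lambda>y. jac t y $ i $ b))" for a b
      by (simp add: J_def r1.\<psi>m_nth r1.\<psi>_deriv jac_sm)
    have "formal_deriv a (\<lambda>y. jac t y $ i $ b) z = formal_deriv b (\<lambda>y. jac t y $ i $ a) z" if z: "z \<in> V" for z
    proof -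
      have 0: "formal_deriv a (\<lambda>y. 0) z = 0" "formal_deriv a (\<lambda>y. 1) z = 0" for a
        using formal_deriv_fls_const[of a 0 z] formal_deriv_fls_const[of a 1 z] by simp_all
      have N: "formal_deriv None (\<lambda>y. fls_const (u y)) z = 0" for u :: "real^'n \<Rightarrow> real"
        by (simp add: formal_deriv.simps)
      have S: "formal_deriv (Some a) (\<lambda>y. fls_const (partial_deriv b t y $ i)) z = formal_deriv (Some b) (\<lambda>y. fls_const (partial_deriv a t y $ i)) z" for a b i
      proof (rule fls_eqI)
        fix k
        have c: "formal_deriv (Some a) (\<lambda>y. fls_const (partial_deriv b t y $ i)) z $$ k = (if k = 0 then partial_deriv a (partial_deriv b (\<lambda>y. t y $ i)) z else 0)" for a b
        proof -
          have "partial_deriv a (\<lambda>y. partial_deriv b t y $ i) z = partial_deriv a (partial_deriv b (\<lambda>y. t y $ i)) z"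
            by (rule partial_deriv_cong[OF g'.openU z]) (simp add: partial_deriv_linear[OF bounded_linear_vec_nth dt])
          then show ?thesis
            unfolding formal_deriv_Some_nth[OF g'.openU z fls_smooth_on_fls_const[OF pd]]
            by (simp add: partial_deriv_const)
        qed
        show "formal_deriv (Some a) (\<lambda>y. fls_const (partial_deriv b t y $ i)) z $$ k = formal_deriv (Some b) (\<lambda>y. fls_const (partial_deriv a t y $ i)) z $$ k"
          unfolding c using partial_deriv_commute[OF g'.openU smooth_on_linear[OF g'.openU bounded_linear_vec_nth t(1)] z] by simp
      qed
      show ?thesis
      proof (cases "i = None \<or> a = None \<or> b = None")
        case True
        then show ?thesis by (cases i; cases a; cases b) (simp_all add: jac_def 0 N)
      next
        case False
        then show ?thesis by (auto simp: jac_def intro: S)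
      qed
    qed
    then show ?thesis
      unfolding dJ by (rule r1.\<psi>_cong[OF fls_smooth_on_formal_deriv[OF g'.openU jac_sm]])
  qed
  have r2: "realization U (\<lambda>F. ?\<psi> (\<lambda>y. F (t y))) E germ_half"
  proof
    show "open U" by (rule g.openU)
    show "?\<psi> (\<lambda>y. F (t y)) = ?\<psi> (\<lambda>y. G (t y))" if "fls_smooth_on U F" "\<And>x. x \<in> U \<Longrightarrow> F x = G x" for F G
      by (rule r1.\<psi>_cong[OF comp[OF that(1)]]) (use that(2) t(2) in auto)
    show "?\<psi> (\<lambda>y. F (t y) + G (t y)) = ?\<psi> (\<lambda>y. F (t y)) + ?\<psi> (\<lambda>y. G (t y))" if "fls_smooth_on U F" "fls_smooth_on U G" for F G
      by (rule r1.\<psi>_add[OF comp[OF that(1)] comp[OF that(2)]])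
    show "?\<psi> (\<lambda>y. F (t y) * G (t y)) = ?\<psi> (\<lambda>y. F (t y)) * ?\<psi> (\<lambda>y. G (t y))" if "fls_smooth_on U F" "fls_smooth_on U G" for F G
      by (rule r1.\<psi>_mult[OF comp[OF that(1)] comp[OF that(2)]])
    show "?\<psi> (\<lambda>y. formal_deriv a F (t y)) = E a (?\<psi> (\<lambda>y. F (t y)))" if F: "fls_smooth_on U F" for F a
    proof -
      have dF: "fls_smooth_on V (\<lambda>y. formal_deriv i F (t y))" for i
        by (rule comp[OF fls_smooth_on_formal_deriv[OF g.openU F]])
      have "germ_deriv b (?\<psi> (\<lambda>y. F (t y))) = (\<Sum>i\<in>UNIV. J $ i $ b * ?\<psi> (\<lambda>y. formal_deriv i F (t y)))" for b
      proof -
        have "germ_deriv b (?\<psi> (\<lambda>y. F (t y))) = ?\<psi> (formal_deriv b (\<lambda>y. F (t y)))"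
          by (rule r1.\<psi>_deriv[OF comp[OF F], symmetric])
        also have "\<dots> = ?\<psi> (\<lambda>y. \<Sum>i\<in>UNIV. jac t y $ i $ b * formal_deriv i F (t y))"
        proof (rule r1.\<psi>_cong[OF fls_smooth_on_formal_deriv[OF g'.openU comp[OF F]]])
          fix z assume z: "z \<in> V"
          show "formal_deriv b (\<lambda>y. F (t y)) z = (\<Sum>i\<in>UNIV. jac t z $ i $ b * formal_deriv i F (t z))"
          proof (cases b)
            case None
            then show ?thesis by (simp add: sum_option jac_def formal_deriv_compose_None)
          next
            case (Some i)
            then show ?thesis
              using formal_deriv_compose_Some[OF g'.openU g.openU F t z] by (simp add: sum_option jac_def)
          qed
        qed
        also have "\<dots> = (\<Sum>i\<in>UNIV. J $ i $ b * ?\<psi> (\<lambda>y. formal_deriv i F (t y)))"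
          by (simp add: r1.\<psi>_sum r1.\<psi>_mult jac_sm dF fls_smooth_on_mult g'.openU J_def r1.\<psi>m_nth)
        finally show ?thesis .
      qed
      then have "E a (?\<psi> (\<lambda>y. F (t y))) = (\<Sum>b\<in>UNIV. Kg $ b $ a * (\<Sum>i\<in>UNIV. J $ i $ b * ?\<psi> (\<lambda>y. formal_deriv i F (t y))))"
        by (simp add: ED)
      also have "\<dots> = (\<Sum>i\<in>UNIV. (\<Sum>b\<in>UNIV. J $ i $ b * Kg $ b $ a) * ?\<psi> (\<lambda>y. formal_deriv i F (t y)))"
        unfolding sum_distrib_left sum_distrib_right by (subst sum.swap) (simp add: mult_ac)
      also have "\<dots> = (\<Sum>i\<in>UNIV. if i = a then ?\<psi> (\<lambda>y. formal_deriv i F (t y)) else 0)"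
        unfolding matrix_mult_eq_mat_nth[OF JKg(1)] by (rule sum.cong) auto
      finally show ?thesis by simp
    qed
  qed (rule r1.\<psi>_half, rule r1.\<psi>_1)
  interpret r2: realization U "\<lambda>F. ?\<psi> (\<lambda>y. F (t y))" E germ_half by (rule r2)
  have gt: "fls_smooth_on V (\<lambda>y. g (t y) $ i $ j)" for i j by (rule comp[OF g.g_smooth])
  have gJ: "?\<psi> (\<lambda>x. g' x $ i $ j) = (transpose J ** r2.\<psi>m g ** J) $ i $ j" for i j
  proof -
    have "?\<psi> (\<lambda>x. g' x $ i $ j) = ?\<psi> (\<lambda>x. \<Sum>l\<in>UNIV. (\<Sum>k\<in>UNIV. jac t x $ k $ i * g (t x) $ k $ l) * jac t x $ l $ j)"
      by (rule r1.\<psi>_cong[OF g'.g_smooth]) (simp add: g' matrix_mult_nth transpose_def)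
    also have "\<dots> = (transpose J ** r2.\<psi>m g ** J) $ i $ j"
      by (simp add: r1.\<psi>_sum r1.\<psi>_mult jac_sm gt fls_smooth_on_mult fls_smooth_on_sum g'.openU J_def r1.\<psi>m_nth r2.\<psi>m_nth matrix_mult_nth transpose_def)
    finally show ?thesis .
  qed
  have f': "?\<psi> f' = ?\<psi> (\<lambda>y. f (t y))" by (rule r1.\<psi>_cong[OF f(1,3)])
  note main = realization_frame_change[OF assms(1,2) r2 r1.realization_axioms germ.derivations_axioms JKg J_closed DE gJ f(1,2) f']
  \<comment> \<open>Evaluation of a transformation law of germs at \<open>y\<close>, stated once for
    the Ricci tensor and the Hessian.\<close>
  have fin: "F y = (\<Sum>j\<in>UNIV. \<Sum>l\<in>UNIV. jac t y $ j $ b * jac t y $ l $ c * G j l (t y))"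
    if "?\<psi> F = (\<Sum>j\<in>UNIV. \<Sum>l\<in>UNIV. J $ j $ b * J $ l $ c * ?\<psi> (\<lambda>y. G j l (t y)))"
      "fls_smooth_on V F" "\<And>j l. fls_smooth_on U (G j l)" for F G b c
  proof (rule germ_at_eqD[OF g'.openU y, where G = "\<lambda>y. \<Sum>j\<in>UNIV. \<Sum>l\<in>UNIV. jac t y $ j $ b * jac t y $ l $ c * G j l (t y)"])
    show "fls_smooth_on V (\<lambda>y. \<Sum>j\<in>UNIV. \<Sum>l\<in>UNIV. jac t y $ j $ b * jac t y $ l $ c * G j l (t y))"
      by (intro fls_smooth_on_sum fls_smooth_on_mult jac_sm comp that g'.openU)
    show "?\<psi> F = ?\<psi> (\<lambda>y. \<Sum>j\<in>UNIV. \<Sum>l\<in>UNIV. jac t y $ j $ b * jac t y $ l $ c * G j l (t y))"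
      unfolding that(1)
      by (simp add: r1.\<psi>_sum r1.\<psi>_mult jac_sm comp that(3) fls_smooth_on_mult fls_smooth_on_sum g'.openU J_def r1.\<psi>m_nth)
  qed (rule that(2))
  show "ricci g' b c y = (\<Sum>j\<in>UNIV. \<Sum>l\<in>UNIV. jac t y $ j $ b * jac t y $ l $ c * ricci g j l (t y))"
    by (rule fin[of "ricci g' b c" b c "ricci g", OF main(1) g'.ricci_sm g.ricci_sm])
  show "hessian g' f' b c y = (\<Sum>j\<in>UNIV. \<Sum>l\<in>UNIV. jac t y $ j $ b * jac t y $ l $ c * hessian g f j l (t y))"
    by (rule fin[of "hessian g' f' b c" b c "hessian g f", OF main(2) g'.hessian_sm[OF f(1)] g.hessian_sm[OF f(2)]])
qed

definition refl_sign :: "'n option \<Rightarrow> 'a::comm_ring_1" where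
  "refl_sign a = (case a of None \<Rightarrow> - 1 | Some _ \<Rightarrow> 1)"

text \<open>The substitution r \<mapsto> -r is a change of frame from \<open>g\<close> to itself
  whose Jacobian diag(-1, 1, ..., 1) is constant and its own inverse.\<close>

lemma ricci_reflect:
  assumes "smooth_formal_metric U g"
    and g: "\<And>x a b. x \<in> U \<Longrightarrow> g x $ a $ b = refl_sign a * refl_sign b * fls_reflect (g x $ a $ b)"
    and f: "fls_smooth_on U f" "\<And>x. x \<in> U \<Longrightarrow> fls_reflect (f x) = f x"
    and x0: "x0 \<in> U"
  shows "ricci g b c x0 = refl_sign b * refl_sign c * fls_reflect (ricci g b c x0)"
    and "hessian g f b c x0 = refl_sign b * refl_sign c * fls_reflect (hessian g f b c x0)"
proof -
  interpret g: smooth_formal_metric U g by fact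
  let ?\<psi> = "germ_at x0"
  interpret r1: realization U ?\<psi> germ_deriv germ_half by (rule germ_realization[OF g.openU x0])
  define J :: "'a germ^('a option)^('a option)" where "J = (\<chi> i j. if i = j then refl_sign i else 0)"
  define E where "E i x = refl_sign i * germ_deriv i (x :: 'a germ)" for i x
  have ss: "refl_sign i * (refl_sign i * x) = x" for i :: "'a option" and x :: "'b::comm_ring_1"
    by (cases i) (simp_all add: refl_sign_def)
  have JJ: "J ** J = mat 1"
  proof -
    have "(\<Sum>k\<in>UNIV. J $ i $ k * J $ k $ j) = (\<Sum>k\<in>UNIV. if k = i then (if i = j then 1 else 0) else 0)" for i j
      by (rule sum.cong) (use ss[of _ 1] in \<open>auto simp: J_def\<close>)
    then show ?thesis by (simp add: vec_eq_iff matrix_mult_nth mat_def)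
  qed
  have Jc: "germ_deriv a (J $ i $ b) = germ_deriv b (J $ i $ a)" for a b i
  proof -
    have "germ_deriv a (J $ i $ b) = 0" for a b
      by (cases i; cases b) (simp_all add: J_def refl_sign_def germ.D_minus)
    then show ?thesis by simp
  qed
  have DE: "germ_deriv a x = (\<Sum>i\<in>UNIV. J $ i $ a * E i x)" for a x
    by (simp add: J_def E_def if_distrib if_distribR ss cong: if_cong)
  have rsm: "fls_smooth_on U (\<lambda>y. fls_reflect (F y))" if "fls_smooth_on U F" for F
    by (rule fls_smooth_on_reflect[OF g.openU that])
  have r2: "realization U (\<lambda>F. ?\<psi> (\<lambda>y. fls_reflect (F y))) E germ_half"
  proof
    show "open U" by (rule g.openU)
    show "?\<psi> (\<lambda>y. fls_reflect (F y)) = ?\<psi> (\<lambda>y. fls_reflect (G y))" if "fls_smooth_on U F" "\<And>x. x \<in> U \<Longrightarrow> F x = G x" for F G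
      by (rule r1.\<psi>_cong[OF rsm[OF that(1)]]) (simp add: that)
    show "?\<psi> (\<lambda>y. fls_reflect (F y + G y)) = ?\<psi> (\<lambda>y. fls_reflect (F y)) + ?\<psi> (\<lambda>y. fls_reflect (G y))" if "fls_smooth_on U F" "fls_smooth_on U G" for F G
      unfolding fls_reflect_add by (rule r1.\<psi>_add[OF rsm[OF that(1)] rsm[OF that(2)]])
    show "?\<psi> (\<lambda>y. fls_reflect (F y * G y)) = ?\<psi> (\<lambda>y. fls_reflect (F y)) * ?\<psi> (\<lambda>y. fls_reflect (G y))" if "fls_smooth_on U F" "fls_smooth_on U G" for F G
      unfolding fls_reflect_mult by (rule r1.\<psi>_mult[OF rsm[OF that(1)] rsm[OF that(2)]])
    show "?\<psi> (\<lambda>y. fls_reflect (fls_const (1 / 2))) = germ_half" by (simp add: r1.\<psi>_half)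
    show "?\<psi> (\<lambda>y. fls_reflect 1) = 1" using fls_reflect_const[of 1] by (simp add: r1.\<psi>_1)
    show "?\<psi> (\<lambda>y. fls_reflect (formal_deriv a F y)) = E a (?\<psi> (\<lambda>y. fls_reflect (F y)))" if F: "fls_smooth_on U F" for F a
    proof -
      have d: "germ_deriv a (?\<psi> (\<lambda>y. fls_reflect (F y))) = ?\<psi> (formal_deriv a (\<lambda>y. fls_reflect (F y)))"
        by (rule r1.\<psi>_deriv[OF rsm[OF F], symmetric])
      show ?thesis
      proof (cases a)
        case None
        have "?\<psi> (formal_deriv a (\<lambda>y. fls_reflect (F y))) = ?\<psi> (\<lambda>y. - fls_reflect (formal_deriv None F y))"
          by (rule r1.\<psi>_cong[OF fls_smooth_on_formal_deriv[OF g.openU rsm[OF F]]])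
             (simp add: None fls_reflect_formal_deriv_None)
        also have "\<dots> = - ?\<psi> (\<lambda>y. fls_reflect (formal_deriv None F y))"
          by (rule r1.\<psi>_minus[OF rsm[OF fls_smooth_on_formal_deriv[OF g.openU F]]])
        finally show ?thesis using d None by (simp add: E_def refl_sign_def)
      next
        case (Some i)
        have "?\<psi> (formal_deriv a (\<lambda>y. fls_reflect (F y))) = ?\<psi> (\<lambda>y. fls_reflect (formal_deriv a F y))"
          by (rule r1.\<psi>_cong[OF fls_smooth_on_formal_deriv[OF g.openU rsm[OF F]]])
             (simp add: Some fls_reflect_formal_deriv_Some[OF g.openU _ F])
        then show ?thesis using d Some by (simp add: E_def refl_sign_def)
      qed
    qed
  qed
  interpret r2: realization U "\<lambda>F. ?\<psi> (\<lambda>y. fls_reflect (F y))" E germ_half by (rule r2)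
  have sign: "refl_sign a * ?\<psi> F = ?\<psi> (\<lambda>x. refl_sign a * F x)" if "fls_smooth_on U F" for a :: "'a option" and F
    using r1.\<psi>_minus[OF that] by (cases a) (simp_all add: refl_sign_def)
  have JM: "(transpose J ** M ** J) $ i $ j = refl_sign i * (refl_sign j * M $ i $ j)" for M i j
    by (simp add: matrix_mult_nth transpose_def J_def if_distrib if_distribR mult_ac cong: if_cong)
  have sm2: "fls_smooth_on U (\<lambda>x. refl_sign a * F x)" if "fls_smooth_on U F" for a :: "'a option" and F
    by (intro fls_smooth_on_mult that g.openU fls_smooth_on_const)
  have gJ: "?\<psi> (\<lambda>x. g x $ i $ j) = (transpose J ** r2.\<psi>m g ** J) $ i $ j" for i j
    unfolding JM r2.\<psi>m_nth
    by (simp add: sign rsm g.g_smooth sm2) (rule r1.\<psi>_cong[OF g.g_smooth], simp add: g[symmetric] mult.assoc[symmetric])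
  have f': "?\<psi> f = ?\<psi> (\<lambda>y. fls_reflect (f y))" by (rule r1.\<psi>_cong[OF f(1)]) (simp add: f(2))
  note main = realization_frame_change[OF assms(1,1) r2 r1.realization_axioms germ.derivations_axioms JJ JJ Jc DE gJ f(1,1) f']
  have fin: "F x0 = refl_sign b * refl_sign c * fls_reflect (G b c x0)"
    if e: "?\<psi> F = (\<Sum>j\<in>UNIV. \<Sum>l\<in>UNIV. J $ j $ b * J $ l $ c * ?\<psi> (\<lambda>y. fls_reflect (G j l y)))"
      and sm: "fls_smooth_on U F" "\<And>j l. fls_smooth_on U (G j l)" for F G b c
  proof (rule germ_at_eqD[OF g.openU x0, where G = "\<lambda>y. refl_sign b * refl_sign c * fls_reflect (G b c y)"])
    show "fls_smooth_on U (\<lambda>y. refl_sign b * refl_sign c * fls_reflect (G b c y))"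
      by (intro fls_smooth_on_mult fls_smooth_on_const rsm sm g.openU)
    have Jsum: "(\<Sum>l\<in>UNIV. J $ l $ c * Y l) = refl_sign c * Y c" for c Y
      by (simp add: J_def if_distrib if_distribR cong: if_cong)
    have "?\<psi> F = (\<Sum>j\<in>UNIV. J $ j $ b * (\<Sum>l\<in>UNIV. J $ l $ c * ?\<psi> (\<lambda>y. fls_reflect (G j l y))))"
      unfolding e by (simp add: sum_distrib_left mult.assoc)
    also have "\<dots> = refl_sign b * (refl_sign c * ?\<psi> (\<lambda>y. fls_reflect (G b c y)))"
      unfolding Jsum ..
    also have "\<dots> = ?\<psi> (\<lambda>y. refl_sign b * (refl_sign c * fls_reflect (G b c y)))"
      by (simp add: sign sm rsm sm2)
    finally show "?\<psi> F = ?\<psi> (\<lambda>y. refl_sign b * refl_sign c * fls_reflect (G b c y))"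
      by (simp add: mult.assoc)
  qed (rule sm(1))
  show "ricci g b c x0 = refl_sign b * refl_sign c * fls_reflect (ricci g b c x0)"
    by (rule fin[of "ricci g b c" b c "ricci g", OF main(1) g.ricci_sm g.ricci_sm])
  show "hessian g f b c x0 = refl_sign b * refl_sign c * fls_reflect (hessian g f b c x0)"
    by (rule fin[of "hessian g f b c" b c "hessian g f", OF main(2) g.hessian_sm[OF f(1)] g.hessian_sm[OF f(1)]])
qed

section \<open>Conical metrics in a chart\<close>

lemma even_series_nth: "even_series u $$ k = (if 0 \<le> k \<and> even k then u (nat k div 2) else 0)"
  by (auto simp: even_series_def even_nat_iff)

lemma fls_ge_even_series [simp]: "fls_ge 0 (even_series u)"
  by (simp add: fls_ge_def even_series_nth)

lemma fls_smooth_on_even_series: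
  assumes "\<And>k. smooth_on U (\<lambda>x. u x k)"
  shows "fls_smooth_on U (\<lambda>x. even_series (u x))"
proof (rule fls_smooth_onI[of _ 0])
  show "smooth_on U (\<lambda>x. even_series (u x) $$ k)" for k
    using assms by (cases "0 \<le> k"; cases "even k") (simp_all add: even_series_nth)
qed simp

lemma fls_ge_prod:
  fixes F :: "'i \<Rightarrow> 'a::comm_ring_1 fls"
  assumes "\<And>i. i \<in> I \<Longrightarrow> fls_ge 0 (F i)"
  shows "fls_ge 0 (\<Prod>i\<in>I. F i) \<and> (\<Prod>i\<in>I. F i) $$ 0 = (\<Prod>i\<in>I. F i $$ 0)"
  using assms
proof (induction I rule: infinite_finite_induct)
  case (insert i I)
  then show ?case
    using fls_ge_mult[of 0 "F i" 0 "prod F I"] fls_mult_lead[of 0 "F i" 0 "prod F I" 0] by simp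
qed simp_all

lemma fls_ge_of_int_mult: "fls_ge p F \<Longrightarrow> fls_ge p (of_int c * F :: 'a::ring_1 fls)"
  by (simp add: fls_ge_def)

lemma fls_det:
  fixes A :: "real fls^'n^'n"
  assumes "\<And>i j. fls_ge 0 (A $ i $ j)"
  shows "fls_ge 0 (det A)" "det A $$ 0 = det (\<chi> i j. A $ i $ j $$ 0)"
proof -
  have *: "fls_ge 0 (\<Prod>i\<in>UNIV. A $ i $ p i)" "(\<Prod>i\<in>UNIV. A $ i $ p i) $$ 0 = (\<Prod>i\<in>UNIV. A $ i $ p i $$ 0)" for p
    using fls_ge_prod[of UNIV "\<lambda>i. A $ i $ p i"] assms by auto
  show "fls_ge 0 (det A)"
    unfolding det_def by (intro fls_ge_sum fls_ge_of_int_mult *)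
  show "det A $$ 0 = det (\<chi> i j. A $ i $ j $$ 0)"
    unfolding det_def by (simp add: fls_sum_nth *)
qed

lemma fls_smooth_on_det:
  assumes "open U" "\<And>i j. fls_smooth_on U (\<lambda>x. A x $ i $ j)"
  shows "fls_smooth_on U (\<lambda>x. det (A x))"
  unfolding det_def
  by (intro fls_smooth_on_sum fls_smooth_on_mult fls_smooth_on_prod fls_smooth_on_const assms)

lemma matrix_inv_eqI:
  fixes A B :: "'a::field^'n^'n"
  assumes "A ** B = mat 1"
  shows "matrix_inv A = B"
proof -
  have BA: "B ** A = mat 1" using assms matrix_left_right_inverse by blast
  have "A ** matrix_inv A = mat 1 \<and> matrix_inv A ** A = mat 1"
    unfolding matrix_inv_def by (rule someI[of _ B]) (simp add: assms BA)
  then have "matrix_inv A = matrix_inv A ** (A ** B)" "matrix_inv A ** A = mat 1"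
    by (simp_all add: assms)
  then show ?thesis by (simp add: matrix_mul_assoc)
qed

lemma cramer_inverse:
  fixes A :: "'a::field^'n^'n"
  assumes "det A \<noteq> 0"
  shows "A ** (\<chi> k j. det (\<chi> a b. if b = k then (if a = j then 1 else 0) else A $ a $ b) * inverse (det A)) = mat 1"
    (is "A ** ?B = _")
proof -
  have "(A ** ?B) $ i $ j = mat 1 $ i $ j" for i j
  proof -
    have "A *v (\<chi> k. ?B $ k $ j) = (\<chi> a. if a = j then 1 else 0)"
      unfolding cramer[OF assms] by (simp add: vec_eq_iff divide_inverse cong: if_cong)
    then have "(A *v (\<chi> k. ?B $ k $ j)) $ i = (if i = j then 1 else 0)" by simp
    then show ?thesis by (simp add: matrix_vector_mult_def matrix_mult_nth mat_def)
  qed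
  then show ?thesis by (simp add: vec_eq_iff)
qed

text \<open>Cramer's rule expresses the inverse by determinants, which inherit smoothness and order
  from the entries. The leading coefficient of \<open>det (A x)\<close> is the determinant of the
  leading coefficients, so it can be inverted.\<close>

lemma fls_matrix_inverse:
  fixes A :: "real^'n::finite \<Rightarrow> real fls^'m^'m"
  assumes "open U" and sm: "\<And>i j. fls_smooth_on U (\<lambda>x. A x $ i $ j)"
    and ge: "\<And>x i j. x \<in> U \<Longrightarrow> fls_ge 0 (A x $ i $ j)"
    and nz: "\<And>x. x \<in> U \<Longrightarrow> det (\<chi> i j. A x $ i $ j $$ 0) \<noteq> 0"
  obtains B where "\<And>x. x \<in> U \<Longrightarrow> A x ** B x = mat 1"
    "\<And>i j. fls_smooth_on U (\<lambda>x. B x $ i $ j)" "\<And>x i j. x \<in> U \<Longrightarrow> fls_ge 0 (B x $ i $ j)"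
proof -
  define M where "M x k j = (\<chi> a b. if b = k then (if a = j then 1 else 0) else A x $ a $ b)" for x k j
  define B where "B x = (\<chi> k j. det (M x k j) * inverse (det (A x)))" for x
  have d0: "fls_ge 0 (det (A x))" "det (A x) $$ 0 \<noteq> 0" if "x \<in> U" for x
    using fls_det[of "A x"] ge[OF that] nz[OF that] by auto
  have M_sm: "fls_smooth_on U (\<lambda>x. M x k j $ a $ b)" for k j a b
    by (cases "b = k") (simp_all add: M_def sm)
  have M_ge: "fls_ge 0 (M x k j $ a $ b)" if "x \<in> U" for x k j a b
    by (simp add: M_def ge[OF that])
  show ?thesis
  proof (rule that[of B])
    show "A x ** B x = mat 1" if "x \<in> U" for x
      unfolding B_def M_def by (rule cramer_inverse) (use d0[OF that] in auto)
    show "fls_smooth_on U (\<lambda>x. B x $ i $ j)" for i j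
      unfolding B_def by simp (intro fls_smooth_on_mult fls_smooth_on_det fls_smooth_on_inverse sm M_sm d0 assms(1))
    show "fls_ge 0 (B x $ i $ j)" if "x \<in> U" for x i j
      unfolding B_def using fls_ge_mult[OF fls_det(1)[OF M_ge[OF that]] fls_inverse_ge_0(1)[OF d0[OF that]]] by simp
  qed
qed

text \<open>One chart with the metric dr^2 + r^2 h + N and the potential -r^2/4 + \<phi>, where N
  and \<phi> are series without positive powers of r.\<close>

locale cone_chart =
  fixes U :: "(real^'n::finite) set" and h :: "real^'n \<Rightarrow> real^'n^'n" and N :: "real^'n \<Rightarrow> real fls^'n^'n"
    and \<phi> :: "real^'n \<Rightarrow> real fls"
  assumes open_U: "open U"
    and h_smooth: "smooth_on U (\<lambda>x. h x $ i $ j)"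
    and h_sym: "x \<in> U \<Longrightarrow> h x $ i $ j = h x $ j $ i"
    and h_det: "x \<in> U \<Longrightarrow> det (h x) \<noteq> 0"
    and N_smooth: "fls_smooth_on U (\<lambda>x. N x $ i $ j)"
    and N_sym: "x \<in> U \<Longrightarrow> N x $ i $ j = N x $ j $ i"
    and N_ge: "x \<in> U \<Longrightarrow> fls_ge 0 (N x $ i $ j)"
    and \<phi>_smooth: "fls_smooth_on U \<phi>"
    and \<phi>_ge: "x \<in> U \<Longrightarrow> fls_ge 0 (\<phi> x)"
begin

definition H where "H x = (\<chi> i j. fls_X_inv ^ 2 * fls_const (h x $ i $ j) + N x $ i $ j)"
definition g where "g x = option_block 1 (H x)"
definition f where "f x = fls_const (- 1/4) * fls_X_inv ^ 2 + \<phi> x"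
definition B where "B x = matrix_inv (H x)"

lemma H_nth: "H x $ i $ j $$ k = (if k = - 2 then h x $ i $ j else 0) + N x $ i $ j $$ k"
  by (simp add: H_def fls_X_inv_power_nth)

lemma f_nth: "f x $$ k = (if k = - 2 then - 1/4 else 0) + \<phi> x $$ k"
  by (simp add: f_def mult.commute[of "fls_const _"] fls_X_inv_power_nth del: fls_mult_const_nth)

lemma H_smooth: "fls_smooth_on U (\<lambda>x. H x $ i $ j)"
  unfolding H_def by simp (intro fls_smooth_on_add fls_smooth_on_mult fls_smooth_on_const fls_smooth_on_fls_const
      h_smooth N_smooth open_U)

lemma f_smooth: "fls_smooth_on U f"
  unfolding f_def[abs_def] by (intro fls_smooth_on_add fls_smooth_on_const \<phi>_smooth open_U)

lemma H_ge: "x \<in> U \<Longrightarrow> fls_ge (- 2) (H x $ i $ j)"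
  using N_ge[of x i j] by (simp add: fls_ge_def H_nth)

lemma f_ge: "x \<in> U \<Longrightarrow> fls_ge (- 2) (f x)"
  using \<phi>_ge[of x] by (simp add: fls_ge_def f_nth)

lemma H_sym: "x \<in> U \<Longrightarrow> H x $ i $ j = H x $ j $ i"
  by (simp add: H_def h_sym[of x i j] N_sym[of x i j])

lemma B_props:
  shows H_B: "x \<in> U \<Longrightarrow> H x ** B x = mat 1" and B_smooth: "fls_smooth_on U (\<lambda>x. B x $ i $ j)"
    and B_ge: "x \<in> U \<Longrightarrow> fls_ge 2 (B x $ i $ j)"
proof -
  \<comment> \<open>This is X^2 H: it has order 0 and leading coefficient \<open>h\<close>, so it
    has an inverse of order 0, and \<open>B\<close> is X^2 times that inverse.\<close>
  define A where "A x = (\<chi> i j. fls_const (h x $ i $ j) + fls_X ^ 2 * N x $ i $ j)" for x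
  have A_nth: "A x $ i $ j $$ k = (if k = 0 then h x $ i $ j else 0) + N x $ i $ j $$ (k - 2)" for x i j k
    by (simp add: A_def fls_X_power_nth)
  have A_sm: "fls_smooth_on U (\<lambda>x. A x $ i $ j)" for i j
    unfolding A_def by simp (intro fls_smooth_on_add fls_smooth_on_mult fls_smooth_on_const fls_smooth_on_fls_const
        h_smooth N_smooth open_U)
  have A_ge: "fls_ge 0 (A x $ i $ j)" if "x \<in> U" for x i j
    using N_ge[OF that, of i j] by (simp add: fls_ge_def A_nth)
  have A_det: "det (\<chi> i j. A x $ i $ j $$ 0) \<noteq> 0" if "x \<in> U" for x
  proof -
    have "(\<chi> i j. A x $ i $ j $$ 0) = h x"
      using N_ge[OF that] by (simp add: vec_eq_iff A_nth fls_ge_def)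
    then show ?thesis using h_det[OF that] by simp
  qed
  obtain B' where B': "\<And>x. x \<in> U \<Longrightarrow> A x ** B' x = mat 1"
    "\<And>i j. fls_smooth_on U (\<lambda>x. B' x $ i $ j)" "\<And>x i j. x \<in> U \<Longrightarrow> fls_ge 0 (B' x $ i $ j)"
    using fls_matrix_inverse[OF open_U A_sm A_ge A_det] by blast
  have XX: "fls_X ^ 2 * fls_X_inv ^ 2 = (1 :: real fls)"
    by (simp add: fls_X_inv_power_times_conv_shift fls_X_power_conv_shift_1)
  have HH: "H x ** (\<chi> i j. fls_X ^ 2 * B' x $ i $ j) = mat 1" if "x \<in> U" for x
  proof -
    have HA: "H x $ i $ j = fls_X_inv ^ 2 * A x $ i $ j" for i j
    proof -
      have "fls_X_inv ^ 2 * (fls_X ^ 2 * N x $ i $ j) = N x $ i $ j"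
        using XX by (simp add: mult.assoc[symmetric] mult.commute)
      then show ?thesis by (simp add: H_def A_def distrib_left)
    qed
    have mm: "fls_X_inv ^ 2 * a * (fls_X ^ 2 * b) = a * (b :: real fls)" for a b
    proof -
      have "fls_X_inv ^ 2 * a * (fls_X ^ 2 * b) = (fls_X ^ 2 * fls_X_inv ^ 2) * (a * b)" by (simp only: ac_simps)
      then show ?thesis by (simp only: XX mult_1)
    qed
    show ?thesis
      unfolding B'(1)[OF that, symmetric] by (simp only: vec_eq_iff matrix_mult_nth HA mm vec_lambda_beta) simp
  qed
  have BB: "B x = (\<chi> i j. fls_X ^ 2 * B' x $ i $ j)" if "x \<in> U" for x
    unfolding B_def by (rule matrix_inv_eqI[OF HH[OF that]])
  show "H x ** B x = mat 1" if "x \<in> U"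
    unfolding BB[OF that] by (rule HH[OF that])
  show "fls_smooth_on U (\<lambda>x. B x $ i $ j)"
    by (rule fls_smooth_on_cong[OF open_U, of "\<lambda>x. fls_X ^ 2 * B' x $ i $ j"])
       (simp_all add: BB fls_smooth_on_mult open_U B')
  show "fls_ge 2 (B x $ i $ j)" if "x \<in> U"
    using B'(3)[OF that, of i j] by (simp add: BB[OF that] fls_ge_def fls_X_power_nth)
qed

lemma B_H: "x \<in> U \<Longrightarrow> B x ** H x = mat 1"
  using H_B matrix_left_right_inverse by blast

text \<open>The coefficient of X^0 in \<open>B x ** H x = mat 1\<close>: the leading coefficient of
  \<open>B\<close> is the inverse of \<open>h\<close>.\<close>

lemma B_lead:
  assumes "x \<in> U"
  shows "(\<Sum>d\<in>UNIV. B x $ i $ d $$ 2 * h x $ d $ j) = (if i = j then 1 else 0)"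
proof -
  have "(\<Sum>d\<in>UNIV. B x $ i $ d $$ 2 * h x $ d $ j) = (\<Sum>d\<in>UNIV. (B x $ i $ d * H x $ d $ j) $$ 0)"
    using fls_geD[OF N_ge[OF assms], of "- 2"] by (simp add: fls_mult_lead[OF B_ge[OF assms] H_ge[OF assms]] H_nth)
  also have "\<dots> = (B x ** H x) $ i $ j $$ 0" by (simp add: matrix_mult_nth fls_sum_nth)
  finally show ?thesis by (simp add: B_H[OF assms] mat_def)
qed

lemma matrix_inv_g: "x \<in> U \<Longrightarrow> matrix_inv (g x) = option_block 1 (B x)"
  by (rule matrix_inv_eqI) (simp add: g_def option_block_mult H_B option_block_mat)

sublocale smooth_formal_metric U g
proof
  fix i j
  show "open U" by (rule open_U)
  show "fls_smooth_on U (\<lambda>x. g x $ i $ j)"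
    by (cases i; cases j) (simp_all add: g_def H_smooth)
  show "fls_smooth_on U (\<lambda>x. matrix_inv (g x) $ i $ j)"
  proof (rule fls_smooth_on_cong[OF open_U])
    show "fls_smooth_on U (\<lambda>x. option_block 1 (B x) $ i $ j)"
      by (cases i; cases j) (simp_all add: B_smooth)
  qed (simp add: matrix_inv_g)
  fix x assume x: "x \<in> U"
  show "g x $ i $ j = g x $ j $ i"
    by (cases i; cases j) (simp_all add: g_def H_sym[OF x])
  show "g x ** matrix_inv (g x) = mat 1"
    unfolding matrix_inv_g[OF x] by (simp add: g_def option_block_mult H_B x option_block_mat)
  then show "matrix_inv (g x) ** g x = mat 1"
    using matrix_left_right_inverse by blast
qed

text \<open>\<open>S\<close>, \<open>C\<close> and \<open>L\<close> are Gamma^r_jk, Gamma^i_rj and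
  Gamma^i_jk: up to sign the second fundamental form, the shape operator and the connection of the
  slices on which r is constant.\<close>

definition S where "S j k x = fls_const (1/2) * (- formal_deriv None (\<lambda>y. H y $ j $ k) x)"
definition C where "C i j x = fls_const (1/2) * (\<Sum>d\<in>UNIV. B x $ i $ d * formal_deriv None (\<lambda>y. H y $ d $ j) x)"
definition L where "L i j k x = fls_const (1/2) * (\<Sum>d\<in>UNIV. B x $ i $ d *
   (formal_deriv (Some j) (\<lambda>y. H y $ d $ k) x + formal_deriv (Some k) (\<lambda>y. H y $ d $ j) x - formal_deriv (Some d) (\<lambda>y. H y $ j $ k) x))"

lemma formal_deriv_0 [simp]: "formal_deriv a (\<lambda>y. 0) x = 0"
  using formal_deriv_fls_const[of a 0 x] by simp

lemma formal_deriv_1 [simp]: "formal_deriv a (\<lambda>y. 1) x = 0"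
  using formal_deriv_fls_const[of a 1 x] by simp

lemma christoffel_components:
  assumes "x \<in> U"
  shows "christoffel g None None b x = 0" "christoffel g None b None x = 0" "christoffel g (Some i) None None x = 0"
    "christoffel g None (Some j) (Some k) x = S j k x"
    "christoffel g (Some i) None (Some j) x = C i j x" "christoffel g (Some i) (Some j) None x = C i j x"
    "christoffel g (Some i) (Some j) (Some k) x = L i j k x"
proof -
  note simps = christoffel_def matrix_inv_g[OF assms] sum_option S_def C_def L_def
  show "christoffel g None None b x = 0" "christoffel g None b None x = 0"
    by (cases b; simp add: simps; simp add: g_def)+
  show "christoffel g (Some i) None None x = 0"
    "christoffel g None (Some j) (Some k) x = S j k x"
    "christoffel g (Some i) None (Some j) x = C i j x" "christoffel g (Some i) (Some j) None x = C i j x"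
    "christoffel g (Some i) (Some j) (Some k) x = L i j k x"
    by (simp_all add: simps) (simp_all add: g_def)
qed

lemma C_smooth: "fls_smooth_on U (C i j)"
  by (rule fls_smooth_on_cong[OF open_U christoffel_components(5) christoffel_sm])
lemma L_smooth: "fls_smooth_on U (L i j k)"
  by (rule fls_smooth_on_cong[OF open_U christoffel_components(7) christoffel_sm])

lemma christoffel_components_deriv:
  assumes "x \<in> U"
  shows "formal_deriv a (christoffel g None None b) x = 0" "formal_deriv a (christoffel g None b None) x = 0"
    "formal_deriv a (christoffel g (Some i) None None) x = 0"
    "formal_deriv a (christoffel g None (Some j) (Some k)) x = formal_deriv a (S j k) x"
    "formal_deriv a (christoffel g (Some i) None (Some j)) x = formal_deriv a (C i j) x"
    "formal_deriv a (christoffel g (Some i) (Some j) None) x = formal_deriv a (C i j) x"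
    "formal_deriv a (christoffel g (Some i) (Some j) (Some k)) x = formal_deriv a (L i j k) x"
  using formal_deriv_cong[OF open_U assms christoffel_components(1)] formal_deriv_cong[OF open_U assms christoffel_components(2)]
    formal_deriv_cong[OF open_U assms christoffel_components(3)] formal_deriv_cong[OF open_U assms christoffel_components(4)]
    formal_deriv_cong[OF open_U assms christoffel_components(5)] formal_deriv_cong[OF open_U assms christoffel_components(6)]
    formal_deriv_cong[OF open_U assms christoffel_components(7)]
  by simp_all

abbreviation "E \<equiv> soliton_op f"

text \<open>The traced Riccati equation for the shape operator, with the Hessian and metric terms
  added; \<open>E_rl\<close> and \<open>E_jk\<close> are likewise the traced Codazzi and Gauss
  equations.\<close>

lemma E_rr:
  assumes "x \<in> U"
  shows "E None None x = - (\<Sum>i\<in>UNIV. formal_deriv None (C i i) x) - (\<Sum>i\<in>UNIV. \<Sum>j\<in>UNIV. C i j x * C j i x)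
     + formal_deriv None (formal_deriv None f) x + fls_const (1/2)"
  by (simp add: soliton_op_def ricci_def hessian_def sum_option christoffel_components[OF assms]
      christoffel_components_deriv[OF assms] sum_subtractf sum_negf sum.distrib)
     (simp add: g_def)

lemma E_rl:
  assumes "x \<in> U"
  shows "E None (Some l) x = (\<Sum>i\<in>UNIV. formal_deriv (Some i) (C i l) x) - (\<Sum>i\<in>UNIV. formal_deriv None (L i i l) x)
     + (\<Sum>i\<in>UNIV. \<Sum>m\<in>UNIV. L i i m x * C m l x) - (\<Sum>i\<in>UNIV. \<Sum>m\<in>UNIV. C i m x * L m i l x)
     + formal_deriv None (formal_deriv (Some l) f) x - (\<Sum>i\<in>UNIV. C i l x * formal_deriv (Some i) f x)"
  by (simp add: soliton_op_def ricci_def hessian_def sum_option christoffel_components[OF assms]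
      christoffel_components_deriv[OF assms] sum_subtractf sum_negf sum.distrib)
     (simp add: g_def)

lemma E_jk:
  assumes "x \<in> U"
  shows "E (Some j) (Some k) x = formal_deriv None (S j k) x + (\<Sum>i\<in>UNIV. formal_deriv (Some i) (L i j k) x)
     - (\<Sum>i\<in>UNIV. formal_deriv (Some j) (L i i k) x)
     + (\<Sum>i\<in>UNIV. C i i x * S j k x) + (\<Sum>i\<in>UNIV. \<Sum>m\<in>UNIV. L i i m x * L m j k x)
     - (\<Sum>m\<in>UNIV. S j m x * C m k x) - (\<Sum>i\<in>UNIV. C i j x * S i k x) - (\<Sum>i\<in>UNIV. \<Sum>m\<in>UNIV. L i j m x * L m i k x)
     + formal_deriv (Some j) (formal_deriv (Some k) f) x - S j k x * formal_deriv None f x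
     - (\<Sum>i\<in>UNIV. L i j k x * formal_deriv (Some i) f x) + fls_const (1/2) * H x $ j $ k"
  by (simp add: soliton_op_def ricci_def hessian_def sum_option christoffel_components[OF assms]
      christoffel_components_deriv[OF assms] sum_subtractf sum_negf sum.distrib)
     (simp add: g_def)

end

section \<open>Leading coefficients of the soliton equation\<close>

lemma formal_deriv_diff:
  assumes "open U" "x \<in> U" "fls_smooth_on U F" "fls_smooth_on U G"
  shows "formal_deriv a (\<lambda>y. F y - G y) x = formal_deriv a F x - formal_deriv a G x"
proof -
  have "formal_deriv a (\<lambda>y. (F y - G y) + G y) x = formal_deriv a (\<lambda>y. F y - G y) x + formal_deriv a G x"
    by (rule formal_deriv_add[OF assms(1,2) fls_smooth_on_diff[OF assms(1,3,4)] assms(4)])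
  then show ?thesis by simp
qed

lemma fls_ge_formal_deriv:
  assumes "open U" "x \<in> U" "\<And>y. y \<in> U \<Longrightarrow> fls_ge p (F y)" "fls_smooth_on U F"
  shows "fls_ge p (formal_deriv a F x)"
proof (cases a)
  case None
  then show ?thesis using fls_ge_mono[OF fls_ge_formal_deriv_None[of p F x]] assms by simp
next
  case (Some i)
  then show ?thesis using fls_ge_formal_deriv_Some[OF assms] by simp
qed

lemma fls_ge_const_mult: "fls_ge p F \<Longrightarrow> fls_ge p (fls_const c * F :: real fls)"
  by (simp add: fls_ge_def)

lemma fls_ge_Suc: "fls_ge p F \<Longrightarrow> F $$ p = 0 \<Longrightarrow> fls_ge (p + 1) F"
  unfolding fls_ge_def by (metis zless_add1_eq)

lemma fls_ge_diff_add: "fls_ge m (x' - x) \<Longrightarrow> fls_ge m (y' - y) \<Longrightarrow> fls_ge m ((x' + y') - (x + y :: real fls))"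
  by (simp add: fls_ge_def)

lemma fls_ge_diff_diff: "fls_ge m (x' - x) \<Longrightarrow> fls_ge m (y' - y) \<Longrightarrow> fls_ge m ((x' - y') - (x - y :: real fls))"
  by (simp add: fls_ge_def)

lemma fls_ge_diff_sum: "(\<And>i. fls_ge m (F' i - F i)) \<Longrightarrow> fls_ge m ((\<Sum>i\<in>I. F' i) - (\<Sum>i\<in>I. F i :: real fls))"
  unfolding sum_subtractf[symmetric] by (rule fls_ge_sum)

text \<open>The splitting (x' - x) y' + x (y' - y) decides which factors have to be bounded.\<close>

lemma fls_ge_diff_mult:
  fixes x y x' y' :: "real fls"
  assumes "fls_ge p (x' - x)" "fls_ge r y'" "fls_ge s x" "fls_ge t (y' - y)" "m \<le> p + r" "m \<le> s + t"
  shows "fls_ge m (x' * y' - x * y)"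
proof -
  have "x' * y' - x * y = (x' - x) * y' + x * (y' - y)" by (simp add: algebra_simps)
  then show ?thesis using fls_ge_add[OF fls_ge_mult'[OF assms(1,2,5)] fls_ge_mult'[OF assms(3,4,6)]] by simp
qed

lemma fls_ge_diff_formal_deriv:
  assumes "open U" "x \<in> U" "fls_smooth_on U F'" "fls_smooth_on U F" "\<And>y. y \<in> U \<Longrightarrow> fls_ge p (F' y - F y)"
  shows "fls_ge p (formal_deriv a F' x - formal_deriv a F x)"
  unfolding formal_deriv_diff[OF assms(1-4), symmetric]
  by (rule fls_ge_formal_deriv[OF assms(1,2,5) fls_smooth_on_diff[OF assms(1,3,4)]])

lemma fls_ge_diff_formal_deriv_None:
  assumes "fls_ge p (F' x - F x)"
  shows "fls_ge (p + 1) (formal_deriv None F' x - formal_deriv None F x)"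
proof -
  have "formal_deriv None F' x - formal_deriv None F x = formal_deriv None (\<lambda>y. F' y - F y) x"
    by (simp add: formal_deriv.simps algebra_simps)
  then show ?thesis using fls_ge_formal_deriv_None[of p "\<lambda>y. F' y - F y" x] assms by simp
qed

section \<open>Orders and leading coefficients for a conical metric\<close>

context cone_chart
begin

lemma D0H_ge: "x \<in> U \<Longrightarrow> fls_ge (- 1) (formal_deriv None (\<lambda>y. H y $ i $ j) x)"
  using fls_ge_formal_deriv_None[of "- 2" "\<lambda>y. H y $ i $ j" x] H_ge[of x i j] by simp

lemma DH_ge: "x \<in> U \<Longrightarrow> fls_ge (- 2) (formal_deriv a (\<lambda>y. H y $ i $ j) x)"
  by (rule fls_ge_formal_deriv[OF open_U _ H_ge H_smooth])

lemma S_nth: "S j k x $$ m = 1/2 * (of_int (m - 1) * H x $ j $ k $$ (m - 1))"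
  by (simp add: S_def formal_deriv_None_nth)

lemma S_ge: "x \<in> U \<Longrightarrow> fls_ge (- 1) (S j k x)"
  unfolding S_def by (intro fls_ge_const_mult fls_ge_minus D0H_ge)

lemma C_ge: "x \<in> U \<Longrightarrow> fls_ge 1 (C i j x)"
  unfolding C_def by (intro fls_ge_const_mult fls_ge_sum fls_ge_mult'[OF B_ge D0H_ge]) auto

text \<open>For the exact cone the shape operator is 1/r times the identity, and \<open>N\<close>
  contributes only at higher order.\<close>

lemma C_lead:
  assumes "x \<in> U"
  shows "C i j x $$ 1 = (if i = j then 1 else 0)"
proof -
  have "N x $ d $ j $$ (- 2) = 0" for d
    using fls_geD[OF N_ge[OF assms], of "- 2"] by simp
  then have "formal_deriv None (\<lambda>y. H y $ d $ j) x $$ (- 1) = 2 * h x $ d $ j" for d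
    by (simp add: formal_deriv_None_nth H_nth)
  then have "C i j x $$ 1 = (\<Sum>d\<in>UNIV. B x $ i $ d $$ 2 * h x $ d $ j)"
    by (simp add: C_def fls_sum_nth fls_mult_lead[OF B_ge[OF assms] D0H_ge[OF assms]] sum_distrib_left)
  then show ?thesis by (simp add: B_lead[OF assms])
qed

lemma L_ge: "x \<in> U \<Longrightarrow> fls_ge 0 (L i j k x)"
  unfolding L_def
  by (intro fls_ge_const_mult fls_ge_sum fls_ge_mult'[OF B_ge fls_ge_diff[OF fls_ge_add[OF DH_ge DH_ge] DH_ge]]) auto

lemma Dif: "x \<in> U \<Longrightarrow> formal_deriv (Some i) f x = formal_deriv (Some i) \<phi> x"
proof -
  assume x: "x \<in> U"
  have "formal_deriv (Some i) f x = formal_deriv (Some i) (\<lambda>y. fls_const (- 1/4) * fls_X_inv ^ 2 + \<phi> y) x"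
    by (rule formal_deriv_cong[OF open_U x]) (simp add: f_def)
  also have "\<dots> = formal_deriv (Some i) \<phi> x"
    by (subst formal_deriv_add[OF open_U x _ \<phi>_smooth]) (simp_all add: formal_deriv_const)
  finally show ?thesis .
qed

lemma Dif_ge: "x \<in> U \<Longrightarrow> fls_ge 0 (formal_deriv (Some i) f x)"
  unfolding Dif by (rule fls_ge_formal_deriv[OF open_U _ \<phi>_ge \<phi>_smooth])

lemma D0f_ge: "x \<in> U \<Longrightarrow> fls_ge (- 1) (formal_deriv None f x)"
  using fls_ge_formal_deriv_None[of "- 2" f x] f_ge[of x] by simp

lemma D0f_lead:
  assumes "x \<in> U"
  shows "formal_deriv None f x $$ (- 1) = - 1/2" "formal_deriv None f x $$ 0 = 0"
  using fls_geD[OF \<phi>_ge[OF assms], of "- 2"] fls_geD[OF \<phi>_ge[OF assms], of "- 1"]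
  by (simp_all add: formal_deriv_None_nth f_nth)

text \<open>At X^2 the traces of -dC/dr and -C^2 are n and -n. The constant term -1/2 of f'' cancels
  1/2, and a second r-derivative contains neither X nor X^2, because d^2/dr^2 carries the factor (k
  - 1)(k - 2) at X^k.\<close>

lemma E_rr_ge:
  assumes x: "x \<in> U"
  shows "fls_ge 3 (E None None x)"
  unfolding fls_ge_def
proof (intro allI impI)
  fix k :: int assume "k < 3"
  have 1: "fls_ge 2 (formal_deriv None (C i i) x)" for i
    using fls_ge_formal_deriv_None[of 1 "C i i" x] C_ge[OF x] by simp
  have 2: "fls_ge 2 (C i j x * C j i x)" for i j
    by (rule fls_ge_mult'[OF C_ge[OF x] C_ge[OF x]]) simp
  have f0: "\<phi> x $$ (k - 2) = 0" if "k < 2"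
    by (rule fls_geD[OF \<phi>_ge[OF x]]) (use that in simp)
  have 3: "(formal_deriv None (formal_deriv None f) x + fls_const (1/2)) $$ k = 0"
    using \<open>k < 3\<close> f0 by (cases "k = 2"; cases "k = 1"; cases "k = 0") (auto simp: formal_deriv_None_nth f_nth)
  show "E None None x $$ k = 0"
  proof (cases "k < 2")
    case True
    have "fls_ge 2 (- (\<Sum>i\<in>UNIV. formal_deriv None (C i i) x) - (\<Sum>i\<in>UNIV. \<Sum>j\<in>UNIV. C i j x * C j i x))"
      by (intro fls_ge_diff fls_ge_minus fls_ge_sum 1 2)
    from fls_geD[OF this True] 3 show ?thesis by (simp add: E_rr[OF x])
  next
    case False
    then have k: "k = 2" using \<open>k < 3\<close> by simp
    have c1: "formal_deriv None (C i i) x $$ 2 = - 1" for i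
      by (simp add: formal_deriv_None_nth C_lead[OF x])
    have c2: "(C i j x * C j i x) $$ 2 = (if i = j then 1 else 0)" for i j
      by (subst fls_mult_lead[OF C_ge[OF x] C_ge[OF x]]) (simp_all add: C_lead[OF x])
    show ?thesis using 3 unfolding k by (simp add: E_rr[OF x] fls_sum_nth c1 c2)
  qed
qed

text \<open>Only S f' and H/2, which enter with opposite signs, contain positive powers of r. Their
  r^2 terms (-r h)(-r/2) and r^2 h/2 cancel, and neither has a term in r.\<close>

lemma E_jk_ge:
  assumes x: "x \<in> U"
  shows "fls_ge 0 (E (Some j) (Some k) x)"
proof -
  let ?D = "\<lambda>a F. formal_deriv a F x"
  have "fls_ge 0 (formal_deriv None (S j k) x)"
    using fls_ge_formal_deriv_None[of "- 1" "S j k" x] S_ge[OF x] by simp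
  moreover have "fls_ge 0 (formal_deriv (Some i) (L a b c) x)" for i a b c
    by (rule fls_ge_formal_deriv[OF open_U x L_ge L_smooth])
  moreover have "fls_ge 0 (C a b x * S c d x)" "fls_ge 0 (S c d x * C a b x)" for a b c d
    by (rule fls_ge_mult'[OF C_ge[OF x] S_ge[OF x]], simp) (rule fls_ge_mult'[OF S_ge[OF x] C_ge[OF x]], simp)
  moreover have "fls_ge 0 (L a b c x * L d e m x)" for a b c d e m
    by (rule fls_ge_mult'[OF L_ge[OF x] L_ge[OF x]]) simp
  moreover have "fls_ge 0 (formal_deriv (Some j) (formal_deriv (Some k) f) x)"
    by (rule fls_ge_formal_deriv[OF open_U x Dif_ge fls_smooth_on_formal_deriv[OF open_U f_smooth]])
  moreover have "fls_ge 0 (L a b c x * formal_deriv (Some i) f x)" for a b c i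
    by (rule fls_ge_mult'[OF L_ge[OF x] Dif_ge[OF x]]) simp
  ultimately have rest: "fls_ge 0 (E (Some j) (Some k) x + S j k x * formal_deriv None f x - fls_const (1/2) * H x $ j $ k)"
    unfolding E_jk[OF x] by (simp add: algebra_simps) (intro fls_ge_add fls_ge_diff fls_ge_sum; simp)
  have S: "S j k x $$ (- 1) = - h x $ j $ k" "S j k x $$ 0 = 0"
    using fls_geD[OF N_ge[OF x], of "- 2" j k] fls_geD[OF N_ge[OF x], of "- 1" j k] by (simp_all add: S_nth H_nth)
  have "(S j k x * formal_deriv None f x - fls_const (1/2) * H x $ j $ k) $$ m = 0" if "m < 0" for m
  proof -
    have prod: "(S j k x * formal_deriv None f x) $$ m = (\<Sum>i=-1..m+1. S j k x $$ i * formal_deriv None f x $$ (m - i))"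
      using fls_times_nth_ge[OF S_ge[OF x] D0f_ge[OF x]] by simp
    have N0: "N x $ j $ k $$ m = 0" by (rule fls_geD[OF N_ge[OF x] that])
    have "m < - 2 \<or> m = - 2 \<or> m = - 1" using that by presburger
    then consider "m < - 2" | "m = - 2" | "m = - 1" by blast
    then show ?thesis
    proof cases
      case 1
      then show ?thesis using prod N0 by (simp add: H_nth)
    next
      case 2
      then show ?thesis using prod N0 by (simp add: H_nth S D0f_lead[OF x])
    next
      case 3
      have "{- 1..0::int} = {- 1, 0}" by auto
      then show ?thesis using prod N0 3 by (simp add: H_nth S D0f_lead[OF x])
    qed
  qed
  then have "fls_ge 0 (S j k x * formal_deriv None f x - fls_const (1/2) * H x $ j $ k)" by (simp add: fls_ge_def)
  from fls_ge_diff[OF rest this] show ?thesis by simp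
qed

text \<open>An r-derivative never contains X, the leading coefficient of \<open>C\<close> is
  constant along Y, and the two products of \<open>L\<close> and \<open>C\<close> cancel at this
  order. Only the Hessian term with \<open>C\<close> is left.\<close>

lemma E_rl_lead:
  assumes x: "x \<in> U"
  shows "E None (Some l) x $$ 1 = - formal_deriv (Some l) \<phi> x $$ 0"
proof -
  have C1: "formal_deriv (Some i) (C a b) x $$ 1 = 0" for i a b
  proof -
    have "formal_deriv (Some i) (C a b) x $$ 1 = partial_deriv i (\<lambda>y. C a b y $$ 1) x"
      by (rule formal_deriv_Some_nth[OF open_U x C_smooth])
    also have "\<dots> = partial_deriv i (\<lambda>y. if a = b then 1 else 0) x"
      by (rule partial_deriv_cong[OF open_U x]) (rule C_lead)
    finally show ?thesis by (simp add: partial_deriv_const)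
  qed
  have D1: "formal_deriv None F x $$ 1 = 0" for F :: "real^'n \<Rightarrow> real fls" by (simp add: formal_deriv_None_nth)
  have LC: "(L a b c x * C d e x) $$ 1 = L a b c x $$ 0 * (if d = e then 1 else 0)" for a b c d e
    by (subst fls_mult_lead[OF L_ge[OF x] C_ge[OF x]]) (simp_all add: C_lead[OF x])
  have CL: "(C d e x * L a b c x) $$ 1 = (if d = e then 1 else 0) * L a b c x $$ 0" for a b c d e
    by (subst fls_mult_lead[OF C_ge[OF x] L_ge[OF x]]) (simp_all add: C_lead[OF x])
  have CD: "(C d e x * formal_deriv (Some i) \<phi> x) $$ 1 = (if d = e then 1 else 0) * formal_deriv (Some i) \<phi> x $$ 0" for d e i
    by (subst fls_mult_lead[OF C_ge[OF x] Dif_ge[OF x, unfolded Dif[OF x]]]) (simp_all add: C_lead[OF x])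
  show ?thesis
    by (simp add: E_rl[OF x] fls_sum_nth C1 D1 LC CL CD Dif[OF x] if_distrib if_distribR cong: if_cong)
qed

text \<open>Comparing the leading coefficients in \<open>\<partial>\<^sub>r (bianchi l) = \<partial>\<^sub>l (bianchi r)\<close> shows that the first
  nonzero coefficient of the mixed component can only be that of \<open>1/r\<close>.\<close>

lemma E_rl_zero:
  assumes rr: "\<And>x. x \<in> U \<Longrightarrow> E None None x = 0" and jk: "\<And>x j k. x \<in> U \<Longrightarrow> E (Some j) (Some k) x = 0"
    and one: "\<And>x l. x \<in> U \<Longrightarrow> E None (Some l) x $$ 1 = 0"
    and x: "x \<in> U"
  shows "E None (Some l) x = 0"
proof -
  define w where "w l = E None (Some l)" for l
  have w_sm: "fls_smooth_on U (w l)" for l unfolding w_def by (rule soliton_op_smooth[OF f_smooth])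
  have wE: "E (Some l) None x = w l x" if "x \<in> U" for x l
    unfolding w_def by (rule soliton_op_symm[OF that f_smooth])
  have step: "w l x $$ p = 0" if ge: "\<And>x l. x \<in> U \<Longrightarrow> fls_ge p (w l x)" and "p \<noteq> 1" and x: "x \<in> U" for p l x
  proof -
    define T where "T m x = (\<Sum>k\<in>UNIV. w k x * B x $ k $ m)" for m x
    have T_sm: "fls_smooth_on U (T m)" for m
    proof -
      have "T m = (\<lambda>x. \<Sum>k\<in>UNIV. w k x * B x $ k $ m)" by (rule ext) (rule T_def)
      then show ?thesis by (simp only:) (intro fls_smooth_on_sum fls_smooth_on_mult w_sm B_smooth open_U)
    qed
    have T_ge: "fls_ge (p + 2) (T m x)" if "x \<in> U" for m x
      unfolding T_def by (intro fls_ge_sum fls_ge_mult'[OF ge[OF that] B_ge[OF that]]) simp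
    have r: "fraise E None None x = 0" "fraise E None (Some m) x = T m x" "fraise E (Some k) None x = w k x"
      "fraise E (Some k) (Some m) x = 0" if "x \<in> U" for x k m
      by (simp_all add: fraise_def sum_option matrix_inv_g[OF that] rr[OF that] jk[OF that] wE[OF that] T_def) (simp add: w_def)
    have dr: "formal_deriv a (fraise E None None) x = 0" "formal_deriv a (fraise E None (Some m)) x = formal_deriv a (T m) x"
      "formal_deriv a (fraise E (Some k) None) x = formal_deriv a (w k) x" "formal_deriv a (fraise E (Some k) (Some m)) x = 0"
      if "x \<in> U" for x k m a
      using formal_deriv_cong[OF open_U that r(1)] formal_deriv_cong[OF open_U that r(2)]
        formal_deriv_cong[OF open_U that r(3)] formal_deriv_cong[OF open_U that r(4)] by simp_all
    have gr: "fgrad f None x = formal_deriv None f x" "fgrad f (Some k) x = (\<Sum>i\<in>UNIV. B x $ k $ i * formal_deriv (Some i) f x)"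
      if "x \<in> U" for x k
      by (simp_all add: fgrad_def sum_option matrix_inv_g[OF that])
    have gr_ge: "fls_ge 2 (fgrad f (Some k) x)" if "x \<in> U" for x k
      unfolding gr[OF that] by (intro fls_ge_sum fls_ge_mult'[OF B_ge[OF that] Dif_ge[OF that]]) simp
    \<comment> \<open>The raised mixed component \<open>T\<close> has gained two orders from
      \<open>B\<close>, and in the radial divergence every mixed entry of E enters through
      \<open>T\<close>.\<close>
    have div0: "fls_ge (p + 2) (fdiv (fraise E) None x)" if "x \<in> U" for x
    proof -
      have "fdiv (fraise E) None x = (\<Sum>m\<in>UNIV. formal_deriv (Some m) (T m) x) + (\<Sum>i\<in>UNIV. \<Sum>m\<in>UNIV. L i i m x * T m x)"
        by (simp add: fdiv_def sum_option dr[OF that] r[OF that] christoffel_components[OF that])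
      moreover have "fls_ge (p + 2) ((\<Sum>m\<in>UNIV. formal_deriv (Some m) (T m) x) + (\<Sum>i\<in>UNIV. \<Sum>m\<in>UNIV. L i i m x * T m x))"
        by (intro fls_ge_add fls_ge_sum fls_ge_formal_deriv[OF open_U that T_ge T_sm] fls_ge_mult'[OF L_ge[OF that] T_ge[OF that]]) simp_all
      ultimately show ?thesis by simp
    qed
    have b0: "fls_ge (p + 2) (bianchi f None x)" if "x \<in> U" for x
    proof -
      have "fls_ge (p + 2) (w m x * fgrad f (Some m) x)" for m
        by (rule fls_ge_mult'[OF ge[OF that] gr_ge[OF that]]) simp
      moreover have "bianchi f None x = (fdiv (fraise E) None x + fdiv (fraise E) None x)
          - (\<Sum>m\<in>UNIV. w m x * fgrad f (Some m) x) - (\<Sum>m\<in>UNIV. w m x * fgrad f (Some m) x)"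
        by (simp add: bianchi_def sum_option rr[OF that] w_def)
      ultimately show ?thesis
        by (simp only:) (intro fls_ge_diff fls_ge_add fls_ge_sum div0[OF that])
    qed
    \<comment> \<open>The term -r/2 of f' lowers the order: -2 \<open>w\<close> f' contributes
      exactly \<open>w\<close> at X^(p-1), whereas the divergence begins at X^(p+1).\<close>
    have bl: "bianchi f (Some l) x $$ (p - 1) = w l x $$ p" "fls_ge (p - 1) (bianchi f (Some l) x)" if "x \<in> U" for x l
    proof -
      have dl: "fdiv (fraise E) (Some l) x = formal_deriv None (w l) x + (\<Sum>i\<in>UNIV. C i i x * w l x) - (\<Sum>m\<in>UNIV. S l m x * T m x) - (\<Sum>k\<in>UNIV. C k l x * w k x)"
        by (simp add: fdiv_def sum_option dr[OF that] r[OF that] christoffel_components[OF that] sum.distrib)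
      have dl_ge: "fls_ge (p + 1) (fdiv (fraise E) (Some l) x)"
        unfolding dl by (intro fls_ge_diff fls_ge_add fls_ge_sum fls_ge_formal_deriv_None ge[OF that]
          fls_ge_mult'[OF C_ge[OF that] ge[OF that]] fls_ge_mult'[OF S_ge[OF that] T_ge[OF that]]) simp_all
      have b: "bianchi f (Some l) x = (fdiv (fraise E) (Some l) x + fdiv (fraise E) (Some l) x) - w l x * formal_deriv None f x - w l x * formal_deriv None f x"
        unfolding bianchi_def by (simp add: sum_option jk[OF that] wE[OF that] gr[OF that])
      have wf: "fls_ge (p - 1) (w l x * formal_deriv None f x)"
        by (rule fls_ge_mult'[OF ge[OF that] D0f_ge[OF that]]) simp
      have wf1: "(w l x * formal_deriv None f x) $$ (p - 1) = - (w l x $$ p) / 2"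
        by (subst fls_mult_lead[OF ge[OF that] D0f_ge[OF that]]) (simp_all add: D0f_lead[OF that])
      show "bianchi f (Some l) x $$ (p - 1) = w l x $$ p"
        unfolding b using fls_geD[OF dl_ge, of "p - 1"] by (simp add: wf1)
      show "fls_ge (p - 1) (bianchi f (Some l) x)"
        unfolding b by (intro fls_ge_diff fls_ge_add wf fls_ge_mono[OF dl_ge]) simp_all
    qed
    \<comment> \<open>By closedness this is a tangential derivative of the radial component, which
      begins at X^(p+2). Directly, d/dr turns X^(p-1) into -(p - 1) X^p.\<close>
    have "formal_deriv None (bianchi f (Some l)) x $$ p = 0"
      unfolding bianchi_closed[OF x f_smooth, of None]
      by (rule fls_geD[OF fls_ge_formal_deriv[OF open_U x b0 bianchi_smooth[OF f_smooth]]]) simp_all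
    then have "of_int (p - 1) * w l x $$ p = 0"
      unfolding formal_deriv_None_nth bl(1)[OF x] by simp
    then show ?thesis using \<open>p \<noteq> 1\<close> by (simp only: mult_eq_0_iff of_int_eq_0_iff) simp
  qed
  \<comment> \<open>There are finitely many components, so one bound on the poles serves all of
    them.\<close>
  have "\<exists>M. \<forall>l x. x \<in> U \<longrightarrow> fls_ge M (w l x)"
  proof -
    have "\<forall>l. \<exists>M. \<forall>x\<in>U. fls_ge M (w l x)" using w_sm unfolding fls_smooth_on_def by blast
    then obtain M where M: "\<And>l x. x \<in> U \<Longrightarrow> fls_ge (M l) (w l x)" by metis
    have "fls_ge (Min (range M)) (w l x)" if "x \<in> U" for l x
      by (rule fls_ge_mono[OF M[OF that]]) simp
    then show ?thesis by blast
  qed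
  then obtain M where M: "\<And>l x. x \<in> U \<Longrightarrow> fls_ge M (w l x)" by blast
  \<comment> \<open>The order is raised one step at a time for all components at once; the step at
    order 1 is supplied by the assumption \<open>one\<close>.\<close>
  have "fls_ge (M + int n) (w l x)" if "x \<in> U" for n l x
    using that
  proof (induction n arbitrary: l x)
    case 0
    then show ?case using M by simp
  next
    case (Suc n)
    have "w l x $$ (M + int n) = 0"
    proof (cases "M + int n = 1")
      case True
      then show ?thesis using one[OF Suc.prems] by (simp add: w_def)
    next
      case False
      show ?thesis by (rule step[OF Suc.IH False Suc.prems])
    qed
    from fls_ge_Suc[OF Suc.IH[OF Suc.prems] this] show ?case by (simp add: algebra_simps)
  qed
  note ge = this
  have "w l x $$ k = 0" for k
  proof (rule fls_geD[OF ge[OF x]])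
    show "k < M + int (nat (k - M + 1))" by simp
  qed
  then show ?thesis unfolding w_def[symmetric] by (intro fls_eqI) simp
qed

end

text \<open>Two sets of data whose metrics agree up to order \<open>q\<close> and whose potentials agree up to order \<open>m\<close>.
  The case \<open>m = q\<close> isolates the next coefficient of the potential in the \<open>rr\<close> component, and \<open>m = q + 1\<close>
  that of the metric in the components tangential to \<open>Y\<close>.\<close>

locale cone_pair = a: cone_chart U h N \<phi> + b: cone_chart U h N' \<phi>'
  for U :: "(real^'n::finite) set" and h :: "real^'n \<Rightarrow> real^'n^'n" and N N' :: "real^'n \<Rightarrow> real fls^'n^'n"
    and \<phi> \<phi>' :: "real^'n \<Rightarrow> real fls" +
  fixes q m :: int
  assumes q0: "0 \<le> q" and qm: "q \<le> m" "m \<le> q + 1"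
    and dN: "x \<in> U \<Longrightarrow> fls_ge q (N' x $ i $ j - N x $ i $ j)"
    and d\<phi>: "x \<in> U \<Longrightarrow> fls_ge m (\<phi>' x - \<phi> x)"
begin

lemma dH_eq: "b.H x $ i $ j - a.H x $ i $ j = N' x $ i $ j - N x $ i $ j"
  by (simp add: a.H_def b.H_def)

lemma dH: "x \<in> U \<Longrightarrow> fls_ge q (b.H x $ i $ j - a.H x $ i $ j)"
  unfolding dH_eq by (rule dN)

lemma df: "x \<in> U \<Longrightarrow> fls_ge m (b.f x - a.f x)"
  using d\<phi>[of x] by (simp add: a.f_def b.f_def)

text \<open>B' - B = -B (H' - H) B', and each of the two inverses contributes order 2.\<close>

lemma dB:
  assumes x: "x \<in> U"
  shows "fls_ge (q + 4) (b.B x $ i $ j - a.B x $ i $ j)"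
proof -
  have "b.B x - a.B x = - (a.B x ** (b.H x - a.H x) ** b.B x)"
  proof -
    have "a.B x ** (b.H x - a.H x) ** b.B x = a.B x ** (b.H x ** b.B x) - (a.B x ** a.H x) ** b.B x"
      by (simp add: matrix_diff_ldistrib matrix_diff_rdistrib matrix_mul_assoc)
    then show ?thesis by (simp add: a.B_H[OF x] b.H_B[OF x])
  qed
  from arg_cong[OF this, of "\<lambda>M. M $ i $ j"]
  have "b.B x $ i $ j - a.B x $ i $ j = - ((a.B x ** (b.H x - a.H x) ** b.B x) $ i $ j)"
    by (simp only: vector_minus_component vector_uminus_component)
  moreover have "fls_ge (q + 4) ((a.B x ** (b.H x - a.H x) ** b.B x) $ i $ j)"
  proof -
    have "fls_ge (q + 2) (a.B x $ i $ c * (b.H x $ c $ d - a.H x $ c $ d))" for c d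
      by (rule fls_ge_mult'[OF a.B_ge[OF x] dH[OF x]]) simp
    then have 2: "fls_ge (q + 2) ((a.B x ** (b.H x - a.H x)) $ i $ d)" for d
      unfolding matrix_mult_nth by (intro fls_ge_sum) simp
    show ?thesis
      unfolding matrix_mult_nth[of "_ ** _"] by (intro fls_ge_sum fls_ge_mult'[OF 2 b.B_ge[OF x]]) simp_all
  qed
  ultimately show ?thesis using fls_ge_minus by metis
qed

lemma dDH: "x \<in> U \<Longrightarrow> fls_ge q (formal_deriv c (\<lambda>y. b.H y $ i $ j) x - formal_deriv c (\<lambda>y. a.H y $ i $ j) x)"
  by (rule fls_ge_diff_formal_deriv[OF a.open_U _ b.H_smooth a.H_smooth dH])

lemma dD0H: "x \<in> U \<Longrightarrow> fls_ge (q + 1) (formal_deriv None (\<lambda>y. b.H y $ i $ j) x - formal_deriv None (\<lambda>y. a.H y $ i $ j) x)"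
  by (rule fls_ge_diff_formal_deriv_None) (rule dH)

lemma dS: "x \<in> U \<Longrightarrow> fls_ge (q + 1) (b.S j k x - a.S j k x)"
  using dD0H[of x j k] unfolding fls_ge_def a.S_def b.S_def by simp

lemma dS_lead: "(b.S j k x - a.S j k x) $$ (q + 1) = 1/2 * (of_int q * (N' x $ j $ k - N x $ j $ k) $$ q)"
  unfolding dH_eq[symmetric] by (simp add: a.S_nth b.S_nth algebra_simps)

lemma dC: "x \<in> U \<Longrightarrow> fls_ge (q + 3) (b.C i j x - a.C i j x)"
  unfolding a.C_def b.C_def right_diff_distrib[symmetric]
  by (intro fls_ge_const_mult fls_ge_diff_sum fls_ge_diff_mult[OF dB b.D0H_ge a.B_ge dD0H]) simp_all

lemma dL: "x \<in> U \<Longrightarrow> fls_ge (q + 2) (b.L i j k x - a.L i j k x)"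
  unfolding a.L_def b.L_def right_diff_distrib[symmetric]
  by (intro fls_ge_const_mult fls_ge_diff_sum fls_ge_diff_mult[OF dB fls_ge_diff[OF fls_ge_add[OF b.DH_ge b.DH_ge] b.DH_ge] a.B_ge
        fls_ge_diff_diff[OF fls_ge_diff_add[OF dDH dDH] dDH]]) simp_all

lemma dDf: "x \<in> U \<Longrightarrow> fls_ge m (formal_deriv c b.f x - formal_deriv c a.f x)"
  by (rule fls_ge_diff_formal_deriv[OF a.open_U _ b.f_smooth a.f_smooth df])

lemma dD0f: "x \<in> U \<Longrightarrow> fls_ge (m + 1) (formal_deriv None b.f x - formal_deriv None a.f x)"
  by (rule fls_ge_diff_formal_deriv_None) (rule df)

text \<open>Apart from f'' only \<open>C\<close> depends on the data, and its difference has gained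
  three orders. Hence at X^(q+2) the difference of E_rr comes from f'' alone.\<close>

lemma dE_rr_rest:
  assumes x: "x \<in> U"
  shows "fls_ge (q + 3) ((b.E None None x - formal_deriv None (formal_deriv None b.f) x) - (a.E None None x - formal_deriv None (formal_deriv None a.f) x))"
proof -
  have eq: "E - D = s1 - s2 + c" if "E = s1 - s2 + D + c" for E D s1 s2 c :: "real fls" using that by simp
  have 1: "fls_ge (q + 3) (- (\<Sum>i\<in>UNIV. formal_deriv None (b.C i i) x) - - (\<Sum>i\<in>UNIV. formal_deriv None (a.C i i) x))"
  proof -
    have "fls_ge (q + 3) ((\<Sum>i\<in>UNIV. formal_deriv None (b.C i i) x) - (\<Sum>i\<in>UNIV. formal_deriv None (a.C i i) x))"
      by (intro fls_ge_diff_sum fls_ge_diff_formal_deriv[OF a.open_U x b.C_smooth a.C_smooth dC])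
    from fls_ge_minus[OF this] show ?thesis by simp
  qed
  show ?thesis
    unfolding eq[OF a.E_rr[OF x]] eq[OF b.E_rr[OF x]]
    by (intro fls_ge_diff_add fls_ge_diff_diff 1 fls_ge_diff_sum
        fls_ge_diff_mult[OF dC[OF x] b.C_ge[OF x] a.C_ge[OF x] dC[OF x]]) (use q0 in simp_all)
qed

lemma dE_rr_lead:
  assumes x: "x \<in> U"
  shows "b.E None None x $$ (q + 2) - a.E None None x $$ (q + 2) = of_int (q * (q + 1)) * (\<phi>' x - \<phi> x) $$ q"
proof -
  have "formal_deriv None (formal_deriv None b.f) x $$ (q + 2) - formal_deriv None (formal_deriv None a.f) x $$ (q + 2)
    = of_int (q * (q + 1)) * (\<phi>' x - \<phi> x) $$ q"
    by (simp add: formal_deriv_None_nth a.f_def b.f_def algebra_simps)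
  then show ?thesis using fls_geD[OF dE_rr_rest[OF x], of "q + 2"] by simp
qed

lemma dE_rr:
  assumes x: "x \<in> U"
  shows "fls_ge (m + 2) (b.E None None x - a.E None None x)"
proof -
  have "fls_ge (m + 1 + 1) (formal_deriv None (formal_deriv None b.f) x - formal_deriv None (formal_deriv None a.f) x)"
    by (rule fls_ge_diff_formal_deriv_None) (rule dD0f[OF x])
  then have "fls_ge (m + 2) (formal_deriv None (formal_deriv None b.f) x - formal_deriv None (formal_deriv None a.f) x)"
    by (rule fls_ge_mono) simp
  moreover have "fls_ge (m + 2) ((b.E None None x - formal_deriv None (formal_deriv None b.f) x) - (a.E None None x - formal_deriv None (formal_deriv None a.f) x))"
    by (rule fls_ge_mono[OF dE_rr_rest[OF x]]) (use qm in simp)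
  ultimately show ?thesis using fls_ge_add by fastforce
qed

text \<open>The terms S f' and H/2, in which the growing factors leave the difference at order
  \<open>q\<close>, are set aside.\<close>

lemma dE_jk_rest:
  assumes x: "x \<in> U"
  shows "fls_ge m ((b.E (Some j) (Some k) x + b.S j k x * formal_deriv None b.f x - fls_const (1/2) * b.H x $ j $ k)
    - (a.E (Some j) (Some k) x + a.S j k x * formal_deriv None a.f x - fls_const (1/2) * a.H x $ j $ k))"
proof -
  have eq: "E + D - c = s - t" if "E = s - D - t + c" for E D s t c :: "real fls" using that by simp
  have dS': "fls_ge m (formal_deriv None (b.S j k) x - formal_deriv None (a.S j k) x)"
    by (rule fls_ge_mono[OF fls_ge_diff_formal_deriv_None[of "q + 1" "b.S j k" x "a.S j k", OF dS[OF x]]]) (use qm in simp)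
  have dL': "fls_ge m (formal_deriv c (b.L i j k) x - formal_deriv c (a.L i j k) x)" for c i j k
    by (rule fls_ge_mono[OF fls_ge_diff_formal_deriv[OF a.open_U x b.L_smooth a.L_smooth dL]]) (use qm in simp_all)
  have CS: "fls_ge m (b.C i j x * b.S k l x - a.C i j x * a.S k l x)" for i j k l
    by (rule fls_ge_diff_mult[OF dC[OF x] b.S_ge[OF x] a.C_ge[OF x] dS[OF x]]) (use qm in simp_all)
  have SC: "fls_ge m (b.S k l x * b.C i j x - a.S k l x * a.C i j x)" for i j k l
    by (rule fls_ge_diff_mult[OF dS[OF x] b.C_ge[OF x] a.S_ge[OF x] dC[OF x]]) (use qm in simp_all)
  have LL: "fls_ge m (b.L i j k x * b.L c d e x - a.L i j k x * a.L c d e x)" for i j k c d e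
    by (rule fls_ge_diff_mult[OF dL[OF x] b.L_ge[OF x] a.L_ge[OF x] dL[OF x]]) (use qm in simp_all)
  have LD: "fls_ge m (b.L i j k x * formal_deriv (Some c) b.f x - a.L i j k x * formal_deriv (Some c) a.f x)" for i j k c
    by (rule fls_ge_diff_mult[OF dL[OF x] b.Dif_ge[OF x] a.L_ge[OF x] dDf[OF x]]) (use qm in simp_all)
  have DD: "fls_ge m (formal_deriv (Some j) (formal_deriv (Some k) b.f) x - formal_deriv (Some j) (formal_deriv (Some k) a.f) x)"
    by (rule fls_ge_diff_formal_deriv[OF a.open_U x fls_smooth_on_formal_deriv[OF a.open_U b.f_smooth]
          fls_smooth_on_formal_deriv[OF a.open_U a.f_smooth] dDf])
  show ?thesis
    unfolding eq[OF a.E_jk[OF x]] eq[OF b.E_jk[OF x]]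
    by (intro fls_ge_diff_add fls_ge_diff_diff fls_ge_diff_sum dS' dL' CS SC LL LD DD)
qed

lemma dE_jk:
  assumes x: "x \<in> U"
  shows "fls_ge q (b.E (Some j) (Some k) x - a.E (Some j) (Some k) x)"
proof -
  have 1: "fls_ge q (b.S j k x * formal_deriv None b.f x - a.S j k x * formal_deriv None a.f x)"
    by (rule fls_ge_diff_mult[OF dS[OF x] b.D0f_ge[OF x] a.S_ge[OF x] dD0f[OF x]]) (use qm in simp_all)
  have 2: "fls_ge q (fls_const (1/2) * b.H x $ j $ k - fls_const (1/2) * a.H x $ j $ k)"
    unfolding right_diff_distrib[symmetric] by (rule fls_ge_const_mult[OF dH[OF x]])
  from fls_ge_diff[OF fls_ge_add[OF fls_ge_mono[OF dE_jk_rest[OF x, of j k] qm(1)] 2] 1]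
  show ?thesis by (simp add: algebra_simps)
qed

text \<open>The difference of -S f' contributes -(q/2)(-1/2) = q/4 and that of H/2 contributes 1/2.
  With m = q + 1 the change of f', although multiplied by S of size r, appears only beyond order
  \<open>q\<close>.\<close>

lemma dE_jk_lead:
  assumes x: "x \<in> U" and "m = q + 1"
  shows "b.E (Some j) (Some k) x $$ q - a.E (Some j) (Some k) x $$ q = of_int (q + 2) / 4 * (N' x $ j $ k - N x $ j $ k) $$ q"
proof -
  let ?D = "\<lambda>f. formal_deriv None f x"
  have "b.S j k x * ?D b.f - a.S j k x * ?D a.f = (b.S j k x - a.S j k x) * ?D b.f + a.S j k x * (?D b.f - ?D a.f)"
    by (simp add: algebra_simps)
  moreover have "((b.S j k x - a.S j k x) * ?D b.f) $$ q = (b.S j k x - a.S j k x) $$ (q + 1) * ?D b.f $$ (- 1)"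
    by (rule fls_mult_lead[OF dS[OF x] b.D0f_ge[OF x]]) simp
  moreover have "(a.S j k x * (?D b.f - ?D a.f)) $$ q = 0"
    by (rule fls_geD[OF fls_ge_mult[OF a.S_ge[OF x] dD0f[OF x]]]) (use assms(2) in simp)
  ultimately have SD: "(b.S j k x * ?D b.f) $$ q - (a.S j k x * ?D a.f) $$ q = - (1/4) * (of_int q * (N' x $ j $ k - N x $ j $ k) $$ q)"
    unfolding fls_minus_nth[symmetric] by (simp only: fls_plus_nth dS_lead b.D0f_lead[OF x]) 
  have H: "(b.H x $ j $ k) $$ q - (a.H x $ j $ k) $$ q = (N' x $ j $ k - N x $ j $ k) $$ q"
    unfolding dH_eq[symmetric] by simp
  have "(b.E (Some j) (Some k) x $$ q + (b.S j k x * ?D b.f) $$ q - 1/2 * b.H x $ j $ k $$ q)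
    - (a.E (Some j) (Some k) x $$ q + (a.S j k x * ?D a.f) $$ q - 1/2 * a.H x $ j $ k $$ q) = 0"
    using fls_geD[OF dE_jk_rest[OF x, of j k], of q] assms(2) by simp
  then have "b.E (Some j) (Some k) x $$ q - a.E (Some j) (Some k) x $$ q
     = - ((b.S j k x * ?D b.f) $$ q - (a.S j k x * ?D a.f) $$ q) + 1/2 * ((b.H x $ j $ k) $$ q - (a.H x $ j $ k) $$ q)"
    by (simp add: algebra_simps)
  then show ?thesis unfolding SD H by (simp add: field_simps)
qed

end

section \<open>Formal solitons on a manifold\<close>

definition tensor_series :: "(nat \<Rightarrow> ('a, 'n::finite) tensor2) \<Rightarrow> ('a, 'n) chart \<Rightarrow> real^'n \<Rightarrow> real fls^'n^'n" where
  "tensor_series hs c x = (\<chi> i j. even_series (\<lambda>k. hs k c x $ i $ j))"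

definition function_series :: "(nat \<Rightarrow> 'a \<Rightarrow> real) \<Rightarrow> ('a, 'n::finite) chart \<Rightarrow> real^'n \<Rightarrow> real fls" where
  "function_series fs c x = even_series (\<lambda>k. fs k (chart_inv c x))"

definition chart_op ::
    "('a, 'n::finite) tensor2 \<Rightarrow> (nat \<Rightarrow> ('a, 'n) tensor2) \<Rightarrow> (nat \<Rightarrow> 'a \<Rightarrow> real) \<Rightarrow> ('a, 'n) chart \<Rightarrow>
     'n option \<Rightarrow> 'n option \<Rightarrow> real^'n \<Rightarrow> real fls" where
  "chart_op h hs fs c a b x = ricci (soliton_metric h hs c) a b x
     + hessian (soliton_metric h hs c) (soliton_potential fs c) a b x + fls_const (1/2) * soliton_metric h hs c x $ a $ b"

definition series_data :: "('a, 'n::finite) chart set \<Rightarrow> (nat \<Rightarrow> ('a, 'n) tensor2) \<Rightarrow> (nat \<Rightarrow> 'a \<Rightarrow> real) \<Rightarrow> bool" where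
  "series_data A hs fs \<longleftrightarrow> (\<forall>i. sym_tensor_field A (hs i)) \<and> (\<forall>i. smooth_function A (fs i))"

lemma formal_expanding_soliton_iff:
  "formal_expanding_soliton A h hs fs \<longleftrightarrow>
     series_data A hs fs \<and> (\<forall>c\<in>A. \<forall>x\<in>chart_image c. \<forall>a b. chart_op h hs fs c a b x = 0)"
proof -
  have "fls_const (- 1/2) = - fls_const (1/2 :: real)" by (rule fls_eqI) simp
  then have "u = fls_const (- 1/2) * v \<longleftrightarrow> u + fls_const (1/2) * v = 0" for u v :: "real fls"
    by (simp add: eq_neg_iff_add_eq_0)
  then show ?thesis by (simp add: formal_expanding_soliton_def series_data_def chart_op_def)
qed

lemma ricci_cong:
  assumes "open U" "x \<in> U" "\<And>y. y \<in> U \<Longrightarrow> g y = g' y"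
  shows "ricci g b c x = ricci g' b c x"
proof -
  have chr: "christoffel g a b c y = christoffel g' a b c y" if y: "y \<in> U" for a b c y
  proof -
    have "formal_deriv e (\<lambda>z. g z $ i $ j) y = formal_deriv e (\<lambda>z. g' z $ i $ j) y" for e i j
      by (rule formal_deriv_cong[OF assms(1) y]) (simp add: assms(3))
    then show ?thesis by (simp add: christoffel_def assms(3)[OF y])
  qed
  have "formal_deriv e (christoffel g a b c) x = formal_deriv e (christoffel g' a b c) x" for e a b c
    by (rule formal_deriv_cong[OF assms(1,2) chr])
  then show ?thesis by (simp add: ricci_def chr[OF assms(2)])
qed

lemma hessian_cong:
  assumes "open U" "x \<in> U" "\<And>y. y \<in> U \<Longrightarrow> g y = g' y"
    "\<And>y a. y \<in> U \<Longrightarrow> formal_deriv a f y = formal_deriv a f' y"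
  shows "hessian g f b c x = hessian g' f' b c x"
proof -
  have chr: "christoffel g a b c x = christoffel g' a b c x" for a b c
  proof -
    have "formal_deriv e (\<lambda>z. g z $ i $ j) x = formal_deriv e (\<lambda>z. g' z $ i $ j) x" for e i j
      by (rule formal_deriv_cong[OF assms(1,2)]) (simp add: assms(3))
    then show ?thesis by (simp add: christoffel_def assms(3)[OF assms(2)])
  qed
  have "formal_deriv e (formal_deriv a f) x = formal_deriv e (formal_deriv a f') x" for e a
    by (rule formal_deriv_cong[OF assms(1,2) assms(4)])
  then show ?thesis by (simp add: hessian_def chr assms(4)[OF assms(2)])
qed

lemma smooth_formal_metric_subset:
  assumes "smooth_formal_metric U g" "V \<subseteq> U" "open V"
  shows "smooth_formal_metric V g"
proof -
  interpret smooth_formal_metric U g by fact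
  show ?thesis
    by unfold_locales
      (use assms(2,3) g_gi gi_g g_symm in \<open>auto intro: fls_smooth_on_subset[OF g_smooth] fls_smooth_on_subset[OF gi_smooth]\<close>)
qed

section \<open>Charts and tensor fields\<close>

locale riemannian_manifold =
  fixes X :: "'a topology" and A :: "('a, 'n::finite) chart set" and h :: "('a, 'n) tensor2"
  assumes mfd: "smooth_manifold X A" and metric: "riemannian_metric A h"
begin

lemma chart:
  assumes "c \<in> A"
  shows open_image: "open (chart_image c)"
    and open_dom: "openin X (chart_dom c)"
    and homeo: "homeomorphic_map (subtopology X (chart_dom c)) (top_of_set (chart_image c)) (chart_map c)"
    and dom_topspace: "chart_dom c \<subseteq> topspace X"
    and inj: "inj_on (chart_map c) (chart_dom c)"
proof -
  show 1: "open (chart_image c)" "openin X (chart_dom c)"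
    "homeomorphic_map (subtopology X (chart_dom c)) (top_of_set (chart_image c)) (chart_map c)"
    using mfd assms by (auto simp: smooth_manifold_def)
  show 2: "chart_dom c \<subseteq> topspace X" using 1(2) by (rule openin_subset)
  then have "topspace (subtopology X (chart_dom c)) = chart_dom c" by auto
  then show "inj_on (chart_map c) (chart_dom c)"
    using homeomorphic_imp_injective_map[OF 1(3)] by simp
qed

lemma covered: "p \<in> topspace X \<Longrightarrow> \<exists>c\<in>A. p \<in> chart_dom c"
  using mfd by (auto simp: smooth_manifold_def)

lemma chart_inv_map: "c \<in> A \<Longrightarrow> p \<in> chart_dom c \<Longrightarrow> chart_inv c (chart_map c p) = p"
  by (simp add: chart_inv_def inj)

lemma chart_map_inv: "x \<in> chart_image c \<Longrightarrow> chart_map c (chart_inv c x) = x"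
  by (simp add: chart_inv_def chart_image_def f_inv_into_f)

lemma chart_inv_dom: "x \<in> chart_image c \<Longrightarrow> chart_inv c x \<in> chart_dom c"
  by (simp add: chart_inv_def chart_image_def inv_into_into)

lemma chart_map_image: "p \<in> chart_dom c \<Longrightarrow> chart_map c p \<in> chart_image c"
  by (simp add: chart_image_def)

lemma tensor_smooth: "sym_tensor_field A T \<Longrightarrow> c \<in> A \<Longrightarrow> smooth_on (chart_image c) (\<lambda>x. T c x $ i $ j)"
proof -
  assume "sym_tensor_field A T" "c \<in> A"
  then have "smooth_on (chart_image c) (T c)" by (simp add: sym_tensor_field_def)
  note o = open_image[OF \<open>c \<in> A\<close>]
  show ?thesis
    by (rule smooth_on_linear[OF o bounded_linear_vec_nth smooth_on_linear[OF o bounded_linear_vec_nth]]) fact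
qed

lemma tensor_sym: "sym_tensor_field A T \<Longrightarrow> c \<in> A \<Longrightarrow> x \<in> chart_image c \<Longrightarrow> T c x $ i $ j = T c x $ j $ i"
  unfolding sym_tensor_field_def by blast

lemma tensor_trans: "sym_tensor_field A T \<Longrightarrow> c \<in> A \<Longrightarrow> d \<in> A \<Longrightarrow> p \<in> chart_dom c \<inter> chart_dom d \<Longrightarrow>
   T d (chart_map d p) $ a $ b = (\<Sum>i\<in>UNIV. \<Sum>j\<in>UNIV. T c (chart_map c p) $ i $ j *
             partial_deriv a (transition c d) (chart_map d p) $ i *
             partial_deriv b (transition c d) (chart_map d p) $ j)"
  unfolding sym_tensor_field_def by blast

lemma h_tensor: "sym_tensor_field A h"
  using metric by (simp add: riemannian_metric_def)

lemma h_det: "c \<in> A \<Longrightarrow> x \<in> chart_image c \<Longrightarrow> det (h c x) \<noteq> 0"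
proof -
  assume c: "c \<in> A" "x \<in> chart_image c"
  have "v = 0" if "h c x *v v = 0" for v
    using metric c that unfolding riemannian_metric_def by (metis inner_zero_right less_irrefl)
  then have "invertible (h c x)"
    unfolding invertible_left_inverse matrix_left_invertible_ker by blast
  then show "det (h c x) \<noteq> 0" by (simp add: invertible_det_nz)
qed

lemma data_h: "series_data A hs fs \<Longrightarrow> sym_tensor_field A (hs i)"
  and data_f: "series_data A hs fs \<Longrightarrow> smooth_function A (fs i)"
  by (simp_all add: series_data_def)

lemma function_smooth: "smooth_function A u \<Longrightarrow> c \<in> A \<Longrightarrow> smooth_on (chart_image c) (\<lambda>x. u (chart_inv c x))"
  by (auto simp: smooth_function_def o_def)

lemma cone_chart:
  assumes "series_data A hs fs" "c \<in> A"
  shows "cone_chart (chart_image c) (h c) (tensor_series hs c) (function_series fs c)"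
proof
  show "fls_smooth_on (chart_image c) (\<lambda>x. tensor_series hs c x $ i $ j)" for i j
    by (simp add: tensor_series_def) (intro fls_smooth_on_even_series tensor_smooth data_h[OF assms(1)] assms)
  have "fls_smooth_on (chart_image c) (\<lambda>x. even_series (\<lambda>k. fs k (chart_inv c x)))"
    by (intro fls_smooth_on_even_series function_smooth data_f[OF assms(1)] assms)
  then show "fls_smooth_on (chart_image c) (function_series fs c)"
    by (simp add: function_series_def[abs_def])
  fix x i j assume x: "x \<in> chart_image c"
  show "tensor_series hs c x $ i $ j = tensor_series hs c x $ j $ i"
    using tensor_sym[OF data_h[OF assms(1)] assms(2) x, of _ i j] by (simp add: tensor_series_def)
  show "h c x $ i $ j = h c x $ j $ i" by (rule tensor_sym[OF h_tensor assms(2) x])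
  show "det (h c x) \<noteq> 0" by (rule h_det[OF assms(2) x])
qed (simp_all add: open_image assms tensor_smooth h_tensor tensor_series_def function_series_def)

lemma soliton_metric_eq:
  assumes "cone_chart U (h c) (tensor_series hs c) u"
  shows "cone_chart.g (h c) (tensor_series hs c) = soliton_metric h hs c"
proof
  interpret cone_chart U "h c" "tensor_series hs c" u by fact
  fix x
  show "g x = soliton_metric h hs c x"
    by (simp add: vec_eq_iff split_option_all g_def soliton_metric_def H_def tensor_series_def)
qed

lemma soliton_potential_eq:
  assumes "cone_chart U (h c) N (function_series fs c)"
  shows "cone_chart.f (function_series fs c) = soliton_potential fs c"
proof
  interpret cone_chart U "h c" N "function_series fs c" by fact
  fix x
  show "f x = soliton_potential fs c x"
    by (simp add: f_def soliton_potential_def function_series_def)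
qed

lemma chart_op_eq:
  assumes "series_data A hs fs" "c \<in> A"
  shows "smooth_formal_metric.soliton_op (cone_chart.g (h c) (tensor_series hs c)) (cone_chart.f (function_series fs c)) = chart_op h hs fs c"
proof -
  interpret cone_chart "chart_image c" "h c" "tensor_series hs c" "function_series fs c" by (rule cone_chart[OF assms])
  show ?thesis
    by (intro ext) (simp only: soliton_op_def chart_op_def flip: soliton_metric_eq[OF cone_chart_axioms] soliton_potential_eq[OF cone_chart_axioms])
qed

lemma smooth_metric:
  assumes "series_data A hs fs" "c \<in> A"
  shows "smooth_formal_metric (chart_image c) (soliton_metric h hs c)"
    and "fls_smooth_on (chart_image c) (soliton_potential fs c)"
proof -
  interpret cone_chart "chart_image c" "h c" "tensor_series hs c" "function_series fs c" by (rule cone_chart[OF assms])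
  show "smooth_formal_metric (chart_image c) (soliton_metric h hs c)"
    using smooth_formal_metric_axioms by (simp add: soliton_metric_eq[OF cone_chart_axioms])
  show "fls_smooth_on (chart_image c) (soliton_potential fs c)"
    using f_smooth by (simp add: soliton_potential_eq[OF cone_chart_axioms])
qed

lemma chart_op_smooth:
  assumes "series_data A hs fs" "c \<in> A"
  shows "fls_smooth_on (chart_image c) (chart_op h hs fs c a b)"
proof -
  interpret cone_chart "chart_image c" "h c" "tensor_series hs c" "function_series fs c" by (rule cone_chart[OF assms])
  show ?thesis using soliton_op_smooth[OF f_smooth] by (simp add: chart_op_eq[OF assms])
qed

lemma chart_op_sym:
  assumes "series_data A hs fs" "c \<in> A" "x \<in> chart_image c"
  shows "chart_op h hs fs c a b x = chart_op h hs fs c b a x"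
proof -
  interpret cone_chart "chart_image c" "h c" "tensor_series hs c" "function_series fs c" by (rule cone_chart[OF assms(1,2)])
  show ?thesis using soliton_op_symm[OF assms(3) f_smooth, of a b] by (simp add: chart_op_eq[OF assms(1,2)])
qed

section \<open>Parity and naturality of the operator\<close>

lemma chart_op_parity:
  assumes "series_data A hs fs" "c \<in> A" "x \<in> chart_image c" "odd k"
  shows "chart_op h hs fs c None None x $$ k = 0" "chart_op h hs fs c (Some i) (Some j) x $$ k = 0"
proof -
  let ?g = "soliton_metric h hs c" and ?f = "soliton_potential fs c"
  have one: "fls_reflect 1 = 1" using fls_reflect_const[of 1] by simp
  have zero: "fls_reflect 0 = 0" using fls_reflect_const[of 0] by simp
  have ev: "fls_reflect (even_series u) = even_series u" for u
    by (rule fls_eqI) (simp add: fls_reflect_nth even_series_nth)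
  have xx: "fls_reflect (fls_X_inv ^ 2) = fls_X_inv ^ 2"
    by (rule fls_eqI) (auto simp: fls_reflect_nth fls_X_inv_power_conv_shift_1, presburger)
  have g: "?g x $ a $ b = refl_sign a * refl_sign b * fls_reflect (?g x $ a $ b)" for x a b
    by (cases a; cases b) (simp_all add: soliton_metric_def refl_sign_def one zero ev xx fls_reflect_add fls_reflect_mult)
  have f: "fls_reflect (?f x) = ?f x" for x
    by (simp only: soliton_potential_def ev xx fls_reflect_add fls_reflect_mult fls_reflect_const)
  note R = ricci_reflect[OF smooth_metric(1)[OF assms(1,2)] g smooth_metric(2)[OF assms(1,2)] f assms(3)]
  have "F $$ k = 0" if "F = fls_reflect F" for F :: "real fls"
    using arg_cong[OF that, of "\<lambda>F. F $$ k"] assms(4) by (simp add: fls_reflect_nth)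
  note odd0 = this
  \<comment> \<open>For two radial or two tangential indices the signs cancel and the component is
    even in r; a mixed component is odd.\<close>
  have r: "chart_op h hs fs c a b x = refl_sign a * refl_sign b * fls_reflect (chart_op h hs fs c a b x)" for a b
    unfolding chart_op_def fls_reflect_add fls_reflect_mult fls_reflect_const distrib_left
    by (simp only: R(1)[of a b, symmetric] R(2)[of a b, symmetric] mult.left_commute[of _ "fls_const _"] g[of x a b, symmetric])
  show "chart_op h hs fs c None None x $$ k = 0"
    using r[of None None] by (intro odd0) (simp add: refl_sign_def)
  show "chart_op h hs fs c (Some i) (Some j) x $$ k = 0"
    using r[of "Some i" "Some j"] by (intro odd0) (simp add: refl_sign_def)
qed

lemma overlap:
  assumes "c \<in> A" "d \<in> A"
  defines "V \<equiv> chart_map d ` (chart_dom c \<inter> chart_dom d)"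
  shows "open V" "V \<subseteq> chart_image d" "smooth_on V (transition c d)" "transition c d ` V \<subseteq> chart_image c"
    "\<And>p. p \<in> chart_dom c \<inter> chart_dom d \<Longrightarrow> transition c d (chart_map d p) = chart_map c p"
proof -
  have "openin (top_of_set (chart_image d)) V"
  proof -
    have "openin (subtopology X (chart_dom d)) (chart_dom c \<inter> chart_dom d)"
      using open_dom[OF assms(1)] by (simp add: openin_subtopology_Int)
    then show ?thesis
      using homeomorphic_imp_open_map[OF homeo[OF assms(2)]] unfolding V_def open_map_def by blast
  qed
  then show "open V" using open_image[OF assms(2)] by (simp add: openin_open_eq)
  show "V \<subseteq> chart_image d" by (auto simp: V_def chart_image_def)
  show "smooth_on V (transition c d)" using mfd assms(1,2) unfolding smooth_manifold_def V_def by blast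
  show *: "transition c d (chart_map d p) = chart_map c p" if "p \<in> chart_dom c \<inter> chart_dom d" for p
    using that by (simp add: transition_def chart_inv_map assms(2))
  show "transition c d ` V \<subseteq> chart_image c" using * by (auto simp: V_def chart_map_image)
qed

text \<open>The chain rule for the composition of the two transition maps, which is the identity
  near the point.\<close>

lemma transition_inverse:
  assumes "c \<in> A" "d \<in> A" "p \<in> chart_dom c \<inter> chart_dom d"
  defines "y \<equiv> chart_map d p"
  shows "(\<chi> i a. partial_deriv a (transition c d) y $ i) ** (\<chi> a i. partial_deriv i (transition d c) (transition c d y) $ a) = mat 1"
proof -
  let ?t = "transition c d" and ?s = "transition d c" and ?W = "chart_map c ` (chart_dom d \<inter> chart_dom c)"
  have ty: "?t y = chart_map c p" unfolding y_def using overlap(5)[OF assms(1,2,3)] .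
  have sty: "?s (?t y) = y" unfolding ty unfolding y_def using overlap(5)[OF assms(2,1), of p] assms(3) by blast
  have W: "open ?W" "?t y \<in> ?W" using overlap(1)[OF assms(2,1)] assms(3) ty by auto
  have ds: "?s differentiable (at (?t y))"
    by (rule smooth_on_differentiable[OF overlap(3)[OF assms(2,1)]]) (use W in simp)
  have dt: "?t differentiable (at (?s (?t y)))"
    unfolding sty by (rule smooth_on_differentiable[OF overlap(3)[OF assms(1,2)]]) (use assms(3) in \<open>auto simp: y_def\<close>)
  have "(\<Sum>a\<in>UNIV. partial_deriv a ?t y $ i * partial_deriv k ?s (?t y) $ a) = (if i = k then 1 else 0)" for i k
  proof -
    have "partial_deriv k (\<lambda>z. ?t (?s z)) (?t y) = (\<Sum>a\<in>UNIV. (partial_deriv k ?s (?t y) $ a) *\<^sub>R partial_deriv a ?t (?s (?t y)))"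
      by (rule partial_deriv_compose[OF dt ds])
    moreover have "partial_deriv k (\<lambda>z. ?t (?s z)) (?t y) = partial_deriv k (\<lambda>z. z) (?t y)"
    proof (rule partial_deriv_cong[OF W])
      fix z assume "z \<in> ?W"
      then obtain p' where "p' \<in> chart_dom d \<inter> chart_dom c" "z = chart_map c p'" by auto
      then show "?t (?s z) = z" using overlap(5)[OF assms(2,1), of p'] overlap(5)[OF assms(1,2), of p'] by auto
    qed
    moreover have "partial_deriv k (\<lambda>z. z) (?t y) = axis k 1"
      using partial_deriv_translation[of k 0 "?t y"] by simp
    ultimately have "axis k 1 $ i = (\<Sum>a\<in>UNIV. partial_deriv k ?s (?t y) $ a * partial_deriv a ?t y $ i)"
      by (simp add: sty)
    then show ?thesis by (simp add: axis_def mult.commute)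
  qed
  then show ?thesis by (simp add: vec_eq_iff matrix_mult_nth mat_def)
qed

text \<open>Changes of coordinates on Y leave r alone, so E_rr is a function and each coefficient of
  E_jk is a covariant tensor. This makes the corrections chosen in \<open>approx_Suc\<close> global
  objects.\<close>

lemma chart_op_trans:
  assumes data: "series_data A hs fs" and cd: "c \<in> A" "d \<in> A" "p \<in> chart_dom c \<inter> chart_dom d"
  shows "chart_op h hs fs d None None (chart_map d p) = chart_op h hs fs c None None (chart_map c p)"
    and "chart_op h hs fs d (Some a) (Some b) (chart_map d p) $$ k = 
      (\<Sum>i\<in>UNIV. \<Sum>j\<in>UNIV. chart_op h hs fs c (Some i) (Some j) (chart_map c p) $$ k *
             partial_deriv a (transition c d) (chart_map d p) $ i *
             partial_deriv b (transition c d) (chart_map d p) $ j)"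
proof -
  define V where "V = chart_map d ` (chart_dom c \<inter> chart_dom d)"
  let ?t = "transition c d"
  define K where "K y = (\<chi> a i. partial_deriv i (transition d c) (?t y) $ a)" for y
  note ov = overlap[OF cd(1,2), folded V_def]
  \<comment> \<open>The tensor law for \<open>h\<close> and for every coefficient
    \<open>hs i\<close>, assembled into one law for the series.\<close>
  have gm: "soliton_metric h hs d y = transpose (jac ?t y) ** soliton_metric h hs c (?t y) ** jac ?t y" if "y \<in> V" for y
  proof -
    obtain p where p: "p \<in> chart_dom c \<inter> chart_dom d" "y = chart_map d p" using \<open>y \<in> V\<close> by (auto simp: V_def)
    note ty = ov(5)[OF p(1)]
    have SS: "soliton_metric h hs d y $ Some a $ Some b
       = (\<Sum>j\<in>UNIV. (\<Sum>i\<in>UNIV. fls_const (partial_deriv a ?t y $ i) * soliton_metric h hs c (?t y) $ Some i $ Some j) * fls_const (partial_deriv b ?t y $ j))"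
      for a b
    proof (rule fls_eqI)
      fix k
      have lin: "T d y $ a $ b = (\<Sum>j\<in>UNIV. \<Sum>i\<in>UNIV. partial_deriv a ?t y $ i * T c (?t y) $ i $ j * partial_deriv b ?t y $ j)"
        if "sym_tensor_field A T" for T
        unfolding p(2) tensor_trans[OF that cd(1,2) p(1)] ty by (subst sum.swap) (simp add: mult_ac)
      have nth: "soliton_metric h hs e z $ Some i $ Some j $$ k = (if k = - 2 then h e z $ i $ j else 0) + (if 0 \<le> k \<and> even k then hs (nat k div 2) e z $ i $ j else 0)" for e z i j k
        by (simp add: soliton_metric_def fls_X_inv_power_nth even_series_nth)
      show "soliton_metric h hs d y $ Some a $ Some b $$ k
       = (\<Sum>j\<in>UNIV. (\<Sum>i\<in>UNIV. fls_const (partial_deriv a ?t y $ i) * soliton_metric h hs c (?t y) $ Some i $ Some j) * fls_const (partial_deriv b ?t y $ j)) $$ k"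
        by (cases "k = - 2"; cases "0 \<le> k"; cases "even k")
          (simp_all add: fls_sum_nth nth lin[OF h_tensor] lin[OF data_h[OF data]] sum_distrib_right)
    qed
    have NN: "soliton_metric h hs e z $ None $ None = 1" "soliton_metric h hs e z $ None $ Some j = 0" "soliton_metric h hs e z $ Some j $ None = 0"
      for e z j by (simp_all add: soliton_metric_def)
    show ?thesis
      unfolding vec_eq_iff matrix_mult_nth sum_option split_option_all
      by (simp add: transpose_def jac_def NN SS)
  qed
  have pot: "soliton_potential fs d y = soliton_potential fs c (?t y)" if "y \<in> V" for y
  proof -
    obtain p where p: "p \<in> chart_dom c \<inter> chart_dom d" "y = chart_map d p" using \<open>y \<in> V\<close> by (auto simp: V_def)
    show ?thesis unfolding p(2) ov(5)[OF p(1)]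
      using p(1) cd by (simp add: soliton_potential_def chart_inv_map)
  qed
  have W: "open (chart_map c ` (chart_dom d \<inter> chart_dom c))" and sW: "smooth_on (chart_map c ` (chart_dom d \<inter> chart_dom c)) (transition d c)"
    using overlap[OF cd(2,1)] by auto
  have K_sm: "smooth_on V (\<lambda>y. K y $ a $ i)" for a i
  proof -
    have "smooth_on V (\<lambda>y. (\<lambda>z. partial_deriv i (transition d c) z $ a) (?t y))"
    proof (rule smooth_on_compose[OF ov(1) _ ov(3)])
      show "smooth_on (chart_map c ` (chart_dom d \<inter> chart_dom c)) (\<lambda>z. partial_deriv i (transition d c) z $ a)"
        by (rule smooth_on_linear[OF W bounded_linear_vec_nth smooth_on_partial_deriv[OF sW]])
      show "?t ` V \<subseteq> chart_map c ` (chart_dom d \<inter> chart_dom c)"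
        using ov(5) by (auto simp: V_def)
    qed
    then show ?thesis by (simp add: K_def)
  qed
  have JK: "(\<chi> i a. partial_deriv a ?t y $ i) ** K y = mat 1" if "y \<in> V" for y
    using that transition_inverse[OF cd(1,2)] unfolding V_def K_def by auto
  have y: "chart_map d p \<in> V" using cd(3) by (simp add: V_def)
  note R = ricci_coordinate_change[where K = K and f = "soliton_potential fs c" and f' = "soliton_potential fs d",
      OF smooth_metric(1)[OF data cd(1)]
      smooth_formal_metric_subset[OF smooth_metric(1)[OF data cd(2)] ov(2,1)] ov(3,4) K_sm JK gm
      fls_smooth_on_subset[OF smooth_metric(2)[OF data cd(2)] ov(2)] smooth_metric(2)[OF data cd(1)] pot y]
  have R1: "ricci (soliton_metric h hs d) b c' (chart_map d p) =
      (\<Sum>j\<in>UNIV. \<Sum>l\<in>UNIV. jac ?t (chart_map d p) $ j $ b * jac ?t (chart_map d p) $ l $ c' * ricci (soliton_metric h hs c) j l (?t (chart_map d p)))"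
    for b c' by (rule R(1))
  have R2: "hessian (soliton_metric h hs d) (soliton_potential fs d) b c' (chart_map d p) =
      (\<Sum>j\<in>UNIV. \<Sum>l\<in>UNIV. jac ?t (chart_map d p) $ j $ b * jac ?t (chart_map d p) $ l $ c' * hessian (soliton_metric h hs c) (soliton_potential fs c) j l (?t (chart_map d p)))"
    for b c' by (rule R(2))
  have main: "chart_op h hs fs d b c' (chart_map d p) = (\<Sum>j\<in>UNIV. \<Sum>l\<in>UNIV. jac ?t (chart_map d p) $ j $ b * jac ?t (chart_map d p) $ l $ c' * chart_op h hs fs c j l (chart_map c p))"
    for b c'
  proof -
    have "soliton_metric h hs d (chart_map d p) $ b $ c'
      = (\<Sum>j\<in>UNIV. \<Sum>l\<in>UNIV. jac ?t (chart_map d p) $ j $ b * jac ?t (chart_map d p) $ l $ c' * soliton_metric h hs c (?t (chart_map d p)) $ j $ l)"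
      unfolding gm[OF y] by (simp add: matrix_mult_nth[of "_ ** _"]) (simp add: matrix_mult_nth transpose_def sum_distrib_right, subst sum.swap, simp add: mult_ac)
    then show ?thesis
      unfolding chart_op_def R1 R2 ov(5)[OF cd(3)]
      by (simp add: distrib_left sum.distrib sum_distrib_left mult_ac)
  qed
  show "chart_op h hs fs d None None (chart_map d p) = chart_op h hs fs c None None (chart_map c p)"
    unfolding main by (simp add: sum_option jac_def)
  show "chart_op h hs fs d (Some a) (Some b) (chart_map d p) $$ k = 
      (\<Sum>i\<in>UNIV. \<Sum>j\<in>UNIV. chart_op h hs fs c (Some i) (Some j) (chart_map c p) $$ k *
             partial_deriv a ?t (chart_map d p) $ i * partial_deriv b ?t (chart_map d p) $ j)"
    unfolding main by (simp add: sum_option jac_def fls_sum_nth fls_const_mult_const[symmetric] mult.assoc del: fls_const_mult_const) (simp add: mult_ac)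
qed

end

section \<open>Comparison of data and uniqueness\<close>

context riemannian_manifold
begin

lemma soliton_potential_nth:
  "soliton_potential fs c x $$ k = (if k = - 2 then - 1/4 else 0) + (if 0 \<le> k \<and> even k then fs (nat k div 2) (chart_inv c x) else 0)"
  by (simp add: soliton_potential_def mult.commute[of "fls_const _"] fls_X_inv_power_nth even_series_nth del: fls_mult_const_nth)

text \<open>The potentials are compared through their derivatives only, so that f_0 may be changed
  by a locally constant function.\<close>

lemma chart_op_cong:
  assumes "c \<in> A" "x \<in> chart_image c" "\<And>i y. y \<in> chart_image c \<Longrightarrow> hs' i c y = hs i c y"
    "\<And>a y. y \<in> chart_image c \<Longrightarrow> formal_deriv a (soliton_potential fs' c) y = formal_deriv a (soliton_potential fs c) y"
  shows "chart_op h hs' fs' c a b x = chart_op h hs fs c a b x"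
proof -
  have g: "soliton_metric h hs' c y = soliton_metric h hs c y" if "y \<in> chart_image c" for y
    by (simp add: soliton_metric_def vec_eq_iff split_option_all assms(3)[OF that])
  have "ricci (soliton_metric h hs' c) a b x = ricci (soliton_metric h hs c) a b x"
    by (rule ricci_cong[OF open_image[OF assms(1)] assms(2) g])
  moreover have "hessian (soliton_metric h hs' c) (soliton_potential fs' c) a b x = hessian (soliton_metric h hs c) (soliton_potential fs c) a b x"
    by (rule hessian_cong[OF open_image[OF assms(1)] assms(2) g assms(4)])
  ultimately show ?thesis by (simp add: chart_op_def g[OF assms(2)])
qed

lemma potential_deriv_cong:
  assumes "series_data A hs fs" "series_data A hs fs'" "c \<in> A" "y \<in> chart_image c"
    and eq: "\<And>i p. 1 \<le> i \<Longrightarrow> p \<in> topspace X \<Longrightarrow> fs' i p = fs i p"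
    and d0: "\<And>i. partial_deriv i (\<lambda>y. fs' 0 (chart_inv c y)) y = partial_deriv i (\<lambda>y. fs 0 (chart_inv c y)) y"
  shows "formal_deriv a (soliton_potential fs' c) y = formal_deriv a (soliton_potential fs c) y"
proof (rule fls_eqI)
  fix k
  have e: "soliton_potential fs' c z $$ k = soliton_potential fs c z $$ k" if "k \<noteq> 0" "z \<in> chart_image c" for k z
  proof -
    have "chart_inv c z \<in> topspace X" using chart_inv_dom[OF that(2)] dom_topspace[OF assms(3)] by blast
    moreover have "1 \<le> nat k div 2" if "0 \<le> k" "even k"
    proof -
      obtain b where "k = 2 * b" using \<open>even k\<close> by blast
      then show ?thesis using that(1) \<open>k \<noteq> 0\<close> by (simp add: nat_mult_distrib)
    qed
    ultimately show ?thesis by (simp add: soliton_potential_nth eq)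
  qed
  show "formal_deriv a (soliton_potential fs' c) y $$ k = formal_deriv a (soliton_potential fs c) y $$ k"
  proof (cases a)
    case None
    then show ?thesis using e[of "k - 1" y] assms(4) by (cases "k = 1") (simp_all add: formal_deriv_None_nth)
  next
    case (Some i)
    have "partial_deriv i (\<lambda>z. soliton_potential fs' c z $$ k) y = partial_deriv i (\<lambda>z. soliton_potential fs c z $$ k) y"
    proof (cases "k = 0")
      case True
      then show ?thesis using d0[of i] by (simp add: soliton_potential_nth)
    next
      case False
      show ?thesis by (rule partial_deriv_cong[OF open_image[OF assms(3)] assms(4)]) (rule e[OF False])
    qed
    then show ?thesis
      unfolding Some formal_deriv_Some_nth[OF open_image[OF assms(3)] assms(4) smooth_metric(2)[OF assms(1,3)]]
        formal_deriv_Some_nth[OF open_image[OF assms(3)] assms(4) smooth_metric(2)[OF assms(2,3)]] .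
  qed
qed

lemma cone_pair:
  assumes "series_data A hs fs" "series_data A hs' fs'" "c \<in> A"
    and hs: "\<And>i y. i < n \<Longrightarrow> y \<in> chart_image c \<Longrightarrow> hs' i c y = hs i c y"
    and fs: "\<And>i y. 2 * int i < m \<Longrightarrow> y \<in> chart_image c \<Longrightarrow> fs' i (chart_inv c y) = fs i (chart_inv c y)"
    and m: "2 * int n \<le> m" "m \<le> 2 * int n + 1"
  shows "cone_pair (chart_image c) (h c) (tensor_series hs c) (tensor_series hs' c) (function_series fs c) (function_series fs' c) (2 * int n) m"
proof (intro cone_pair.intro cone_chart assms(1-3) cone_pair_axioms.intro m)
  fix x i j assume x: "x \<in> chart_image c"
  show "fls_ge (2 * int n) (tensor_series hs' c x $ i $ j - tensor_series hs c x $ i $ j)"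
    unfolding fls_ge_def
  proof (intro allI impI)
    fix k :: int assume k: "k < 2 * int n"
    have "nat k div 2 < n" if "0 \<le> k" using that k by linarith
    then show "(tensor_series hs' c x $ i $ j - tensor_series hs c x $ i $ j) $$ k = 0"
      by (simp add: tensor_series_def even_series_nth hs[OF _ x])
  qed
  show "fls_ge m (function_series fs' c x - function_series fs c x)"
    unfolding fls_ge_def
  proof (intro allI impI)
    fix k :: int assume k: "k < m"
    have "2 * int (nat k div 2) < m" if "0 \<le> k" using that k by linarith
    then show "(function_series fs' c x - function_series fs c x) $$ k = 0"
      by (simp add: function_series_def even_series_nth fs[OF _ x])
  qed
qed simp

text \<open>The case m = q = 2n of \<open>cone_pair\<close>. The bounds also say how far a change of
  the coefficients from index \<open>n\<close> on can reach down.\<close>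

lemma compare:
  assumes d: "series_data A hs fs" "series_data A hs' fs'" "c \<in> A"
    and hs: "\<And>i y. i < n \<Longrightarrow> y \<in> chart_image c \<Longrightarrow> hs' i c y = hs i c y"
    and fs: "\<And>i y. i < n \<Longrightarrow> y \<in> chart_image c \<Longrightarrow> fs' i (chart_inv c y) = fs i (chart_inv c y)"
    and x: "x \<in> chart_image c"
  shows "fls_ge (2 * int n + 2) (chart_op h hs' fs' c None None x - chart_op h hs fs c None None x)"
    "chart_op h hs' fs' c None None x $$ (2 * int n + 2) - chart_op h hs fs c None None x $$ (2 * int n + 2)
      = 2 * real n * (2 * real n + 1) * (fs' n (chart_inv c x) - fs n (chart_inv c x))"
    "fls_ge (2 * int n) (chart_op h hs' fs' c (Some j) (Some k) x - chart_op h hs fs c (Some j) (Some k) x)"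
proof -
  interpret cone_pair "chart_image c" "h c" "tensor_series hs c" "tensor_series hs' c" "function_series fs c" "function_series fs' c" "2 * int n" "2 * int n"
    by (rule cone_pair[OF d hs]) (use fs in auto)
  note E = chart_op_eq[OF d(1,3)] chart_op_eq[OF d(2,3)]
  show "fls_ge (2 * int n + 2) (chart_op h hs' fs' c None None x - chart_op h hs fs c None None x)"
    using dE_rr[OF x] unfolding E by simp
  show "chart_op h hs' fs' c None None x $$ (2 * int n + 2) - chart_op h hs fs c None None x $$ (2 * int n + 2)
      = 2 * real n * (2 * real n + 1) * (fs' n (chart_inv c x) - fs n (chart_inv c x))"
    using dE_rr_lead[OF x] unfolding E by (simp add: function_series_def even_series_nth nat_mult_distrib)
  show "fls_ge (2 * int n) (chart_op h hs' fs' c (Some j) (Some k) x - chart_op h hs fs c (Some j) (Some k) x)"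
    using dE_jk[OF x] unfolding E by simp
qed

text \<open>The case m = q + 1 with q = 2n. Where it is used, parity raises the order 2n + 3 in the
  first claim to 2n + 4.\<close>

lemma compare':
  assumes d: "series_data A hs fs" "series_data A hs' fs'" "c \<in> A"
    and hs: "\<And>i y. i < n \<Longrightarrow> y \<in> chart_image c \<Longrightarrow> hs' i c y = hs i c y"
    and fs: "\<And>i y. i \<le> n \<Longrightarrow> y \<in> chart_image c \<Longrightarrow> fs' i (chart_inv c y) = fs i (chart_inv c y)"
    and x: "x \<in> chart_image c"
  shows "fls_ge (2 * int n + 3) (chart_op h hs' fs' c None None x - chart_op h hs fs c None None x)"
    "chart_op h hs' fs' c (Some j) (Some k) x $$ (2 * int n) - chart_op h hs fs c (Some j) (Some k) x $$ (2 * int n)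
      = (real n + 1) / 2 * (hs' n c x $ j $ k - hs n c x $ j $ k)"
proof -
  interpret cone_pair "chart_image c" "h c" "tensor_series hs c" "tensor_series hs' c" "function_series fs c" "function_series fs' c" "2 * int n" "2 * int n + 1"
    by (rule cone_pair[OF d hs]) (use fs in auto)
  note E = chart_op_eq[OF d(1,3)] chart_op_eq[OF d(2,3)]
  show "fls_ge (2 * int n + 3) (chart_op h hs' fs' c None None x - chart_op h hs fs c None None x)"
    using dE_rr[OF x] unfolding E by (simp add: add.commute)
  show "chart_op h hs' fs' c (Some j) (Some k) x $$ (2 * int n) - chart_op h hs fs c (Some j) (Some k) x $$ (2 * int n)
      = (real n + 1) / 2 * (hs' n c x $ j $ k - hs n c x $ j $ k)"
  proof -
    have "of_int (2 * int n + 2) / 4 = (real n + 1) / 2" by simp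
    then show ?thesis
      using dE_jk_lead[OF x refl, of j k] unfolding E by (simp only:) (simp add: tensor_series_def even_series_nth nat_mult_distrib)
  qed
qed

lemma chart_op_rl_lead:
  assumes "series_data A hs fs" "c \<in> A" "x \<in> chart_image c"
  shows "chart_op h hs fs c None (Some l) x $$ 1 = - partial_deriv l (\<lambda>y. fs 0 (chart_inv c y)) x"
proof -
  interpret cone_chart "chart_image c" "h c" "tensor_series hs c" "function_series fs c" by (rule cone_chart[OF assms(1,2)])
  show ?thesis
    using E_rl_lead[OF assms(3), of l]
    unfolding chart_op_eq[OF assms(1,2)]
    by (simp add: formal_deriv_Some_nth[OF open_U assms(3) \<phi>_smooth]) (simp add: function_series_def even_series_nth)
qed

lemma soliton_f0_partial:
  assumes "formal_expanding_soliton A h hs fs" "c \<in> A" "x \<in> chart_image c"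
  shows "partial_deriv l (\<lambda>y. fs 0 (chart_inv c y)) x = 0"
  using chart_op_rl_lead[of hs fs c x l] assms by (simp add: formal_expanding_soliton_iff)

text \<open>f_0 enters the equation only through its derivative, which is 0 for every solution. This
  is used to normalize f_0 to 0 and, conversely, to add locally constant functions.\<close>

lemma soliton_change_f0:
  assumes sol: "formal_expanding_soliton A h hs fs" and data: "series_data A hs' fs'"
    and hs: "\<And>i c x. c \<in> A \<Longrightarrow> x \<in> chart_image c \<Longrightarrow> hs' i c x = hs i c x"
    and fs: "\<And>i p. 1 \<le> i \<Longrightarrow> p \<in> topspace X \<Longrightarrow> fs' i p = fs i p"
    and d0: "\<And>c x l. c \<in> A \<Longrightarrow> x \<in> chart_image c \<Longrightarrow> partial_deriv l (\<lambda>y. fs' 0 (chart_inv c y)) x = 0"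
  shows "formal_expanding_soliton A h hs' fs'"
  unfolding formal_expanding_soliton_iff
proof (intro conjI ballI allI)
  fix c x a b assume c: "c \<in> A" and x: "x \<in> chart_image c"
  have data0: "series_data A hs fs" using sol by (simp add: formal_expanding_soliton_iff)
  then have data1: "series_data A hs fs'" using data by (simp add: series_data_def)
  have "chart_op h hs' fs' c a b x = chart_op h hs fs c a b x"
  proof (rule chart_op_cong[OF c x])
    show "hs' i c y = hs i c y" if "y \<in> chart_image c" for i y by (rule hs[OF c that])
    show "formal_deriv a (soliton_potential fs' c) y = formal_deriv a (soliton_potential fs c) y" if "y \<in> chart_image c" for a y
      by (rule potential_deriv_cong[OF data0 data1 c that fs])
         (simp_all add: d0[OF c that] soliton_f0_partial[OF sol c that])
  qed
  then show "chart_op h hs' fs' c a b x = 0" using sol c x by (simp add: formal_expanding_soliton_iff)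
qed fact

text \<open>At each index first the function is determined, then the tensor. At index 0 the factor
  2n(2n + 1) vanishes and the normalization takes its place.\<close>

lemma normalized_unique:
  assumes s: "formal_expanding_soliton A h hs fs" "formal_expanding_soliton A h hs' fs'"
    and f0: "fs 0 = (\<lambda>p. 0)" "fs' 0 = (\<lambda>p. 0)"
  shows "(\<forall>c\<in>A. \<forall>x\<in>chart_image c. hs' i c x = hs i c x) \<and> (\<forall>c\<in>A. \<forall>x\<in>chart_image c. fs' i (chart_inv c x) = fs i (chart_inv c x))"
proof (induction i rule: less_induct)
  case (less n)
  have d: "series_data A hs fs" "series_data A hs' fs'" using s by (simp_all add: formal_expanding_soliton_iff)
  have f: "fs' n (chart_inv c x) = fs n (chart_inv c x)" if c: "c \<in> A" and x: "x \<in> chart_image c" for c x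
  proof (cases "n = 0")
    case False
    have "2 * real n * (2 * real n + 1) * (fs' n (chart_inv c x) - fs n (chart_inv c x)) = 0"
      using compare(2)[OF d c, of n x] less.IH c x s by (simp add: formal_expanding_soliton_iff)
    moreover have "2 * real n * (2 * real n + 1) \<noteq> 0" using False by (simp add: add_nonneg_eq_0_iff)
    ultimately show ?thesis by simp
  qed (simp add: f0)
  have "hs' n c x $ j $ k = hs n c x $ j $ k" if c: "c \<in> A" and x: "x \<in> chart_image c" for c x j k
  proof -
    have "chart_op h hs' fs' c (Some j) (Some k) x $$ (2 * int n) - chart_op h hs fs c (Some j) (Some k) x $$ (2 * int n)
      = (real n + 1) / 2 * (hs' n c x $ j $ k - hs n c x $ j $ k)"
      by (rule compare'(2)[OF d c _ _ x]) (use less.IH c f[OF c] in \<open>auto simp: le_less\<close>)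
    then have "(real n + 1) / 2 * (hs' n c x $ j $ k - hs n c x $ j $ k) = 0"
      using s c x by (simp add: formal_expanding_soliton_iff)
    moreover have "real n + 1 \<noteq> 0" by (metis of_nat_Suc of_nat_eq_0_iff Suc_not_Zero add.commute)
    ultimately show ?thesis by simp
  qed
  then show ?case using f by (simp add: vec_eq_iff)
qed

section \<open>Locally constant functions\<close>

lemma partials_zero_locally_constant:
  fixes u :: "real^'m::finite \<Rightarrow> real"
  assumes "open S" "smooth_on S u" "\<And>x l. x \<in> S \<Longrightarrow> partial_deriv l u x = 0" "convex T" "T \<subseteq> S" "x \<in> T" "y \<in> T"
  shows "u x = u y"
proof (rule has_derivative_zero_unique[OF assms(4) _ assms(6,7)])
  fix z assume "z \<in> T"
  then have z: "z \<in> S" using assms(5) by blast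
  have d: "u differentiable (at z)" by (rule smooth_on_differentiable[OF assms(2) z])
  have "frechet_derivative u (at z) = (\<lambda>v. 0)"
    by (rule ext) (simp add: frechet_derivative_expand[OF d] assms(3)[OF z])
  then have "(u has_derivative (\<lambda>v. 0)) (at z)" using has_derivative_frechet[OF d] by simp
  then show "(u has_derivative (\<lambda>v. 0)) (at z within T)" by (rule has_derivative_at_withinI)
qed

text \<open>Coordinate balls are connected open neighbourhoods; through them constancy on convex
  sets in charts is related to the connected components of the manifold.\<close>

lemma chart_ball:
  assumes "c \<in> A" "p \<in> chart_dom c"
  obtains e where "e > 0" "ball (chart_map c p) e \<subseteq> chart_image c" "openin X (chart_inv c ` ball (chart_map c p) e)"
    "p \<in> chart_inv c ` ball (chart_map c p) e" "connectedin X (chart_inv c ` ball (chart_map c p) e)"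
proof -
  obtain e where e: "e > 0" "ball (chart_map c p) e \<subseteq> chart_image c"
    using open_image[OF assms(1)] chart_map_image[OF assms(2)] by (meson openE)
  let ?B = "ball (chart_map c p) e"
  obtain g where g: "homeomorphic_maps (subtopology X (chart_dom c)) (top_of_set (chart_image c)) (chart_map c) g"
    using homeo[OF assms(1)] unfolding homeomorphic_map_maps by blast
  have top: "topspace (subtopology X (chart_dom c)) = chart_dom c" using dom_topspace[OF assms(1)] by auto
  have ginv: "g x = chart_inv c x" if "x \<in> chart_image c" for x
  proof -
    have "g (chart_map c (chart_inv c x)) = chart_inv c x"
      using g chart_inv_dom[OF that] unfolding homeomorphic_maps_def top by blast
    then show ?thesis by (simp add: chart_map_inv[OF that])
  qed
  then have gB: "g ` ?B = chart_inv c ` ?B" using e(2) by (intro image_cong) auto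
  have gh: "homeomorphic_map (top_of_set (chart_image c)) (subtopology X (chart_dom c)) g"
    using g homeomorphic_maps_sym homeomorphic_map_maps by blast
  have "openin (subtopology X (chart_dom c)) (g ` ?B)"
    using homeomorphic_imp_open_map[OF gh] e(2) unfolding open_map_def by (simp add: openin_open_eq open_image[OF assms(1)])
  then have o: "openin X (chart_inv c ` ?B)" unfolding gB using open_dom[OF assms(1)] openin_trans_full by blast
  have "connectedin (top_of_set (chart_image c)) ?B" using e(2) by (simp add: connectedin_subtopology)
  then have "connectedin (subtopology X (chart_dom c)) (g ` ?B)"
    using connectedin_continuous_map_image[OF homeomorphic_imp_continuous_map[OF gh]] by blast
  then have cn: "connectedin X (chart_inv c ` ?B)" unfolding gB by (simp add: connectedin_subtopology)
  have "p = chart_inv c (chart_map c p)" using assms by (simp add: chart_inv_map)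
  then have "p \<in> chart_inv c ` ?B" using e(1) by (metis centre_in_ball imageI)
  then show ?thesis using that e o cn by blast
qed

lemma constant_on_component:
  assumes sm: "smooth_function A u" and d: "\<And>c x l. c \<in> A \<Longrightarrow> x \<in> chart_image c \<Longrightarrow> partial_deriv l (\<lambda>y. u (chart_inv c y)) x = 0"
    and C: "C \<in> connected_components_of X"
  shows "\<exists>k. \<forall>p\<in>C. u p = k"
proof -
  obtain p0 where p0: "p0 \<in> C" using nonempty_connected_components_of[OF C] by blast
  have CX: "C \<subseteq> topspace X" by (rule connected_components_of_subset[OF C])
  \<comment> \<open>\<open>P\<close> is arbitrary so that a level set of \<open>u\<close> and its
    complement are both covered; the level set is then open and closed.\<close>
  have op: "openin X {p \<in> topspace X. P (u p)}" for P
  proof (subst openin_subopen, safe)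
    fix p assume p: "p \<in> topspace X" "P (u p)"
    obtain c where c: "c \<in> A" "p \<in> chart_dom c" using covered[OF p(1)] by blast
    obtain e where e: "e > 0" "ball (chart_map c p) e \<subseteq> chart_image c" "openin X (chart_inv c ` ball (chart_map c p) e)"
      "p \<in> chart_inv c ` ball (chart_map c p) e" using chart_ball[OF c] by metis
    have "u (chart_inv c y) = u (chart_inv c (chart_map c p))" if "y \<in> ball (chart_map c p) e" for y
      by (rule partials_zero_locally_constant[OF open_image[OF c(1)] function_smooth[OF sm c(1)] d[OF c(1)] convex_ball e(2) that])
         (use e(1) in simp_all)
    then have "\<forall>q\<in>chart_inv c ` ball (chart_map c p) e. u q = u p" by (simp add: chart_inv_map[OF c])
    then have "chart_inv c ` ball (chart_map c p) e \<subseteq> {p \<in> topspace X. P (u p)}"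
      using openin_subset[OF e(3)] p(2) by auto
    then show "\<exists>T. openin X T \<and> p \<in> T \<and> T \<subseteq> {p \<in> topspace X. P (u p)}" using e(3,4) by blast
  qed
  have "closedin X {p \<in> topspace X. u p = u p0}"
  proof -
    have "topspace X - {p \<in> topspace X. u p = u p0} = {p \<in> topspace X. u p \<noteq> u p0}" by auto
    then show ?thesis unfolding closedin_def using op[of "\<lambda>v. v \<noteq> u p0"] by auto
  qed
  then have "C \<subseteq> {p \<in> topspace X. u p = u p0} \<or> disjnt C {p \<in> topspace X. u p = u p0}"
    by (rule connectedin_clopen_cases[OF connectedin_connected_components_of[OF C] _ op[of "\<lambda>v. v = u p0"]])
  then show ?thesis using p0 CX by (auto simp: disjnt_def)
qed

text \<open>The converse of \<open>constant_on_component\<close>: a coordinate ball is connected,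
  hence lies in one component, on which \<open>u\<close> is constant.\<close>

lemma locally_constant_smooth:
  assumes u: "\<And>C. C \<in> connected_components_of X \<Longrightarrow> \<exists>k. \<forall>p\<in>C. u p = k" and c: "c \<in> A"
  shows "smooth_on (chart_image c) (\<lambda>y. u (chart_inv c y))"
    "x \<in> chart_image c \<Longrightarrow> partial_deriv l (\<lambda>y. u (chart_inv c y)) x = 0"
proof -
  have loc: "\<exists>e k. e > 0 \<and> (\<forall>y\<in>ball x e. u (chart_inv c y) = k)" if x: "x \<in> chart_image c" for x
  proof -
    obtain e where e: "e > 0" "connectedin X (chart_inv c ` ball x e)" "chart_inv c x \<in> chart_inv c ` ball x e"
      using chart_ball[OF c chart_inv_dom[OF x]] chart_map_inv[OF x] by metis
    have px: "chart_inv c x \<in> topspace X" using chart_inv_dom[OF x] dom_topspace[OF c] by blast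
    then obtain C where C: "C \<in> connected_components_of X" "chart_inv c x \<in> C"
      using Union_connected_components_of[of X] by blast
    have "chart_inv c ` ball x e \<subseteq> C"
      by (rule connected_components_of_maximal[OF C(1) e(2)]) (use C(2) e(3) in \<open>auto simp: disjnt_def\<close>)
    then show ?thesis using u[OF C(1)] e(1) by blast
  qed
  show "smooth_on (chart_image c) (\<lambda>y. u (chart_inv c y))"
  proof (rule smooth_on_local[OF open_image[OF c]])
    fix x assume "x \<in> chart_image c"
    then obtain e k where e: "e > 0" "\<And>y. y \<in> ball x e \<Longrightarrow> u (chart_inv c y) = k" using loc by blast
    have "smooth_on (ball x e) (\<lambda>y. u (chart_inv c y))"
      by (rule smooth_on_cong[OF open_ball _ smooth_on_const[of _ k]]) (simp add: e(2))
    then show "\<exists>T. open T \<and> x \<in> T \<and> smooth_on T (\<lambda>y. u (chart_inv c y))"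
      using e(1) by (intro exI[of _ "ball x e"]) simp
  qed
  assume "x \<in> chart_image c"
  then obtain e k where e: "e > 0" "\<And>y. y \<in> ball x e \<Longrightarrow> u (chart_inv c y) = k" using loc by blast
  have "partial_deriv l (\<lambda>y. u (chart_inv c y)) x = partial_deriv l (\<lambda>y. k) x"
    by (rule partial_deriv_cong[OF open_ball[of x e]]) (use e in simp_all)
  then show "partial_deriv l (\<lambda>y. u (chart_inv c y)) x = 0" by (simp add: partial_deriv_const)
qed

lemma smooth_functionI: "(\<And>c. c \<in> A \<Longrightarrow> smooth_on (chart_image c) (\<lambda>x. u (chart_inv c x))) \<Longrightarrow> smooth_function A u"
  by (simp add: smooth_function_def o_def)

lemma partial_deriv_diff:
  assumes "f differentiable (at x)" "g differentiable (at x)"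
  shows "partial_deriv i (\<lambda>x. f x - g x :: real) x = partial_deriv i f x - partial_deriv i g x"
proof -
  have "partial_deriv i (\<lambda>x. f x + (- 1) * g x) x = partial_deriv i f x + partial_deriv i (\<lambda>x. (- 1) * g x) x"
    by (rule partial_deriv_add) (use assms in auto)
  also have "partial_deriv i (\<lambda>x. (- 1) * g x) x = (- 1) * partial_deriv i g x"
    by (rule partial_deriv_linear[OF bounded_linear_mult_right assms(2)])
  finally show ?thesis by simp
qed

lemma uniqueness:
  assumes sol: "formal_expanding_soliton A h hs fs"
  shows "formal_expanding_soliton A h hs' fs' \<longleftrightarrow>
          (\<forall>i. \<forall>c\<in>A. \<forall>x\<in>chart_image c. hs' i c x = hs i c x) \<and>
          (\<forall>i\<ge>1. \<forall>p\<in>topspace X. fs' i p = fs i p) \<and>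
          (\<forall>C\<in>connected_components_of X. \<exists>k. \<forall>p\<in>C. fs' 0 p = fs 0 p + k)"
    (is "_ \<longleftrightarrow> ?hs \<and> ?fs \<and> ?f0")
proof
  assume sol': "formal_expanding_soliton A h hs' fs'"
  have d: "series_data A hs fs" "series_data A hs' fs'" using sol sol' by (simp_all add: formal_expanding_soliton_iff)
  \<comment> \<open>Replacing f_0 by 0 in both solutions leaves the other coefficients untouched and
    makes \<open>normalized_unique\<close> applicable.\<close>
  have norm: "formal_expanding_soliton A h hs (fs(0 := \<lambda>p. 0))" if s: "formal_expanding_soliton A h hs fs" for hs fs
  proof (rule soliton_change_f0[OF s])
    have "smooth_function A (\<lambda>p. 0)" by (rule smooth_functionI) simp
    then show "series_data A hs (fs(0 := \<lambda>p. 0))"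
      using s by (auto simp: formal_expanding_soliton_iff series_data_def)
  qed (simp_all add: partial_deriv_const)
  note nu = normalized_unique[OF norm[OF sol] norm[OF sol']]
  have ?hs using nu by auto
  moreover have ?fs
  proof (intro allI impI ballI)
    fix i :: nat and p assume i: "1 \<le> i" and p: "p \<in> topspace X"
    obtain c where c: "c \<in> A" "p \<in> chart_dom c" using covered[OF p] by blast
    show "fs' i p = fs i p" using nu[of i] i c chart_inv_map[OF c] chart_map_image[OF c(2)] by force
  qed
  moreover have ?f0
  proof
    fix C assume C: "C \<in> connected_components_of X"
    define u where "u p = fs' 0 p - fs 0 p" for p
    have sm: "smooth_on (chart_image c) (\<lambda>y. fs' 0 (chart_inv c y))" "smooth_on (chart_image c) (\<lambda>y. fs 0 (chart_inv c y))" if "c \<in> A" for c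
      using function_smooth[OF data_f[OF d(2)] that] function_smooth[OF data_f[OF d(1)] that] by auto
    have "smooth_function A u"
    proof (rule smooth_functionI)
      fix c assume c: "c \<in> A"
      have "smooth_on (chart_image c) (\<lambda>y. fs' 0 (chart_inv c y) + (- 1) * fs 0 (chart_inv c y))"
        by (intro smooth_on_add smooth_on_mult smooth_on_const sm c open_image)
      then show "smooth_on (chart_image c) (\<lambda>y. u (chart_inv c y))" by (simp add: u_def)
    qed
    moreover have "partial_deriv l (\<lambda>y. u (chart_inv c y)) x = 0" if c: "c \<in> A" and x: "x \<in> chart_image c" for c x l
      unfolding u_def
      by (subst partial_deriv_diff) (simp_all add: smooth_on_differentiable[OF sm(1)[OF c] x] smooth_on_differentiable[OF sm(2)[OF c] x]
          soliton_f0_partial[OF sol c x] soliton_f0_partial[OF sol' c x])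
    ultimately obtain k where "\<forall>p\<in>C. u p = k" using constant_on_component[OF _ _ C] by blast
    then show "\<exists>k. \<forall>p\<in>C. fs' 0 p = fs 0 p + k" by (intro exI[of _ k]) (force simp: u_def)
  qed
  ultimately show "?hs \<and> ?fs \<and> ?f0" by blast
next
  assume R: "?hs \<and> ?fs \<and> ?f0"
  have d: "series_data A hs fs" using sol by (simp add: formal_expanding_soliton_iff)
  \<comment> \<open>The constants of the several components, assembled into one locally constant
    function.\<close>
  define u where "u p = fs' 0 p - fs 0 p" for p
  have u: "\<exists>k. \<forall>p\<in>C. u p = k" if "C \<in> connected_components_of X" for C
    using R that unfolding u_def by (metis add_diff_cancel_left')
  have fs0: "fs' 0 = (\<lambda>p. fs 0 p + u p)" by (simp add: u_def fun_eq_iff)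
  have top: "chart_inv c y \<in> topspace X" if "c \<in> A" "y \<in> chart_image c" for c y
    using chart_inv_dom[OF that(2)] dom_topspace[OF that(1)] by blast
  show "formal_expanding_soliton A h hs' fs'"
  proof (rule soliton_change_f0[OF sol])
    \<comment> \<open>\<open>hs'\<close> is only known to agree with \<open>hs\<close> on the chart
      images, so the tensor properties are carried over pointwise there.\<close>
    have "sym_tensor_field A (hs' i)" for i
    proof -
      have T: "sym_tensor_field A (hs i)" by (rule data_h[OF d])
      have eq: "hs' i c x = hs i c x" if "c \<in> A" "x \<in> chart_image c" for c x using R that by blast
      have eqp: "hs' i c (chart_map c p) = hs i c (chart_map c p)" if "c \<in> A" "p \<in> chart_dom c" for c p
        using eq[OF that(1) chart_map_image[OF that(2)]] .
      have "smooth_on (chart_image c) (hs' i c)" if "c \<in> A" for c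
        by (rule smooth_on_cong[OF open_image[OF that], of "hs i c"]) (use eq[OF that] T that in \<open>auto simp: sym_tensor_field_def\<close>)
      then show ?thesis
        unfolding sym_tensor_field_def
      proof (intro conjI ballI allI)
        fix c x i' j assume "c \<in> A" "x \<in> chart_image c"
        then show "hs' i c x $ i' $ j = hs' i c x $ j $ i'" using tensor_sym[OF T] by (simp add: eq)
      next
        fix c e p a b assume ce: "c \<in> A" "e \<in> A" and p: "p \<in> chart_dom c \<inter> chart_dom e"
        have "hs' i e (chart_map e p) = hs i e (chart_map e p)" "hs' i c (chart_map c p) = hs i c (chart_map c p)"
          using eqp ce p by auto
        then show "hs' i e (chart_map e p) $ a $ b = (\<Sum>i'\<in>UNIV. \<Sum>j\<in>UNIV. hs' i c (chart_map c p) $ i' $ j *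
             partial_deriv a (transition c e) (chart_map e p) $ i' * partial_deriv b (transition c e) (chart_map e p) $ j)"
          using tensor_trans[OF T ce p, of a b] by (simp only:)
      qed
    qed
    moreover have "smooth_function A (fs' i)" for i
    proof (rule smooth_functionI)
      fix c assume c: "c \<in> A"
      show "smooth_on (chart_image c) (\<lambda>x. fs' i (chart_inv c x))"
      proof (cases "i = 0")
        case True
        show ?thesis unfolding True fs0
          by (intro smooth_on_add open_image c function_smooth data_f[OF d] locally_constant_smooth(1)[OF u])
      next
        case False
        show ?thesis
          by (rule smooth_on_cong[OF open_image[OF c] _ function_smooth[OF data_f[OF d, of i] c]])
             (use R False top[OF c] in simp)
      qed
    qed
    ultimately show "series_data A hs' fs'" by (simp add: series_data_def)
    show "partial_deriv l (\<lambda>y. fs' 0 (chart_inv c y)) x = 0" if c: "c \<in> A" and x: "x \<in> chart_image c" for c x l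
    proof -
      have "partial_deriv l (\<lambda>y. fs 0 (chart_inv c y) + u (chart_inv c y)) x = partial_deriv l (\<lambda>y. fs 0 (chart_inv c y)) x + partial_deriv l (\<lambda>y. u (chart_inv c y)) x"
        by (rule partial_deriv_add)
          (use smooth_on_differentiable[OF function_smooth[OF data_f[OF d] c] x] smooth_on_differentiable[OF locally_constant_smooth(1)[OF u c] x] in auto)
      then show ?thesis
        unfolding fs0 by (simp add: soliton_f0_partial[OF sol c x] locally_constant_smooth(2)[OF u c x])
    qed
  qed (use R in auto)
qed

text \<open>The state of the recursion before the coefficients of index \<open>n\<close> are chosen.
  The rr component is two orders ahead because f_2n acts on it at order 2n + 2, whereas h_2n acts on
  the tangential components at order 2n.\<close>

definition approx :: "nat \<Rightarrow> (nat \<Rightarrow> ('a, 'n) tensor2) \<times> (nat \<Rightarrow> 'a \<Rightarrow> real) \<Rightarrow> bool" where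
  "approx n s \<longleftrightarrow> series_data A (fst s) (snd s) \<and> snd s 0 = (\<lambda>p. 0) \<and>
     (\<forall>c\<in>A. \<forall>x\<in>chart_image c. fls_ge (2 * int n + 2) (chart_op h (fst s) (snd s) c None None x) \<and>
        (\<forall>j k. fls_ge (2 * int n) (chart_op h (fst s) (snd s) c (Some j) (Some k) x)))"

text \<open>The exact cone, with all further coefficients zero, satisfies \<open>E_rr_ge\<close> and
  \<open>E_jk_ge\<close>.\<close>

lemma approx_0: "\<exists>s. approx 0 s"
proof
  let ?s = "(\<lambda>_ _ _. 0, \<lambda>_ _. 0) :: (nat \<Rightarrow> ('a, 'n) tensor2) \<times> (nat \<Rightarrow> 'a \<Rightarrow> real)"
  have d: "series_data A (fst ?s) (snd ?s)"
    by (simp add: series_data_def sym_tensor_field_def smooth_function_def o_def)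
  have "fls_ge 2 (chart_op h (fst ?s) (snd ?s) c None None x) \<and> (\<forall>j k. fls_ge 0 (chart_op h (fst ?s) (snd ?s) c (Some j) (Some k) x))"
    if c: "c \<in> A" and x: "x \<in> chart_image c" for c x
  proof -
    interpret cone_chart "chart_image c" "h c" "tensor_series (fst ?s) c" "function_series (snd ?s) c" by (rule cone_chart[OF d c])
    show ?thesis
      using fls_ge_mono[OF E_rr_ge[OF x], of 2] E_jk_ge[OF x] unfolding chart_op_eq[OF d c] by simp
  qed
  then show "approx 0 ?s" using d by (simp add: approx_def)
qed

text \<open>Parity doubles the gain: removing one even coefficient raises the order by two.\<close>

lemma fls_ge_even_step:
  assumes "fls_ge (2 * m) F" "F $$ (2 * m) = 0" "\<And>k. odd k \<Longrightarrow> F $$ k = 0"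
  shows "fls_ge (2 * m + 2) F"
  unfolding fls_ge_def
proof (intro allI impI)
  fix k assume "k < 2 * m + 2"
  then consider "k < 2 * m" | "k = 2 * m" | "k = 2 * m + 1" by linarith
  then show "F $$ k = 0" using assms by cases (auto simp: fls_ge_def)
qed

text \<open>First f_2n removes the coefficient of X^(2n+2) in the rr component, then h_2n removes
  that of X^(2n) in the tangential ones. The order matters: f_2n can change the tangential
  coefficient, whereas h_2n reaches the rr component only beyond X^(2n+2).\<close>

lemma approx_Suc:
  assumes "approx n s"
  shows "\<exists>t. approx (Suc n) t \<and> (\<forall>i. i \<noteq> n \<longrightarrow> fst t i = fst s i \<and> snd t i = snd s i)"
proof -
  obtain hs fs where s: "s = (hs, fs)" by (cases s)
  have d: "series_data A hs fs" and f0: "fs 0 = (\<lambda>p. 0)"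
    and rr: "\<And>c x. c \<in> A \<Longrightarrow> x \<in> chart_image c \<Longrightarrow> fls_ge (2 * int n + 2) (chart_op h hs fs c None None x)"
    and jk: "\<And>c x j k. c \<in> A \<Longrightarrow> x \<in> chart_image c \<Longrightarrow> fls_ge (2 * int n) (chart_op h hs fs c (Some j) (Some k) x)"
    using assms by (auto simp: approx_def s)
  define w where "w c x = chart_op h hs fs c None None x $$ (2 * int n + 2)" for c x
  \<comment> \<open>By \<open>chart_op_trans\<close> the coefficient \<open>w\<close> does not
    depend on the chart, so any chart around \<open>p\<close> may be picked.\<close>
  define ch where "ch p = (SOME c. c \<in> A \<and> p \<in> chart_dom c)" for p
  define N where "N = 2 * real n * (2 * real n + 1)"
  \<comment> \<open>For n = 0 the constant \<open>N\<close> is 0 and division by it gives 0, so f_0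
    remains 0; by \<open>w0\<close> there is nothing to remove in this case.\<close>
  define \<psi> where "\<psi> p = fs n p - w (ch p) (chart_map (ch p) p) / N" for p
  define fs1 where "fs1 = fs(n := \<psi>)"
  have w0: "w c x = 0" if "n = 0" "c \<in> A" "x \<in> chart_image c" for c x
  proof -
    interpret cone_chart "chart_image c" "h c" "tensor_series hs c" "function_series fs c" by (rule cone_chart[OF d that(2)])
    show ?thesis using fls_geD[OF E_rr_ge[OF that(3)], of 2] that(1) unfolding w_def chart_op_eq[OF d that(2)] by simp
  qed
  have \<psi>: "\<psi> (chart_inv c x) = fs n (chart_inv c x) - w c x / N" if c: "c \<in> A" and x: "x \<in> chart_image c" for c x
  proof -
    let ?p = "chart_inv c x"
    have p: "?p \<in> chart_dom c" by (rule chart_inv_dom[OF x])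
    have "ch ?p \<in> A \<and> ?p \<in> chart_dom (ch ?p)"
      unfolding ch_def by (rule someI[of _ c]) (use c p in simp)
    then have "w (ch ?p) (chart_map (ch ?p) ?p) = w c (chart_map c ?p)"
      unfolding w_def using chart_op_trans(1)[OF d c, of "ch ?p" ?p] p by simp
    then show ?thesis by (simp add: \<psi>_def chart_map_inv[OF x])
  qed
  have "smooth_function A \<psi>"
  proof (rule smooth_functionI)
    fix c assume c: "c \<in> A"
    have "smooth_on (chart_image c) (\<lambda>x. fs n (chart_inv c x) + (- 1 / N) * w c x)"
      unfolding w_def by (intro smooth_on_add smooth_on_mult smooth_on_const function_smooth data_f[OF d] c open_image fls_smooth_on_nth chart_op_smooth d)
    then show "smooth_on (chart_image c) (\<lambda>x. \<psi> (chart_inv c x))"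
      by (rule smooth_on_cong[OF open_image[OF c], rotated]) (simp add: \<psi>[OF c])
  qed
  then have d1: "series_data A hs fs1" using d by (simp add: series_data_def fs1_def)
  have f01: "fs1 0 = (\<lambda>p. 0)" if "n \<noteq> 0" using that by (simp add: fs1_def f0)
  have rr1: "fls_ge (2 * int n + 4) (chart_op h hs fs1 c None None x)" and jk1: "fls_ge (2 * int n) (chart_op h hs fs1 c (Some j) (Some k) x)"
    if c: "c \<in> A" and x: "x \<in> chart_image c" for c x j k
  proof -
    note cmp = compare[OF d d1 c _ _ x, of n]
    have "fls_ge (2 * int n + 2) (chart_op h hs fs1 c None None x - chart_op h hs fs c None None x)"
      by (rule cmp(1)) (simp_all add: fs1_def)
    from fls_ge_add[OF this rr[OF c x]] have g: "fls_ge (2 * (int n + 1)) (chart_op h hs fs1 c None None x)" by simp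
    have "chart_op h hs fs1 c None None x $$ (2 * int n + 2) - w c x = N * (fs1 n (chart_inv c x) - fs n (chart_inv c x))"
      unfolding w_def N_def by (rule cmp(2)) (simp_all add: fs1_def)
    also have "\<dots> = - w c x"
    proof (cases "n = 0")
      case True
      then show ?thesis by (simp add: N_def w0[OF True c x])
    next
      case False
      then have "N \<noteq> 0" by (simp add: N_def add_nonneg_eq_0_iff)
      then show ?thesis by (simp add: fs1_def \<psi>[OF c x])
    qed
    finally have z: "chart_op h hs fs1 c None None x $$ (2 * (int n + 1)) = 0" by simp
    show "fls_ge (2 * int n + 4) (chart_op h hs fs1 c None None x)"
      using fls_ge_even_step[OF g z chart_op_parity(1)[OF d1 c x]] by (simp add: add.commute)
    have "fls_ge (2 * int n) (chart_op h hs fs1 c (Some j) (Some k) x - chart_op h hs fs c (Some j) (Some k) x)"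
      by (rule cmp(3)) (simp_all add: fs1_def)
    from fls_ge_add[OF this jk[OF c x, of j k]] show "fls_ge (2 * int n) (chart_op h hs fs1 c (Some j) (Some k) x)" by simp
  qed
  define v where "v c x j k = chart_op h hs fs1 c (Some j) (Some k) x $$ (2 * int n)" for c x j k
  \<comment> \<open>The reciprocal of the factor (n + 1)/2 in \<open>compare'\<close>.\<close>
  define M where "M = 2 / (real n + 1)"
  define T :: "('a, 'n) tensor2" where "T c x = (\<chi> j k. hs n c x $ j $ k - M * v c x j k)" for c x
  define hs2 where "hs2 = hs(n := T)"
  have "sym_tensor_field A T"
    unfolding sym_tensor_field_def
  proof (intro conjI ballI allI)
    fix c assume c: "c \<in> A"
    have "smooth_on (chart_image c) (\<lambda>x. hs n c x $ j $ k + (- M) * v c x j k)" for j k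
      unfolding v_def by (intro smooth_on_add smooth_on_mult smooth_on_const tensor_smooth data_h[OF d] c open_image fls_smooth_on_nth chart_op_smooth d1)
    then show "smooth_on (chart_image c) (T c)"
      by (simp add: smooth_on_vec_iff open_image c T_def)
    show "T c x $ i $ j = T c x $ j $ i" if x: "x \<in> chart_image c" for x i j
      using tensor_sym[OF data_h[OF d] c x, of n i j] chart_op_sym[OF d1 c x, of "Some i" "Some j"] by (simp add: T_def v_def)
  next
    fix c e p a b assume ce: "c \<in> A" "e \<in> A" and p: "p \<in> chart_dom c \<inter> chart_dom e"
    show "T e (chart_map e p) $ a $ b = (\<Sum>i\<in>UNIV. \<Sum>j\<in>UNIV. T c (chart_map c p) $ i $ j *
             partial_deriv a (transition c e) (chart_map e p) $ i * partial_deriv b (transition c e) (chart_map e p) $ j)"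
      unfolding T_def v_def
      by (simp add: tensor_trans[OF data_h[OF d] ce p] chart_op_trans(2)[OF d1 ce p] left_diff_distrib sum_subtractf sum_distrib_left mult.assoc)
  qed
  then have d2: "series_data A hs2 fs1" using d1 by (simp add: series_data_def hs2_def)
  have "approx (Suc n) (hs2, fs1)"
    unfolding approx_def fst_conv snd_conv
  proof (intro conjI ballI allI)
    show "series_data A hs2 fs1" by (rule d2)
    fix c x assume c: "c \<in> A" and x: "x \<in> chart_image c"
    note cmp = compare'[OF d1 d2 c _ _ x, of n]
    have "fls_ge (2 * int n + 3) (chart_op h hs2 fs1 c None None x - chart_op h hs fs1 c None None x)"
      by (rule cmp(1)) (simp_all add: hs2_def)
    from fls_ge_add[OF this fls_ge_mono[OF rr1[OF c x]]]
    have g: "fls_ge (2 * int n + 3) (chart_op h hs2 fs1 c None None x)" by simp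
    \<comment> \<open>Order 2n + 3 kills the even coefficient at 2n + 2, and parity then yields
      order 2n + 4, as \<open>approx (Suc n)\<close> demands.\<close>
    have "fls_ge (2 * (int n + 1)) (chart_op h hs2 fs1 c None None x)" by (rule fls_ge_mono[OF g]) simp
    moreover have "chart_op h hs2 fs1 c None None x $$ (2 * (int n + 1)) = 0" by (rule fls_geD[OF g]) simp
    ultimately have "fls_ge (2 * (int n + 1) + 2) (chart_op h hs2 fs1 c None None x)"
      using fls_ge_even_step chart_op_parity(1)[OF d2 c x] by blast
    then show "fls_ge (2 * int (Suc n) + 2) (chart_op h hs2 fs1 c None None x)" by (simp add: algebra_simps)
    fix j k
    have "fls_ge (2 * int n) (chart_op h hs2 fs1 c (Some j) (Some k) x - chart_op h hs fs1 c (Some j) (Some k) x)"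
      by (rule compare(3)[OF d1 d2 c _ _ x]) (simp_all add: hs2_def)
    from fls_ge_add[OF this jk1[OF c x, of j k]] have g: "fls_ge (2 * int n) (chart_op h hs2 fs1 c (Some j) (Some k) x)" by simp
    have "chart_op h hs2 fs1 c (Some j) (Some k) x $$ (2 * int n) - v c x j k = (real n + 1) / 2 * (hs2 n c x $ j $ k - hs n c x $ j $ k)"
      unfolding v_def by (rule cmp(2)) (simp_all add: hs2_def)
    also have "\<dots> = - v c x j k"
    proof -
      have "real n + 1 \<noteq> 0" by (metis of_nat_Suc of_nat_eq_0_iff Suc_not_Zero add.commute)
      then show ?thesis by (simp add: hs2_def T_def M_def)
    qed
    finally have "chart_op h hs2 fs1 c (Some j) (Some k) x $$ (2 * int n) = 0" by simp
    from fls_ge_even_step[OF g this chart_op_parity(2)[OF d2 c x]]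
    show "fls_ge (2 * int (Suc n)) (chart_op h hs2 fs1 c (Some j) (Some k) x)" by (simp add: algebra_simps)
  next
    show "fs1 0 = (\<lambda>p. 0)"
    proof (cases "n = 0")
      case True
      then show ?thesis by (simp add: fs1_def fun_eq_iff \<psi>_def N_def f0)
    qed (rule f01)
  qed
  moreover have "\<forall>i. i \<noteq> n \<longrightarrow> fst (hs2, fs1) i = fst s i \<and> snd (hs2, fs1) i = snd s i"
    by (simp add: s hs2_def fs1_def)
  ultimately show ?thesis by blast
qed

text \<open>The coefficient of index \<open>i\<close> is final from approximation
  \<open>Suc i\<close> on. The diagonal sequence agrees with approximation \<open>n\<close> below
  index \<open>n\<close>, so its rr and tangential components vanish to every order.\<close>

lemma existence: "\<exists>hs fs. formal_expanding_soliton A h hs fs"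
proof -
  obtain s where s: "\<And>n. approx n (s n)" and step: "\<And>n i. i \<noteq> n \<Longrightarrow> fst (s (Suc n)) i = fst (s n) i \<and> snd (s (Suc n)) i = snd (s n) i"
    using dependent_nat_choice[of approx "\<lambda>n s t. \<forall>i. i \<noteq> n \<longrightarrow> fst t i = fst s i \<and> snd t i = snd s i", OF approx_0 approx_Suc] by metis
  define hs where "hs i = fst (s (Suc i)) i" for i
  define fs where "fs i = snd (s (Suc i)) i" for i
  have stable: "fst (s (Suc i + m)) i = hs i \<and> snd (s (Suc i + m)) i = fs i" for i m
  proof (induction m)
    case (Suc m)
    have "i \<noteq> Suc i + m" by simp
    from step[OF this] Suc show ?case by simp
  qed (simp add: hs_def fs_def)
  have agree: "fst (s n) i = hs i \<and> snd (s n) i = fs i" if "i < n" for i n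
    using stable[of i "n - Suc i"] that by simp
  have dn: "series_data A (fst (s n)) (snd (s n))" for n using s by (simp add: approx_def)
  have d: "series_data A hs fs"
    unfolding series_data_def hs_def fs_def using dn by (simp add: series_data_def)
  have f0: "fs 0 = (\<lambda>p. 0)" unfolding fs_def using s[of "Suc 0"] by (simp add: approx_def)
  have rr: "chart_op h hs fs c None None x = 0" and jk: "chart_op h hs fs c (Some j) (Some k) x = 0"
    if c: "c \<in> A" and x: "x \<in> chart_image c" for c x j k
  proof -
    have ap: "fls_ge (2 * int n + 2) (chart_op h (fst (s n)) (snd (s n)) c None None x)"
      "fls_ge (2 * int n) (chart_op h (fst (s n)) (snd (s n)) c (Some j) (Some k) x)" for n
      using s[of n] c x by (simp_all add: approx_def)
    have 1: "fls_ge (2 * int n) (chart_op h hs fs c None None x)" for n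
    proof -
      have "fls_ge (2 * int n + 2) (chart_op h hs fs c None None x - chart_op h (fst (s n)) (snd (s n)) c None None x)"
        by (rule compare(1)[OF dn d c _ _ x]) (simp_all add: agree)
      from fls_ge_add[OF this ap(1)] have "fls_ge (2 * int n + 2) (chart_op h hs fs c None None x)" by simp
      then show ?thesis by (rule fls_ge_mono) simp
    qed
    have 2: "fls_ge (2 * int n) (chart_op h hs fs c (Some j) (Some k) x)" for n
    proof -
      have "fls_ge (2 * int n) (chart_op h hs fs c (Some j) (Some k) x - chart_op h (fst (s n)) (snd (s n)) c (Some j) (Some k) x)"
        by (rule compare(3)[OF dn d c _ _ x]) (simp_all add: agree)
      from fls_ge_add[OF this ap(2)] show ?thesis by simp
    qed
    have z: "F = 0" if "\<And>n. fls_ge (2 * int n) F" for F :: "real fls"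
    proof (rule fls_eqI)
      fix k
      have "k < 2 * int (nat (k + 1))" by linarith
      from fls_geD[OF that this] show "F $$ k = 0 $$ k" by simp
    qed
    show "chart_op h hs fs c None None x = 0" by (rule z[OF 1])
    show "chart_op h hs fs c (Some j) (Some k) x = 0" by (rule z[OF 2])
  qed
  have rl: "chart_op h hs fs c None (Some l) x = 0" if c: "c \<in> A" and x: "x \<in> chart_image c" for c x l
  proof -
    interpret cone_chart "chart_image c" "h c" "tensor_series hs c" "function_series fs c" by (rule cone_chart[OF d c])
    \<comment> \<open>With f_0 = 0 the coefficient of X vanishes by \<open>chart_op_rl_lead\<close>,
      so the exceptional order of \<open>E_rl_zero\<close> is excluded.\<close>
    have "E None (Some l) x = 0"
      using E_rl_zero[OF _ _ _ x] unfolding chart_op_eq[OF d c]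
      by (simp add: rr[OF c] jk[OF c] chart_op_rl_lead[OF d c] f0 partial_deriv_const)
    then show ?thesis unfolding chart_op_eq[OF d c] .
  qed
  have "chart_op h hs fs c a b x = 0" if c: "c \<in> A" and x: "x \<in> chart_image c" for c x a b
    using rr[OF c x] rl[OF c x] jk[OF c x] chart_op_sym[OF d c x, of a b] by (cases a; cases b) simp_all
  then show ?thesis
    using d unfolding formal_expanding_soliton_iff by (intro exI[of _ hs] exI[of _ fs]) blast
qed

end

theorem theorem1p2:
  fixes X :: "'a topology"
    and A :: "('a, 'n::finite) chart set"
    and h :: "('a, 'n) tensor2"
  assumes "smooth_manifold X A"
    and "compact_space X"
    and "riemannian_metric A h"
  shows "(\<exists>hs fs. formal_expanding_soliton A h hs fs) \<and>
    (\<forall>hs fs hs' fs'. formal_expanding_soliton A h hs fs \<longrightarrow>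
       (formal_expanding_soliton A h hs' fs' \<longleftrightarrow>
          (\<forall>i. \<forall>c\<in>A. \<forall>x\<in>chart_image c. hs' i c x = hs i c x) \<and>
          (\<forall>i\<ge>1. \<forall>p\<in>topspace X. fs' i p = fs i p) \<and>
          (\<forall>C\<in>connected_components_of X. \<exists>k. \<forall>p\<in>C. fs' 0 p = fs 0 p + k)))"
proof -
  interpret riemannian_manifold X A h
    by unfold_locales (use assms in auto)
  show ?thesis
    by (intro conjI existence allI impI uniqueness)
qed

end
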